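(* Let $\alpha>0$, let $X,Y,\tau_\alpha,\tau,\bar g,(\mathcal{G}_t)_{0\le t\le T}$ be as defined in the context, and let the instantaneous interest rate $(r_u)_{0\le u\le T}$ be deterministic. Let $$S_0=\mathbb{E}\Big[\exp\Big(-\int_0^T r_u\,du\Big)\mathbf{1}_{[\tau>T]}\,\Big|\,\mathcal{G}_0\Big]\mathbf{1}_{[\tau>0]}$$ be the time-$0$ price of the risky zero-coupon bond paying $1$ at time $T$ if no default has occurred by $T$ and $0$ otherwise. Then $$S_0=\exp\Big(-\int_0^T r_u\,du\Big)\left(1-\left(\mathbb{Q}[\tau_\alpha\le T]-\mathbb{E}\left[\frac{\alpha/\sqrt{2}}{\sqrt{T-\bar g_{\tau_\alpha}}}\,\mathbf{1}_{[\tau_\alpha\le T]}\right]\right)\right).$$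
   Context: Let $T>0$ and let $(\Omega,\mathcal{F},(\mathcal{F}_t)_{0\le t\le T},\mathbb{Q})$ be a filtered probability space satisfying the usual conditions, carrying a standard $(\mathcal{F}_t)$-Brownian motion $W$; $\mathbb{E}$ denotes expectation under $\mathbb{Q}$ (the risk-neutral measure). The firm's (normalized) cash balance process is $dX_t=\sigma\,dW_t$, $X_0=x$, normalized to $x=0$ and $\sigma=1$, so $X=W$. Time indices range over $[0,T]$, and $\inf\emptyset=\infty$. The rate $r$ is integrable on $[0,T]$. Define $g(t):=\sup\{s\le t: X_s=0\}$, with $g(t-)$ its left limit at $t$. For the constant $\alpha>0$ define $$\tau_\alpha:=\inf\Big\{t>0:\ t-g(t)\ge\tfrac{\alpha^2}{2},\ \text{where } X_s<0\text{ for } s\in(g(t-),t)\Big\},$$ the first time that $X$ has been continuously negative for at least $\alpha^2/2$ units of time. The default time is $$\tau:=\inf\{t>\tau_\alpha:\ X_t=2X_{\tau_\alpha}\}.$$ Define the process $Y$ by $Y_t=X_t$ for $t<\tau_\alpha$ and $Y_t=2X_{\tau_\alpha}-X_t$ for $t\ge\tau_\alpha$. ($Y$ is again an $(\mathcal{F}_t)$-Brownian motion and $\tau=\inf\{t\ge\tau_\alpha: Y_t=0\}$.) Put $\bar g_t:=\sup\{s\le t: Y_s=0\}$. Let $\operatorname{sign}(x)=1$ if $x>0$ and $\operatorname{sign}(x)=-1$ if $x\le 0$. Set $\tilde{\mathcal{G}}_t:=\sigma\{\operatorname{sign}(Y_s);\ s\le t\}$, and let $(\mathcal{G}_t)_{0\le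 t\le T}$ be the $\mathbb{Q}$-complete and right-continuous version of $(\tilde{\mathcal{G}}_t)_{0\le t\le T}$ (the market's filtration). *)

theory Defs
  imports "HOL-Probability.Probability"
begin

text \<open>
  Processes have type \<open>real \<Rightarrow> 'a \<Rightarrow> real\<close>, but only their values at times in \<open>[0,T]\<close> are ever
  constrained or used. Random times take values in \<^typ>\<open>ereal\<close>, where the infimum of the empty
  set is \<open>\<infinity>\<close>.
\<close>

locale usual_filtered_prob_space = prob_space M + complete_measure M
  for M :: "'a measure" +
  fixes F :: "real \<Rightarrow> 'a measure" and T :: real
  assumes subalg: "t \<in> {0..T} \<Longrightarrow> subalgebra M (F t)"
    and mono: "0 \<le> s \<Longrightarrow> s \<le> t \<Longrightarrow> t \<le> T \<Longrightarrow> sets (F s) \<subseteq> sets (F t)"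
    and null_sets_initial: "null_sets M \<subseteq> sets (F 0)"
    and right_continuous: "t \<in> {0..<T} \<Longrightarrow> sets (F t) = (\<Inter>s\<in>{t<..T}. sets (F s))"

locale std_brownian_motion = usual_filtered_prob_space M F T
  for M :: "'a measure" and F :: "real \<Rightarrow> 'a measure" and T :: real +
  fixes W :: "real \<Rightarrow> 'a \<Rightarrow> real"
  assumes adapted: "t \<in> {0..T} \<Longrightarrow> W t \<in> borel_measurable (F t)"
    and initial: "AE \<omega> in M. W 0 \<omega> = 0"
    and continuous_paths: "AE \<omega> in M. continuous_on {0..T} (\<lambda>t. W t \<omega>)"
    and increments_indep: "0 \<le> s \<Longrightarrow> s < t \<Longrightarrow> t \<le> T \<Longrightarrow>
      indep_set (sets (F s)) {(\<lambda>\<omega>. W t \<omega> - W s \<omega>) -` B \<inter> space M | B. B \<in> sets borel}"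
    and increments_normal: "0 \<le> s \<Longrightarrow> s < t \<Longrightarrow> t \<le> T \<Longrightarrow>
      distributed M lborel (\<lambda>\<omega>. W t \<omega> - W s \<omega>) (normal_density 0 (sqrt (t - s)))"

text \<open>The last zero before time \<open>t\<close>: this is \<open>g(t)\<close> for the cash balance \<open>X\<close> and \<open>\<bar>g\<^sub>t\<close> for \<open>Y\<close>.\<close>

definition last_zero :: "(real \<Rightarrow> 'a \<Rightarrow> real) \<Rightarrow> real \<Rightarrow> 'a \<Rightarrow> real" where
  "last_zero Z t \<omega> = Sup {s \<in> {0..t}. Z s \<omega> = 0}"

definition last_zero_left :: "(real \<Rightarrow> 'a \<Rightarrow> real) \<Rightarrow> real \<Rightarrow> 'a \<Rightarrow> real" where
  "last_zero_left Z t \<omega> = Lim (at_left t) (\<lambda>s. last_zero Z s \<omega>)"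

definition tau_alpha :: "real \<Rightarrow> real \<Rightarrow> (real \<Rightarrow> 'a \<Rightarrow> real) \<Rightarrow> 'a \<Rightarrow> ereal" where
  "tau_alpha T \<alpha> X \<omega> = Inf (ereal ` {t \<in> {0<..T}.
     t - last_zero X t \<omega> \<ge> \<alpha>\<^sup>2 / 2 \<and> (\<forall>s\<in>{last_zero_left X t \<omega><..<t}. X s \<omega> < 0)})"

text \<open>
  \<^const>\<open>real_of_ereal\<close> maps \<open>\<infinity>\<close> to \<open>0\<close>, but in the two definitions below (and in the price formula,
  on \<open>\<tau>\<^sub>\<alpha> \<le> T\<close>) it is only relevant when \<open>\<tau>\<^sub>\<alpha>\<close> is finite.
\<close>

definition default_time :: "real \<Rightarrow> real \<Rightarrow> (real \<Rightarrow> 'a \<Rightarrow> real) \<Rightarrow> 'a \<Rightarrow> ereal" where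
  "default_time T \<alpha> X \<omega> = Inf (ereal ` {t \<in> {0..T}.
     tau_alpha T \<alpha> X \<omega> < ereal t \<and> X t \<omega> = 2 * X (real_of_ereal (tau_alpha T \<alpha> X \<omega>)) \<omega>})"

definition reflected :: "real \<Rightarrow> real \<Rightarrow> (real \<Rightarrow> 'a \<Rightarrow> real) \<Rightarrow> real \<Rightarrow> 'a \<Rightarrow> real" where
  "reflected T \<alpha> X t \<omega> =
     (if ereal t < tau_alpha T \<alpha> X \<omega> then X t \<omega>
      else 2 * X (real_of_ereal (tau_alpha T \<alpha> X \<omega>)) \<omega> - X t \<omega>)"

text \<open>Unlike the library's \<^const>\<open>sgn\<close>, this takes the value \<open>-1\<close> at \<open>0\<close>.\<close>

definition sign_left :: "real \<Rightarrow> real" where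
  "sign_left x = (if x > 0 then 1 else - 1)"

definition sign_sigma :: "'a measure \<Rightarrow> (real \<Rightarrow> 'a \<Rightarrow> real) \<Rightarrow> real \<Rightarrow> 'a measure" where
  "sign_sigma M Y t = sigma (space M)
     (\<Union>s\<in>{0..t}. {(\<lambda>\<omega>. sign_left (Y s \<omega>)) -` B \<inter> space M | B. B \<in> sets borel})"

text \<open>Augmentation by the null sets of \<open>M\<close>; on a complete space these are all negligible sets.\<close>

definition sign_sigma_complete :: "'a measure \<Rightarrow> (real \<Rightarrow> 'a \<Rightarrow> real) \<Rightarrow> real \<Rightarrow> 'a measure" where
  "sign_sigma_complete M Y t = sigma (space M) (sets (sign_sigma M Y t) \<union> null_sets M)"

definition market_filtration ::
  "'a measure \<Rightarrow> real \<Rightarrow> (real \<Rightarrow> 'a \<Rightarrow> real) \<Rightarrow> real \<Rightarrow> 'a measure" where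
  "market_filtration M T Y t =
     (if t < T then sigma (space M) (\<Inter>s\<in>{t<..T}. sets (sign_sigma_complete M Y s))
      else sign_sigma_complete M Y T)"

end

(*
  Let d = alpha^2 / 2 and let a be the start of the first negative excursion of X that lasts d, so
  that tau_alpha = a + d and gbar at tau_alpha is a. By the reflection principle a Brownian motion
  at distance y from 0 avoids 0 for time u with probability psi (y / sqrt u), where
  psi y = P(|N(0,1)| < y). Let t be the first grid time inside that excursion. Whether t is such a
  time is known at t except for the event that X stays negative on [t, t + d]; reflecting X at t + d
  therefore shows that no default occurs before T with conditional probability
  psi (|X_t| / sqrt (T - t)) / psi (|X_t| / sqrt d). As the mesh shrinks, t tends to a and X_t to 0,
  and since psi is asymptotically linear at 0 the ratio tends to sqrt d / sqrt (T - a). This uses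
  only the Markov property at deterministic times. Finally G_0 is contained in F_0, because Y = X
  before time d, and F_0 is independent of the whole path.
*)

theory Submission
  imports Defs
begin

section \<open>Long negative excursions of a path\<close>

text \<open>The start \<open>a\<close> of the excursion is not a stopping time, so the Markov
  property cannot be applied there; hence the detour over grid times. On the event that X is
  negative on [t, t + d], no default means that X - X_{t+d} stays above X_{t+d}, which after a
  change of sign of the increments means that X stays negative up to T. This yields psi(|X_t| / sqrt
  (T - t)), integrated over an event known at t. Written as the ratio times psi(|X_t| / sqrt d),
  with the second factor read back as negativity on [t, t + d], it becomes an integral over the grid
  event itself, and its integrand has a limit. Two boundary effects remain. The default indicator
  may jump in the limit when the path touches the default level without crossing it, so this is
  shown to have probability 0. If a + d = T, no grid time detects the run; there the weight is sqrt
  d / sqrt d = 1 and cancels the contribution of the run to the probability of tau_alpha being at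
  most T.\<close>

text \<open>The right end \<open>a + d\<close> belongs to the negative stretch because a time at
  which the path vanishes is its own last zero and fails the length condition in
  \<open>tau_alpha\<close>.\<close>

definition neg_runs :: "real \<Rightarrow> real \<Rightarrow> (real \<Rightarrow> real) \<Rightarrow> real set" where
  "neg_runs T d x = {a \<in> {0..T - d}. x a = 0 \<and> (\<forall>s\<in>{a<..a + d}. x s < 0)}"

text \<open>A relation rather than a function, so that paths without a long negative excursion need
  no default value.\<close>

definition first_run :: "real \<Rightarrow> real \<Rightarrow> (real \<Rightarrow> real) \<Rightarrow> real \<Rightarrow> bool" where
  "first_run T d x a \<longleftrightarrow> a \<in> neg_runs T d x \<and> (\<forall>b\<in>neg_runs T d x. a \<le> b)"

lemma first_run_unique: "first_run T d x a \<Longrightarrow> first_run T d x b \<Longrightarrow> a = b"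
  unfolding first_run_def by (meson antisym)

lemma last_zero_eqI:
  assumes "0 \<le> a" "a \<le> t" "Z a \<omega> = 0" "\<And>s. a < s \<Longrightarrow> s \<le> t \<Longrightarrow> Z s \<omega> \<noteq> 0"
  shows "last_zero Z t \<omega> = a"
  unfolding last_zero_def
proof (rule cSup_eq_maximum)
  show "a \<in> {s \<in> {0..t}. Z s \<omega> = 0}" using assms by auto
  show "\<And>s. s \<in> {s \<in> {0..t}. Z s \<omega> = 0} \<Longrightarrow> s \<le> a" using assms(4) by force
qed

lemma last_zero_left_eqI:
  assumes "0 \<le> a" "a < t" "Z a \<omega> = 0" "\<And>s. a < s \<Longrightarrow> s < t \<Longrightarrow> Z s \<omega> \<noteq> 0"
  shows "last_zero_left Z t \<omega> = a"
  unfolding last_zero_left_def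
proof (rule tendsto_Lim)
  show "at_left t \<noteq> bot" by simp
  have "\<forall>\<^sub>F s in at_left t. s \<in> {a<..<t}"
    using assms(2) by (intro eventually_at_leftI) auto
  hence "\<forall>\<^sub>F s in at_left t. last_zero Z s \<omega> = a"
    by eventually_elim (use assms in \<open>auto intro!: last_zero_eqI\<close>)
  thus "((\<lambda>s. last_zero Z s \<omega>) \<longlongrightarrow> a) (at_left t)" by (rule tendsto_eventually)
qed

lemma neg_between:
  fixes x :: "real \<Rightarrow> real"
  assumes cont: "continuous_on {p..q} x" and nz: "\<And>s. s \<in> {p<..q} \<Longrightarrow> x s \<noteq> 0"
    and neg: "x c < 0" "c \<in> {p<..q}" and s: "s \<in> {p<..q}"
  shows "x s < 0"
proof (rule ccontr)
  assume "\<not> x s < 0"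
  hence pos: "x s \<ge> 0" by simp
  have "connected (x ` {min s c..max s c})"
    using s neg by (intro connected_continuous_image continuous_on_subset[OF cont]) auto
  moreover have "x s \<in> x ` {min s c..max s c}" "x c \<in> x ` {min s c..max s c}" by auto
  ultimately have "0 \<in> x ` {min s c..max s c}"
    using pos neg(1) unfolding connected_iff_interval by (meson less_imp_le)
  then obtain u where "u \<in> {min s c..max s c}" "x u = 0" by auto
  moreover from this(1) have "u \<in> {p<..q}" using s neg by auto
  ultimately show False using nz by blast
qed

lemma neg_run_start:
  fixes x :: "real \<Rightarrow> real"
  assumes cont: "continuous_on {0..T} x" and x0: "x 0 = 0" and p: "0 \<le> p" "p \<le> T" and neg: "x p < 0"
  obtains a where "0 \<le> a" "a < p" "x a = 0" "\<And>s. s \<in> {a<..p} \<Longrightarrow> x s < 0"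
proof -
  have cont': "continuous_on {0..p} x" using cont p by (auto intro: continuous_on_subset)
  have "closed ({0..p} \<inter> x -` {0})"
    by (intro continuous_closed_preimage cont') auto
  moreover have "bounded ({0..p} \<inter> x -` {0})" by (rule bounded_subset[of "{0..p}"]) auto
  ultimately have "compact ({0..p} \<inter> x -` {0})" by (simp add: compact_eq_bounded_closed)
  moreover have "0 \<in> {0..p} \<inter> x -` {0}" using x0 p by auto
  ultimately obtain a where a: "a \<in> {0..p} \<inter> x -` {0}" "\<And>s. s \<in> {0..p} \<inter> x -` {0} \<Longrightarrow> s \<le> a"
    by (metis compact_attains_sup empty_iff)
  have ap: "a < p" using a(1) neg by (metis Int_iff atLeastAtMost_iff less_eq_real_def less_irrefl vimage_singleton_eq)
  have "x s < 0" if "s \<in> {a<..p}" for s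
  proof (rule neg_between[where x=x, OF _ _ neg _ that])
    show "continuous_on {a..p} x" using cont' a(1) by (auto intro: continuous_on_subset)
    show "x s \<noteq> 0" if "s \<in> {a<..p}" for s using a(1) a(2)[of s] that by auto
    show "p \<in> {a<..p}" using ap by simp
  qed
  thus ?thesis using that a(1) ap by auto
qed

text \<open>Two starts are more than \<open>d\<close> apart: the later one is a zero, and the path
  is negative for time \<open>d\<close> after the earlier one. Hence a start within \<open>d\<close>
  of the infimum is already the least.\<close>

lemma first_run_ex:
  assumes d: "d > 0" and ne: "neg_runs T d x \<noteq> {}"
  obtains a where "first_run T d x a"
proof -
  let ?R = "neg_runs T d x"
  have sep: "a + d < b" if "a \<in> ?R" "b \<in> ?R" "a < b" for a b
    using that unfolding neg_runs_def by force
  have bdd: "bdd_below ?R" unfolding neg_runs_def by (rule bdd_belowI[of _ 0]) auto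
  obtain a where a: "a \<in> ?R" "a < Inf ?R + d"
    using cInf_lessD[OF ne, of "Inf ?R + d"] d by auto
  have "a \<le> b" if "b \<in> ?R" for b
  proof (rule ccontr)
    assume "\<not> a \<le> b"
    with sep[OF that a(1)] cInf_lower[OF that bdd] a(2) show False using d by simp
  qed
  thus ?thesis using that a(1) unfolding first_run_def by blast
qed

section \<open>The random times of the model in terms of excursions\<close>

text \<open>After its last zero \<open>a\<close> a continuous path keeps one sign up to
  \<open>t\<close>, so the length and sign conditions at \<open>t\<close> say together that
  \<open>t\<close> lies in a negative excursion of age at least \<open>d\<close>.\<close>

lemma tau_alpha_set_eq:
  assumes cont: "continuous_on {0..T} (\<lambda>t. X t \<omega>)" and x0: "X 0 \<omega> = 0" and d: "0 < d"
  shows "t \<in> {0<..T} \<and> t - last_zero X t \<omega> \<ge> d \<and> (\<forall>s\<in>{last_zero_left X t \<omega><..<t}. X s \<omega> < 0)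
    \<longleftrightarrow> (\<exists>a\<in>neg_runs T d (\<lambda>t. X t \<omega>). a + d \<le> t \<and> t \<le> T \<and> (\<forall>s\<in>{a<..t}. X s \<omega> < 0))"
    (is "?L \<longleftrightarrow> ?R")
proof
  assume ?L
  hence t: "0 < t" "t \<le> T" and len: "t - last_zero X t \<omega> \<ge> d"
    and neg: "\<And>s. s \<in> {last_zero_left X t \<omega><..<t} \<Longrightarrow> X s \<omega> < 0" by auto
  define Z where "Z = {s \<in> {0..t}. X s \<omega> = 0}"
  have cont': "continuous_on {0..t} (\<lambda>t. X t \<omega>)" using cont t by (auto intro: continuous_on_subset)
  have "Z = {0..t} \<inter> (\<lambda>t. X t \<omega>) -` {0}" unfolding Z_def by auto
  hence "closed Z" using continuous_closed_preimage[OF cont'] by simp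
  moreover have Z0: "0 \<in> Z" using x0 t by (auto simp: Z_def)
  moreover have bdd: "bdd_above Z" by (rule bdd_aboveI[of _ t]) (auto simp: Z_def)
  ultimately have aZ: "Sup Z \<in> Z" by (intro closed_contains_Sup) auto
  define a where "a = Sup Z"
  have a: "0 \<le> a" "a \<le> t" "X a \<omega> = 0" using aZ by (auto simp: a_def Z_def)
  have nz: "X s \<omega> \<noteq> 0" if "a < s" "s \<le> t" for s
    using cSup_upper[OF _ bdd, of s] that a(1) by (force simp: a_def Z_def)
  have "last_zero X t \<omega> = a" using a nz by (intro last_zero_eqI) auto
  with len have at: "a + d \<le> t" by simp
  \<comment> \<open>At all times between \<open>a\<close> and \<open>t\<close> the last zero is
    already \<open>a\<close>, so the left limit is \<open>a\<close> too and the sign condition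
    covers the whole open interval.\<close>
  have "last_zero_left X t \<omega> = a" using a nz at d by (intro last_zero_left_eqI) auto
  \<comment> \<open>The midpoint is an arbitrary sample: one negative value fixes the sign on the
    zero-free interval, including the end \<open>t\<close> that the sign condition leaves
    out.\<close>
  with neg have neg': "X ((a + t) / 2) \<omega> < 0" using at d by simp
  have "X s \<omega> < 0" if "s \<in> {a<..t}" for s
  proof (rule neg_between[where x="\<lambda>t. X t \<omega>", OF _ _ neg' _ that])
    show "continuous_on {a..t} (\<lambda>t. X t \<omega>)" using cont' a by (auto intro: continuous_on_subset)
  qed (use nz at d in auto)
  thus ?R using a at t unfolding neg_runs_def by (intro bexI[of _ a]) auto
next
  assume ?R
  then obtain a where a: "0 \<le> a" "X a \<omega> = 0" "a + d \<le> t" "t \<le> T" and neg: "\<And>s. s \<in> {a<..t} \<Longrightarrow> X s \<omega> < 0"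
    unfolding neg_runs_def by auto
  have "last_zero X t \<omega> = a" using a d neg by (intro last_zero_eqI) force+
  moreover have "last_zero_left X t \<omega> = a" using a d neg by (intro last_zero_left_eqI) force+
  ultimately show ?L using a d neg by auto
qed

lemma tau_alpha_cases:
  assumes cont: "continuous_on {0..T} (\<lambda>t. X t \<omega>)" and x0: "X 0 \<omega> = 0" and d: "d = \<alpha>\<^sup>2 / 2" "0 < d"
  shows "first_run T d (\<lambda>t. X t \<omega>) a \<Longrightarrow> tau_alpha T \<alpha> X \<omega> = ereal (a + d)"
    and "neg_runs T d (\<lambda>t. X t \<omega>) = {} \<Longrightarrow> tau_alpha T \<alpha> X \<omega> = \<infinity>"
proof -
  let ?S = "{t \<in> {0<..T}. t - last_zero X t \<omega> \<ge> \<alpha>\<^sup>2 / 2 \<and> (\<forall>s\<in>{last_zero_left X t \<omega><..<t}. X s \<omega> < 0)}"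
  have S: "?S = {t. \<exists>a\<in>neg_runs T d (\<lambda>t. X t \<omega>). a + d \<le> t \<and> t \<le> T \<and> (\<forall>s\<in>{a<..t}. X s \<omega> < 0)}"
    using tau_alpha_set_eq[where X=X and \<omega>=\<omega>, OF cont x0 d(2)] d(1) by blast
  show "tau_alpha T \<alpha> X \<omega> = ereal (a + d)" if "first_run T d (\<lambda>t. X t \<omega>) a"
    unfolding tau_alpha_def S
  proof (intro antisym Inf_lower Inf_greatest)
    show "ereal (a + d) \<in> ereal ` {t. \<exists>a\<in>neg_runs T d (\<lambda>t. X t \<omega>). a + d \<le> t \<and> t \<le> T \<and> (\<forall>s\<in>{a<..t}. X s \<omega> < 0)}"
      using that unfolding first_run_def neg_runs_def by (intro imageI) auto
    show "ereal (a + d) \<le> t"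
      if "t \<in> ereal ` {t. \<exists>a\<in>neg_runs T d (\<lambda>t. X t \<omega>). a + d \<le> t \<and> t \<le> T \<and> (\<forall>s\<in>{a<..t}. X s \<omega> < 0)}" for t
      using that \<open>first_run T d (\<lambda>t. X t \<omega>) a\<close> unfolding first_run_def by force
  qed
  show "tau_alpha T \<alpha> X \<omega> = \<infinity>" if "neg_runs T d (\<lambda>t. X t \<omega>) = {}"
    unfolding tau_alpha_def S using that by (simp add: top_ereal_def)
qed

text \<open>At \<open>a + d\<close> the path is negative, hence strictly above the level
  \<open>2 * X (a + d)\<close>. By continuity it avoids the level exactly if it stays above it. The
  time \<open>a + d\<close> itself satisfies the strict inequality automatically, so the closed
  interval agrees with the strict condition in \<open>default_time\<close>.\<close>

lemma default_time_cases:
  assumes cont: "continuous_on {0..T} (\<lambda>t. X t \<omega>)" and x0: "X 0 \<omega> = 0" and d: "d = \<alpha>\<^sup>2 / 2" "0 < d"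
  shows "default_time T \<alpha> X \<omega> > 0"
    and "first_run T d (\<lambda>t. X t \<omega>) a \<Longrightarrow>
      default_time T \<alpha> X \<omega> > ereal T \<longleftrightarrow> (\<forall>u\<in>{a + d..T}. X u \<omega> > 2 * X (a + d) \<omega>)"
    and "neg_runs T d (\<lambda>t. X t \<omega>) = {} \<Longrightarrow> default_time T \<alpha> X \<omega> > ereal T"
proof -
  let ?D = "{t \<in> {0..T}. tau_alpha T \<alpha> X \<omega> < ereal t \<and> X t \<omega> = 2 * X (real_of_ereal (tau_alpha T \<alpha> X \<omega>)) \<omega>}"
  show none: "default_time T \<alpha> X \<omega> > ereal T" if "neg_runs T d (\<lambda>t. X t \<omega>) = {}"
    using tau_alpha_cases(2)[where X=X and \<omega>=\<omega>, OF cont x0 d that] unfolding default_time_def by (simp add: top_ereal_def)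
  show iff: "default_time T \<alpha> X \<omega> > ereal T \<longleftrightarrow> (\<forall>u\<in>{a + d..T}. X u \<omega> > 2 * X (a + d) \<omega>)"
    if a: "first_run T d (\<lambda>t. X t \<omega>) a" for a
  proof -
    have tau: "tau_alpha T \<alpha> X \<omega> = ereal (a + d)" by (rule tau_alpha_cases(1)[where X=X and \<omega>=\<omega>, OF cont x0 d a])
    have aT: "0 \<le> a" "a + d \<le> T" "X (a + d) \<omega> < 0"
      using a d(2) unfolding first_run_def neg_runs_def by auto
    have D: "?D = {t \<in> {0..T}. a + d < t \<and> X t \<omega> = 2 * X (a + d) \<omega>}" by (simp add: tau)
    have "default_time T \<alpha> X \<omega> > ereal T \<longleftrightarrow> ?D = {}"
    proof (cases "?D = {}")
      case True thus ?thesis unfolding default_time_def True by (simp add: top_ereal_def)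
    next
      case False
      then obtain t where "t \<in> ?D" by blast
      hence "default_time T \<alpha> X \<omega> \<le> ereal t" "t \<le> T" unfolding default_time_def by (auto intro!: Inf_lower)
      thus ?thesis using False by (meson ereal_less_eq(3) leD order_trans)
    qed
    also have "\<dots> \<longleftrightarrow> (\<forall>u\<in>{a + d..T}. X u \<omega> > 2 * X (a + d) \<omega>)" (is "?A \<longleftrightarrow> ?B")
    proof
      assume ?A
      show ?B
      proof (rule ccontr)
        assume "\<not> ?B"
        then obtain u where u: "u \<in> {a + d..T}" "X u \<omega> \<le> 2 * X (a + d) \<omega>" by force
        have "\<exists>t\<ge>a + d. t \<le> u \<and> X t \<omega> = 2 * X (a + d) \<omega>"
          using u aT d(2) by (intro IVT2' continuous_on_subset[OF cont]) auto
        then obtain t where t: "t \<ge> a + d" "t \<le> u" "X t \<omega> = 2 * X (a + d) \<omega>" by blast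
        moreover have "t \<noteq> a + d" using t(3) aT(3) by auto
        ultimately have "t \<in> ?D" using aT u d(2) by (auto simp: tau)
        with \<open>?A\<close> show False by blast
      qed
    next
      assume ?B
      hence "X t \<omega> > 2 * X (a + d) \<omega>" if "a + d < t" "t \<le> T" for t using that by auto
      thus ?A unfolding D by fastforce
    qed
    finally show ?thesis .
  qed
  have "default_time T \<alpha> X \<omega> \<ge> tau_alpha T \<alpha> X \<omega>"
    unfolding default_time_def by (intro Inf_greatest) auto
  moreover have "tau_alpha T \<alpha> X \<omega> > 0"
  proof (cases "neg_runs T d (\<lambda>t. X t \<omega>) = {}")
    case True thus ?thesis using tau_alpha_cases(2)[where X=X and \<omega>=\<omega>, OF cont x0 d True] by simp
  next
    case False
    then obtain a where a: "first_run T d (\<lambda>t. X t \<omega>) a" using first_run_ex d(2) by blast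
    thus ?thesis using tau_alpha_cases(1)[where X=X and \<omega>=\<omega>, OF cont x0 d a] d(2)
      unfolding first_run_def neg_runs_def by auto
  qed
  ultimately show "default_time T \<alpha> X \<omega> > 0" by simp
qed

text \<open>Reflection changes nothing up to and including \<open>a + d\<close>, since there 2x - x
  = x. So the last zero is that of the original path.\<close>

lemma last_zero_reflected:
  assumes cont: "continuous_on {0..T} (\<lambda>t. X t \<omega>)" and x0: "X 0 \<omega> = 0" and d: "d = \<alpha>\<^sup>2 / 2" "0 < d"
    and a: "first_run T d (\<lambda>t. X t \<omega>) a"
  shows "last_zero (reflected T \<alpha> X) (real_of_ereal (tau_alpha T \<alpha> X \<omega>)) \<omega> = a"
proof -
  have tau: "tau_alpha T \<alpha> X \<omega> = ereal (a + d)" by (rule tau_alpha_cases(1)[where X=X and \<omega>=\<omega>, OF cont x0 d a])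
  have R: "0 \<le> a" "X a \<omega> = 0" "\<And>s. s \<in> {a<..a + d} \<Longrightarrow> X s \<omega> < 0"
    using a unfolding first_run_def neg_runs_def by auto
  show ?thesis unfolding tau real_of_ereal.simps
  proof (rule last_zero_eqI)
    show "reflected T \<alpha> X a \<omega> = 0" using R d by (simp add: reflected_def tau)
    show "reflected T \<alpha> X s \<omega> \<noteq> 0" if "a < s" "s \<le> a + d" for s
      using R(3)[of s] R(3)[of "a+d"] that d(2)
      by (cases "s < a + d") (auto simp: reflected_def tau)
  qed (use R d in auto)
qed

text \<open>Replaces the uncountable choice of \<open>a\<close> by a countable one. Strictness of
  \<open>a + d < t\<close> and continuity at \<open>a + d\<close> leave room for a rational interval
  longer than \<open>d\<close>; conversely such an interval lies in an excursion that starts before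
  \<open>p\<close>, so its first \<open>d\<close> time units end before \<open>q\<close>.\<close>

lemma run_before_iff:
  fixes x :: "real \<Rightarrow> real"
  assumes cont: "continuous_on {0..T} x" and x0: "x 0 = 0" and d: "0 < d" and t: "t \<le> T"
  shows "(\<exists>a\<in>neg_runs T d x. a + d < t) \<longleftrightarrow>
    (\<exists>p\<in>\<rat>. \<exists>q\<in>\<rat>. 0 \<le> p \<and> q \<le> t \<and> d < q - p \<and> (\<forall>s\<in>{p..q}. x s < 0))" (is "?L \<longleftrightarrow> ?R")
proof
  assume ?L
  then obtain a where a: "0 \<le> a" "a + d < t" "x a = 0" "\<And>s. s \<in> {a<..a + d} \<Longrightarrow> x s < 0"
    unfolding neg_runs_def by auto
  have "continuous (at (a + d) within {0..T}) x"
    using cont a d t by (auto simp: continuous_on_eq_continuous_within)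
  moreover have "x (a + d) < 0" using a d by auto
  ultimately have "\<forall>\<^sub>F s in at (a + d) within {0..T}. x s < 0"
    unfolding continuous_within by (rule order_tendstoD(2))
  then obtain e where e: "e > 0" "\<And>s. s \<in> {0..T} \<Longrightarrow> s \<noteq> a + d \<Longrightarrow> dist s (a + d) < e \<Longrightarrow> x s < 0"
    unfolding eventually_at by blast
  \<comment> \<open>The room available after \<open>a + d\<close>: up to \<open>t\<close>, and as
    long as continuity keeps the path negative.\<close>
  define m where "m = min (t - (a + d)) e"
  have m: "m > 0" using a e unfolding m_def by auto
  obtain p where p: "p \<in> \<rat>" "a < p" "p < a + m / 2" using m Rats_dense_in_real[of a "a + m/2"] by auto
  obtain q where q: "q \<in> \<rat>" "p + d < q" "q < a + d + m" using p m Rats_dense_in_real[of "p + d" "a + d + m"] by auto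
  have "x s < 0" if "s \<in> {p..q}" for s
  proof (cases "s \<le> a + d")
    case True thus ?thesis using a p that by auto
  next
    case False
    thus ?thesis using that q a t d p by (intro e(2)) (auto simp: m_def dist_real_def)
  qed
  thus ?R using p q a by (intro bexI[of _ p] bexI[of _ q]) (auto simp: m_def)
next
  assume ?R
  then obtain p q where pq: "0 \<le> p" "q \<le> t" "d < q - p" and neg: "\<And>s. s \<in> {p..q} \<Longrightarrow> x s < 0" by blast
  obtain a where a: "0 \<le> a" "a < p" "x a = 0" "\<And>s. s \<in> {a<..p} \<Longrightarrow> x s < 0"
    using neg_run_start[OF cont x0, of p] pq d t neg[of p] by auto
  have "x s < 0" if "s \<in> {a<..a + d}" for s
    using a(4)[of s] neg[of s] that pq a by (cases "s \<le> p") auto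
  thus ?L using a pq t by (intro bexI[of _ a]) (auto simp: neg_runs_def)
qed

section \<open>The standard normal law\<close>

text \<open>As a function of v / sqrt u this is the probability that a Brownian motion rises by less
  than v during time u. For y at most 0 the interval is empty and the value 0, which lets the
  reflection formula hold for barriers of any sign.\<close>

definition psi :: "real \<Rightarrow> real" where
  "psi y = measure std_normal_distribution {- y<..<y}"

lemma measure_std_normal_upper:
  assumes "a \<le> b"
  shows "measure std_normal_distribution {a..b} \<le> (b - a) / sqrt (2 * pi)"
proof -
  interpret N: real_distribution std_normal_distribution by (rule real_dist_normal_dist)
  have "emeasure std_normal_distribution {a..b} = (\<integral>\<^sup>+x. std_normal_density x * indicator {a..b} x \<partial>lborel)"
    by (subst emeasure_density) (auto intro!: nn_integral_cong simp: indicator_def)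
  also have "\<dots> \<le> (\<integral>\<^sup>+x. ennreal (1 / sqrt (2 * pi)) * indicator {a..b} x \<partial>lborel)"
    by (intro nn_integral_mono) (auto simp: std_normal_density_def indicator_def intro!: ennreal_leI divide_right_mono)
  also have "\<dots> = ennreal ((b - a) / sqrt (2 * pi))"
    using assms by (subst nn_integral_cmult_indicator) (auto simp: ennreal_mult[symmetric])
  finally show ?thesis using assms
    by (simp add: N.emeasure_eq_measure)
qed

lemma measure_std_normal_uminus:
  assumes "B \<in> sets borel"
  shows "measure std_normal_distribution (uminus -` B) = measure std_normal_distribution B"
proof -
  have [measurable]: "B \<in> sets borel" by fact
  have m: "uminus -` B \<in> sets borel" using measurable_sets[of uminus borel borel B] by simp
  have "emeasure std_normal_distribution (uminus -` B) = (\<integral>\<^sup>+x. std_normal_density x * indicator (uminus -` B) x \<partial>lborel)"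
    using m by (subst emeasure_density) (auto intro!: nn_integral_cong simp: indicator_def)
  also have "\<dots> = (\<integral>\<^sup>+x. std_normal_density (- x) * indicator B (- x) \<partial>lborel)"
    by (intro nn_integral_cong) (auto simp: std_normal_density_def indicator_def)
  also have "\<dots> = (\<integral>\<^sup>+x. std_normal_density x * indicator B x \<partial>(distr lborel borel uminus))"
    by (subst nn_integral_distr) auto
  also have "\<dots> = emeasure std_normal_distribution B"
    by (subst emeasure_density) (auto intro!: nn_integral_cong simp: lborel_distr_uminus indicator_def)
  finally show ?thesis by (simp add: measure_def)
qed

lemma psi_nonpos: "y \<le> 0 \<Longrightarrow> psi y = 0"
  unfolding psi_def by simp

lemma psi_nonneg [simp]: "psi y \<ge> 0"
  unfolding psi_def by simp

lemma psi_mono: "y \<le> z \<Longrightarrow> psi y \<le> psi z"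
proof -
  interpret N: real_distribution std_normal_distribution by (rule real_dist_normal_dist)
  show "y \<le> z \<Longrightarrow> psi y \<le> psi z"
    unfolding psi_def by (intro N.finite_measure_mono) auto
qed

lemma psi_measurable [measurable]: "psi \<in> borel_measurable borel"
  by (intro borel_measurable_mono monoI psi_mono)

lemma psi_le_1 [simp]: "psi y \<le> 1"
proof -
  interpret N: real_distribution std_normal_distribution by (rule real_dist_normal_dist)
  show ?thesis unfolding psi_def by simp
qed

text \<open>The added mass lies in two intervals of length \<open>\<delta>\<close>, where the
  density is at most 1 / sqrt (2 pi) and so at most 1/2. This crude Lipschitz bound absorbs
  overshoots and barrier shifts, and it rules out atoms of the running extremum.\<close>

lemma psi_add_le:
  assumes "\<delta> \<ge> 0"
  shows "psi (y + \<delta>) \<le> psi y + \<delta>"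
proof -
  interpret N: real_distribution std_normal_distribution by (rule real_dist_normal_dist)
  have sq: "sqrt (2 * pi) \<ge> 2" using pi_gt3 by (intro real_le_rsqrt) auto
  have "psi (y + \<delta>) \<le> N.prob ({- y<..<y} \<union> ({- (y + \<delta>)..- y} \<union> {y..y + \<delta>}))"
    unfolding psi_def by (intro N.finite_measure_mono) auto
  also have "\<dots> \<le> psi y + (N.prob {- (y + \<delta>)..- y} + N.prob {y..y + \<delta>})"
    unfolding psi_def by (intro order_trans[OF measure_Un_le] add_left_mono measure_Un_le) auto
  also have "\<dots> \<le> psi y + (\<delta> / sqrt (2 * pi) + \<delta> / sqrt (2 * pi))"
    using measure_std_normal_upper[of "- (y + \<delta>)" "- y"] measure_std_normal_upper[of y "y + \<delta>"] assms by simp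
  also have "\<dots> \<le> psi y + (\<delta> / 2 + \<delta> / 2)"
    using assms sq by (intro add_mono divide_left_mono) auto
  finally show ?thesis by simp
qed

lemma psi_upper:
  assumes "y \<ge> 0"
  shows "psi y \<le> 2 * y / sqrt (2 * pi)"
proof -
  interpret N: real_distribution std_normal_distribution by (rule real_dist_normal_dist)
  have "psi y \<le> N.prob {- y..y}" unfolding psi_def by (intro N.finite_measure_mono) auto
  also have "\<dots> \<le> (y - (- y)) / sqrt (2 * pi)" using assms by (intro measure_std_normal_upper) auto
  finally show ?thesis by simp
qed

text \<open>On the interval the density is at least its value at the ends. Together with the bound
  by its peak this squeezes psi y / y towards 2 / sqrt (2 pi).\<close>

lemma psi_lower:
  assumes "y \<ge> 0"
  shows "2 * y / sqrt (2 * pi) * exp (- y\<^sup>2 / 2) \<le> psi y"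
proof -
  interpret N: real_distribution std_normal_distribution by (rule real_dist_normal_dist)
  have "ennreal (2 * y / sqrt (2 * pi) * exp (- y\<^sup>2 / 2)) = (\<integral>\<^sup>+x. ennreal (std_normal_density y) * indicator {-y<..<y} x \<partial>lborel)"
    using assms by (subst nn_integral_cmult_indicator)
      (auto simp: ennreal_mult[symmetric] std_normal_density_def mult_ac)
  also have "\<dots> \<le> (\<integral>\<^sup>+x. std_normal_density x * indicator {-y<..<y} x \<partial>lborel)"
  proof (intro nn_integral_mono)
    fix x
    have "std_normal_density y \<le> std_normal_density x" if "- y < x" "x < y"
    proof -
      have "x\<^sup>2 \<le> y\<^sup>2" using that by (intro abs_le_square_iff[THEN iffD1]) auto
      thus ?thesis by (auto simp: std_normal_density_def intro!: divide_right_mono)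
    qed
    thus "ennreal (std_normal_density y) * indicator {-y<..<y} x \<le> std_normal_density x * indicator {-y<..<y} x"
      by (auto simp: indicator_def intro!: ennreal_leI)
  qed
  also have "\<dots> = emeasure std_normal_distribution {-y<..<y}"
    by (subst emeasure_density) (auto intro!: nn_integral_cong simp: indicator_def)
  finally show ?thesis by (simp add: N.emeasure_eq_measure psi_def)
qed

lemma psi_pos: "y > 0 \<Longrightarrow> psi y > 0"
  using psi_lower[of y] by (smt (verit) divide_pos_pos exp_gt_zero mult_pos_pos pi_gt_zero real_sqrt_gt_zero)

text \<open>The ratio is the conditional probability of avoiding 0 for time \<open>w\<close>, given
  that 0 is avoided for the shorter time \<open>d\<close>.\<close>

lemma psi_ratio_bounds:
  assumes "0 < d" "d \<le> w"
  shows "0 \<le> psi (y / sqrt w) / psi (y / sqrt d)" and "psi (y / sqrt w) / psi (y / sqrt d) \<le> 1"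
proof -
  show "0 \<le> psi (y / sqrt w) / psi (y / sqrt d)" by simp
  show "psi (y / sqrt w) / psi (y / sqrt d) \<le> 1"
  proof (cases "y > 0")
    case True
    hence "y / sqrt w \<le> y / sqrt d" using assms by (intro divide_left_mono) (auto intro: mult_pos_pos)
    hence "psi (y / sqrt w) \<le> psi (y / sqrt d)" by (rule psi_mono)
    thus ?thesis using psi_nonneg[of "y / sqrt d"] unfolding divide_le_eq_1 by linarith
  next
    case False
    \<comment> \<open>Division by 0 gives 0, so the bound extends to \<open>y\<close> at most 0
      without a side condition.\<close>
    hence "psi (y / sqrt d) = 0" using assms by (intro psi_nonpos) (auto simp: divide_nonpos_pos)
    thus ?thesis by simp
  qed
qed

lemma psi_div_tendsto: "((\<lambda>y. psi y / y) \<longlongrightarrow> 2 / sqrt (2 * pi)) (at_right 0)"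
proof (rule tendsto_sandwich)
  show "\<forall>\<^sub>F y in at_right 0. 2 / sqrt (2 * pi) * exp (- y\<^sup>2 / 2) \<le> psi y / y"
    using eventually_at_right_less[of "0::real"]
    by eventually_elim (use psi_lower in \<open>auto simp: field_simps\<close>)
  show "\<forall>\<^sub>F y in at_right 0. psi y / y \<le> 2 / sqrt (2 * pi)"
    using eventually_at_right_less[of "0::real"]
    by eventually_elim (use psi_upper in \<open>auto simp: field_simps\<close>)
  have "((\<lambda>y::real. 2 / sqrt (2 * pi) * exp (- y\<^sup>2 / 2)) \<longlongrightarrow> 2 / sqrt (2 * pi) * exp (- 0\<^sup>2 / 2)) (at_right 0)"
    by (intro tendsto_intros) auto
  thus "((\<lambda>y::real. 2 / sqrt (2 * pi) * exp (- y\<^sup>2 / 2)) \<longlongrightarrow> 2 / sqrt (2 * pi)) (at_right 0)" by simp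
qed auto

lemma measure_std_normal_tail:
  assumes "y \<ge> 0"
  shows "measure std_normal_distribution {y..} = (1 - psi y) / 2"
proof -
  interpret N: real_distribution std_normal_distribution by (rule real_dist_normal_dist)
  have "N.prob ({- y<..<y} \<union> ({..-y} \<union> {y..})) = N.prob UNIV"
    by (intro arg_cong[where f=N.prob]) auto
  also have "N.prob UNIV = 1" using N.prob_space by simp
  also have "N.prob ({- y<..<y} \<union> ({..-y} \<union> {y..})) = psi y + N.prob ({..-y} \<union> {y..})"
    unfolding psi_def by (intro N.finite_measure_Union) auto
  also have "N.prob ({..-y} \<union> {y..}) = N.prob {..-y} + N.prob {y..}"
  proof (cases "y = 0")
    \<comment> \<open>Only here do the two closed tails overlap, in a single point of mass
      0.\<close>
    case True
    have "N.prob {0..0::real} = 0" using measure_std_normal_upper[of 0 0] by (simp add: measure_le_0_iff)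
    hence "N.prob {0..} = N.prob {0<..}"
      using N.finite_measure_Union[of "{0..0}" "{0<..}"] ivl_disj_un_singleton(1)[of "0::real"] by simp
    moreover have "N.prob ({..0} \<union> {0<..}) = N.prob {..0} + N.prob {0<..}"
      by (intro N.finite_measure_Union) auto
    moreover have "{..0} \<union> {0<..} = {..0} \<union> {0::real..}" by auto
    ultimately show ?thesis using True by simp
  next
    case False
    thus ?thesis using assms by (intro N.finite_measure_Union) auto
  qed
  also have "N.prob {..-y} = N.prob {y..}"
    using measure_std_normal_uminus[of "{y..}"] by (simp add: vimage_def le_minus_iff atMost_def)
  finally show ?thesis by simp
qed

lemma measure_std_normal_half: "measure std_normal_distribution {0<..} = 1 / 2"
proof -
  interpret N: real_distribution std_normal_distribution by (rule real_dist_normal_dist)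
  have "N.prob {..0} = 1 / 2"
    using measure_std_normal_uminus[of "{0..}"] measure_std_normal_tail[of 0] psi_nonpos[of 0]
    by (simp add: vimage_def atMost_def)
  moreover have "N.prob ({..0} \<union> {0<..}) = N.prob {..0} + N.prob {0<..}"
    by (intro N.finite_measure_Union) auto
  moreover have "{..0} \<union> {0<..} = (UNIV :: real set)" by auto
  ultimately show ?thesis using N.prob_space by simp
qed

section \<open>The reflection principle\<close>

text \<open>A Fatou argument in which the approximating events need be neither monotone in
  \<open>n\<close> nor contained in \<open>E\<close>; grids for successive \<open>n\<close> are not
  nested.\<close>

lemma (in prob_space) prob_le_limit:
  assumes E: "E \<in> events" and D: "\<And>n. D n \<in> events"
    and sub: "\<And>\<omega>. \<omega> \<in> E \<Longrightarrow> \<forall>\<^sub>F n in sequentially. \<omega> \<in> D n"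
    and le: "\<And>n. prob (D n) \<le> c n" and lim: "c \<longlonglongrightarrow> l"
  shows "prob E \<le> l"
proof -
  have "(\<lambda>n. \<integral>\<omega>. indicator (E \<inter> D n) \<omega> \<partial>M) \<longlonglongrightarrow> (\<integral>\<omega>. indicator E \<omega> \<partial>M :: real)"
  proof (rule integral_dominated_convergence[where w="\<lambda>_. 1"])
    show "AE \<omega> in M. (\<lambda>n. indicator (E \<inter> D n) \<omega> :: real) \<longlonglongrightarrow> indicator E \<omega>"
    proof (intro AE_I2 tendsto_eventually)
      fix \<omega>
      show "\<forall>\<^sub>F n in sequentially. indicator (E \<inter> D n) \<omega> = (indicator E \<omega> :: real)"
        using sub[of \<omega>] by (cases "\<omega> \<in> E") (auto elim!: eventually_mono)
    qed
  qed (use E D in \<open>auto simp: indicator_def\<close>)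
  hence "(\<lambda>n. prob (E \<inter> D n)) \<longlonglongrightarrow> prob E" using E D by (simp add: sets.Int)
  moreover have "prob (E \<inter> D n) \<le> c n" for n
    using finite_measure_mono[of "E \<inter> D n" "D n"] D[of n] le[of n] by auto
  ultimately show ?thesis using lim by (meson LIMSEQ_le)
qed

section \<open>Brownian motion with every path continuous\<close>

text \<open>With continuity and the start at 0 for every outcome, the pathwise lemmas apply without
  an exceptional set. The single product formula expresses both the independence and the law of an
  increment.\<close>

locale cts_bm = prob_space M for M :: "'a measure" +
  fixes F :: "real \<Rightarrow> 'a measure" and T :: real and X :: "real \<Rightarrow> 'a \<Rightarrow> real"
  assumes subalg: "t \<in> {0..T} \<Longrightarrow> subalgebra M (F t)"
    and mono: "0 \<le> s \<Longrightarrow> s \<le> t \<Longrightarrow> t \<le> T \<Longrightarrow> sets (F s) \<subseteq> sets (F t)"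
    and adapted: "t \<in> {0..T} \<Longrightarrow> X t \<in> borel_measurable (F t)"
    and start: "\<omega> \<in> space M \<Longrightarrow> X 0 \<omega> = 0"
    and cont: "\<omega> \<in> space M \<Longrightarrow> continuous_on {0..T} (\<lambda>t. X t \<omega>)"
    and increment: "0 \<le> s \<Longrightarrow> s < t \<Longrightarrow> t \<le> T \<Longrightarrow> A \<in> sets (F s) \<Longrightarrow> B \<in> sets borel \<Longrightarrow>
      prob (A \<inter> {\<omega> \<in> space M. X t \<omega> - X s \<omega> \<in> B}) =
      prob A * measure std_normal_distribution {z. sqrt (t - s) * z \<in> B}"
begin

lemma space_F: "t \<in> {0..T} \<Longrightarrow> space (F t) = space M"
  using subalg unfolding subalgebra_def by auto

lemma sets_F: "t \<in> {0..T} \<Longrightarrow> A \<in> sets (F t) \<Longrightarrow> A \<in> events"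
  using subalg unfolding subalgebra_def by auto

lemma measurable_F: "t \<in> {0..T} \<Longrightarrow> f \<in> measurable (F t) N \<Longrightarrow> f \<in> measurable M N"
  using measurable_from_subalg[OF subalg] by auto

lemma measurable_F_mono: "0 \<le> s \<Longrightarrow> s \<le> t \<Longrightarrow> t \<le> T \<Longrightarrow> f \<in> measurable (F s) N \<Longrightarrow> f \<in> measurable (F t) N"
proof (rule measurable_from_subalg)
  assume "0 \<le> s" "s \<le> t" "t \<le> T"
  thus "subalgebra (F t) (F s)" using mono[of s t] unfolding subalgebra_def by (simp add: space_F)
qed

lemma X_measurable_F: "0 \<le> s \<Longrightarrow> s \<le> t \<Longrightarrow> t \<le> T \<Longrightarrow> X s \<in> borel_measurable (F t)"
  by (rule measurable_F_mono[of s t]) (auto intro: adapted)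

lemma X_measurable: "t \<in> {0..T} \<Longrightarrow> X t \<in> borel_measurable M"
  using measurable_F adapted by auto

text \<open>Turns every result about upper barriers into one about lower barriers, and supplies the
  symmetry for the reflection at \<open>t + d\<close>.\<close>

lemma uminus_cts_bm: "cts_bm M F T (\<lambda>t \<omega>. - X t \<omega>)"
proof (unfold_locales, goal_cases)
  case (3 t) thus ?case using adapted by auto
next
  case (5 \<omega>) thus ?case using cont by (auto intro: continuous_intros)
next
  case (6 s t A B)
  have [measurable]: "B \<in> sets borel" by fact
  have uB: "uminus -` B \<in> sets borel" using measurable_sets[of uminus borel borel B] by simp
  have "prob (A \<inter> {\<omega> \<in> space M. - X t \<omega> - - X s \<omega> \<in> B}) = prob (A \<inter> {\<omega> \<in> space M. X t \<omega> - X s \<omega> \<in> uminus -` B})"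
    by (intro arg_cong[where f=prob]) auto
  also have "\<dots> = prob A * measure std_normal_distribution {z. sqrt (t - s) * z \<in> uminus -` B}"
    by (rule increment) (use 6 uB in auto)
  also have "{z. sqrt (t - s) * z \<in> uminus -` B} = uminus -` {z. sqrt (t - s) * z \<in> B}" by auto
  also have "measure std_normal_distribution \<dots> = measure std_normal_distribution {z. sqrt (t - s) * z \<in> B}"
    by (rule measure_std_normal_uminus) (use measurable_sets[of "\<lambda>z. sqrt (t - s) * z" borel borel B] in \<open>auto simp: vimage_def\<close>)
  finally show ?case .
qed (use subalg mono start in auto)

text \<open>By compactness the strict bound is uniform, so it is a countable condition.\<close>

lemma sets_all_less:
  assumes st: "0 \<le> s" "s \<le> t" "t \<le> T" and sp: "space N = space M"
    and X: "\<And>u. u \<in> {s..t} \<Longrightarrow> X u \<in> borel_measurable N" and V: "V \<in> borel_measurable N"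
  shows "{\<omega> \<in> space M. \<forall>u\<in>{s..t}. X u \<omega> < V \<omega>} \<in> sets N"
proof -
  \<comment> \<open>Rational parameters in the unit interval reach both ends of the time interval
    even when \<open>s\<close> and \<open>t\<close> are irrational, and they also cover
    \<open>s = t\<close>.\<close>
  define U where "U r = s + r * (t - s)" for r
  have U: "U r \<in> {s..t}" if "r \<in> {0..1}" for r
    using that st mult_left_le_one_le[of "t - s" r] unfolding U_def by auto
  have "(\<forall>u\<in>{s..t}. X u \<omega> < V \<omega>) \<longleftrightarrow> (\<exists>m. \<forall>r\<in>{0..1} \<inter> \<rat>. X (U r) \<omega> \<le> V \<omega> - 1 / real (Suc m))" (is "?L \<longleftrightarrow> ?R")
    if \<omega>: "\<omega> \<in> space M" for \<omega>
  proof
    assume ?L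
    have "continuous_on {s..t} (\<lambda>u. X u \<omega>)" using cont[OF \<omega>] st by (auto intro: continuous_on_subset)
    then obtain w where w: "w \<in> {s..t}" "\<And>u. u \<in> {s..t} \<Longrightarrow> X u \<omega> \<le> X w \<omega>"
      using continuous_attains_sup[of "{s..t}" "\<lambda>u. X u \<omega>"] st by force
    with \<open>?L\<close> have "V \<omega> - X w \<omega> > 0" by auto
    then obtain m where "1 / real (Suc m) < V \<omega> - X w \<omega>" using nat_approx_posE by blast
    thus ?R using w(2) U by (intro exI[of _ m]) force
  next
    assume ?R
    then obtain m where m: "\<And>r. r \<in> {0..1} \<inter> \<rat> \<Longrightarrow> X (U r) \<omega> \<le> V \<omega> - 1 / real (Suc m)" by blast
    show ?L
    proof
      fix u assume u: "u \<in> {s..t}"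
      obtain r where r: "r \<in> {0..1}" "u = U r"
      proof (cases "s = t")
        case True thus ?thesis using u that[of 0] by (auto simp: U_def)
      next
        case False
        thus ?thesis using u that[of "(u - s) / (t - s)"] by (auto simp: U_def divide_simps)
      qed
      have "continuous_on {0..1} (\<lambda>r. X (U r) \<omega>)"
        using U st by (intro continuous_on_compose2[OF cont[OF \<omega>], of _ U]) (force simp: U_def intro!: continuous_intros)+
      moreover have "closure ({0..1} \<inter> \<rat>) = {0..1::real}"
      proof
        show "closure ({0..1} \<inter> \<rat>) \<subseteq> {0..1::real}" by (intro closure_minimal) auto
        have "{0<..<1} \<subseteq> closure ({0<..<1} \<inter> (\<rat>::real set))"
          using open_Int_closure_subset[of "{0<..<1::real}" "\<rat>"] Rats_closure_real by auto
        hence "closure {0<..<1} \<subseteq> closure ({0<..<1} \<inter> (\<rat>::real set))" by (rule closure_minimal[OF _ closed_closure])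
        also have "\<dots> \<subseteq> closure ({0..1} \<inter> \<rat>)" by (intro closure_mono) auto
        finally show "{0..1::real} \<subseteq> closure ({0..1} \<inter> \<rat>)" by simp
      qed
      ultimately have "X (U r) \<omega> \<le> V \<omega> - 1 / real (Suc m)"
        using r m by (intro continuous_le_on_closure[of "{0..1} \<inter> \<rat>" "\<lambda>r. X (U r) \<omega>" r]) auto
      thus "X u \<omega> < V \<omega>" using r(2) by (smt (verit) divide_pos_pos of_nat_0_less_iff zero_less_Suc)
    qed
  qed
  hence "{\<omega> \<in> space M. \<forall>u\<in>{s..t}. X u \<omega> < V \<omega>} =
      {\<omega> \<in> space N. \<exists>m. \<forall>r\<in>{0..1} \<inter> \<rat>. X (U r) \<omega> \<le> V \<omega> - 1 / real (Suc m)}"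
    unfolding sp by blast
  also have "\<dots> \<in> sets N"
  proof -
    have "countable ({0..1} \<inter> (\<rat> :: real set))" by (simp add: countable_rat countable_Int2)
    moreover have "Measurable.pred N (\<lambda>\<omega>. X (U r) \<omega> \<le> V \<omega> - 1 / real (Suc m))" if "r \<in> {0..1} \<inter> \<rat>" for r m
    proof -
      have [measurable]: "X (U r) \<in> borel_measurable N" using X[OF U] that by auto
      note [measurable] = V
      show ?thesis by measurable
    qed
    ultimately have "Measurable.pred N (\<lambda>\<omega>. \<exists>m. \<forall>r\<in>{0..1} \<inter> \<rat>. X (U r) \<omega> \<le> V \<omega> - 1 / real (Suc m))"
      by (intro pred_intros_countable pred_intros_countable_bounded) auto
    thus ?thesis by simp
  qed
  finally show ?thesis .
qed

text \<open>The case \<open>s = t\<close> occurs at the last grid point. There the increment is 0,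
  so only the weak inequality can serve for the first bound and only the strict one for the
  second.\<close>

lemma increment_sym:
  assumes "0 \<le> s" "s \<le> t" "t \<le> T" "A \<in> sets (F s)"
  shows "prob A \<le> 2 * prob (A \<inter> {\<omega> \<in> space M. X t \<omega> - X s \<omega> \<ge> 0})"
    and "2 * prob (A \<inter> {\<omega> \<in> space M. X t \<omega> - X s \<omega> > 0}) \<le> prob A"
proof -
  have "prob A \<le> 2 * prob (A \<inter> {\<omega> \<in> space M. X t \<omega> - X s \<omega> \<ge> 0}) \<and>
    2 * prob (A \<inter> {\<omega> \<in> space M. X t \<omega> - X s \<omega> > 0}) \<le> prob A"
  proof (cases "s = t")
    case True
    have "A \<inter> space M = A" using sets_F[of s A] assms sets.sets_into_space[of A M] by auto
    thus ?thesis using True by simp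
  next
    case False
    hence "sqrt (t - s) > 0" using assms by simp
    hence "{z. sqrt (t - s) * z \<in> {0..}} = {0..}" "{z. sqrt (t - s) * z \<in> {0<..}} = {0<..}"
      by (auto simp: zero_le_mult_iff zero_less_mult_iff)
    thus ?thesis
      using increment[of s t A "{0..}"] increment[of s t A "{0<..}"] False assms
        measure_std_normal_half measure_std_normal_tail[of 0] psi_nonpos[of 0]
      by simp
  qed
  thus "prob A \<le> 2 * prob (A \<inter> {\<omega> \<in> space M. X t \<omega> - X s \<omega> \<ge> 0})"
    and "2 * prob (A \<inter> {\<omega> \<in> space M. X t \<omega> - X s \<omega> > 0}) \<le> prob A" by auto
qed

lemma increment_tail:
  assumes "0 \<le> s" "s < t" "t \<le> T" "A \<in> sets (F s)" "v \<ge> 0"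
  shows "2 * prob (A \<inter> {\<omega> \<in> space M. X t \<omega> - X s \<omega> \<ge> v}) = prob A * (1 - psi (v / sqrt (t - s)))"
proof -
  have "sqrt (t - s) > 0" using assms by simp
  hence "{z. sqrt (t - s) * z \<in> {v..}} = {v / sqrt (t - s)..}" by (auto simp: field_simps)
  moreover have "v / sqrt (t - s) \<ge> 0" using assms by simp
  ultimately show ?thesis
    using increment[of s t A "{v..}"] assms measure_std_normal_tail[of "v / sqrt (t - s)"] by simp
qed

text \<open>
  The path is stopped at the first grid point where it has risen by \<open>v\<close>; from there the remaining
  increment is symmetric. The overshoot at that point is what separates the two bounds.
\<close>

lemma grid_reflection:
  assumes st: "0 \<le> s" "s < t" "t \<le> T" and A: "A \<in> sets (F s)" and v: "v > 0" and n: "n > 0"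
  defines "u \<equiv> \<lambda>j. s + real j * (t - s) / real n"
  shows "prob (A \<inter> {\<omega> \<in> space M. \<exists>j\<le>n. X (u j) \<omega> - X s \<omega> \<ge> v}) \<le> prob A * (1 - psi (v / sqrt (t - s)))"
    and "\<delta> > 0 \<Longrightarrow> prob A * (1 - psi ((v + \<delta>) / sqrt (t - s))) \<le>
      prob (A \<inter> {\<omega> \<in> space M. \<exists>j\<le>n. X (u j) \<omega> - X s \<omega> \<ge> v}) +
      2 * prob {\<omega> \<in> space M. \<exists>j<n. X (u (Suc j)) \<omega> - X (u j) \<omega> > \<delta>}"
proof -
  define E where "E j = A \<inter> {\<omega> \<in> space M. (\<forall>i<j. X (u i) \<omega> - X s \<omega> < v) \<and> X (u j) \<omega> - X s \<omega> \<ge> v}" for j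
  have u: "s \<le> u j" "u j \<le> t" if "j \<le> n" for j
  proof -
    have "real j * (t - s) \<le> real n * (t - s)" using that st by (intro mult_right_mono) auto
    moreover have "0 \<le> real j * (t - s)" using st by simp
    ultimately show "s \<le> u j" "u j \<le> t" using n that unfolding u_def by (simp_all add: divide_le_eq[of _ "real n"] le_diff_eq[symmetric] add.commute[of s] mult.commute del: le_diff_eq)
  qed
  have u_mono: "u i \<le> u j" if "i \<le> j" for i j
    using that st n unfolding u_def by (intro add_left_mono divide_right_mono mult_right_mono) auto
  have u0: "u 0 = s" by (simp add: u_def)
  have EF: "E j \<in> sets (F (u j))" if j: "j \<le> n" for j
  proof -
    define N where "N = F (u j)"
    have sp: "space N = space M" using u[of j] j st by (auto simp: N_def space_F)
    have Xi: "X (u i) \<in> borel_measurable N" if "i \<le> j" for i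
      unfolding N_def using that j u[of i] u[of j] u_mono st by (intro X_measurable_F) auto
    have Xs[measurable]: "X s \<in> borel_measurable N"
      unfolding N_def using u[of j] j st by (intro X_measurable_F) auto
    have "A \<in> sets N" unfolding N_def using A mono[of s "u j"] u[of j] j st by auto
    moreover have "{\<omega> \<in> space N. (\<forall>i\<in>{..<j}. X (u i) \<omega> - X s \<omega> < v) \<and> X (u j) \<omega> - X s \<omega> \<ge> v} \<in> sets N"
    proof (intro sets.sets_Collect_conj sets.sets_Collect_finite_All)
      fix i assume "i \<in> {..<j}"
      hence [measurable]: "X (u i) \<in> borel_measurable N" using Xi by auto
      show "{\<omega> \<in> space N. X (u i) \<omega> - X s \<omega> < v} \<in> sets N" by measurable
    next
      have [measurable]: "X (u j) \<in> borel_measurable N" using Xi by auto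
      show "{\<omega> \<in> space N. X (u j) \<omega> - X s \<omega> \<ge> v} \<in> sets N" by measurable
    qed auto
    ultimately have "A \<inter> {\<omega> \<in> space N. (\<forall>i\<in>{..<j}. X (u i) \<omega> - X s \<omega> < v) \<and> X (u j) \<omega> - X s \<omega> \<ge> v} \<in> sets N"
      by (rule sets.Int)
    thus ?thesis unfolding E_def sp N_def[symmetric] by (simp only: Ball_def lessThan_iff)
  qed
  have Eev: "E j \<in> events" if "j \<le> n" for j
    using EF[OF that] sets_F[of "u j" "E j"] u[OF that] st by auto
  have disj: "disjoint_family_on E {..n}"
    unfolding disjoint_family_on_def E_def by (auto simp: set_eq_iff) (metis leD linorder_neqE_nat)
  have disj': "disjoint_family_on (\<lambda>j. E j \<inter> C j) {..n}" for C
    using disj unfolding disjoint_family_on_def by blast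
  have UE: "(\<Union>j\<le>n. E j) = A \<inter> {\<omega> \<in> space M. \<exists>j\<le>n. X (u j) \<omega> - X s \<omega> \<ge> v}" (is "_ = ?U")
  proof
    show "?U \<subseteq> (\<Union>j\<le>n. E j)"
    proof
      fix \<omega> assume \<omega>: "\<omega> \<in> ?U"
      define j where "j = (LEAST j. X (u j) \<omega> - X s \<omega> \<ge> v)"
      obtain k where k: "k \<le> n" "X (u k) \<omega> - X s \<omega> \<ge> v" using \<omega> by auto
      have "X (u j) \<omega> - X s \<omega> \<ge> v" unfolding j_def using k(2) by (rule LeastI)
      moreover have "j \<le> n" unfolding j_def using Least_le[of "\<lambda>j. X (u j) \<omega> - X s \<omega> \<ge> v", OF k(2)] k(1) by simp
      moreover have "\<forall>i<j. X (u i) \<omega> - X s \<omega> < v" unfolding j_def using not_less_Least by force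
      ultimately show "\<omega> \<in> (\<Union>j\<le>n. E j)" using \<omega> unfolding E_def by blast
    qed
  qed (auto simp: E_def)
  have sumE: "prob ?U = (\<Sum>j\<le>n. prob (E j))"
    unfolding UE[symmetric] using Eev disj by (intro finite_measure_finite_Union) auto
  have Xm[measurable]: "X t \<in> borel_measurable M" "X s \<in> borel_measurable M" using st by (auto intro: X_measurable)
  have Xu[measurable]: "X (u j) \<in> borel_measurable M" if "j \<le> n" for j using st u[OF that] by (auto intro: X_measurable)
  have [measurable]: "A \<in> events" using A st sets_F[of s A] by auto

  define C where "C j = {\<omega> \<in> space M. X t \<omega> - X (u j) \<omega> \<ge> 0}" for j
  define C' where "C' j = {\<omega> \<in> space M. X t \<omega> - X (u j) \<omega> > 0}" for j
  have Cev: "C j \<in> events" "C' j \<in> events" if "j \<le> n" for j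
    using that unfolding C_def C'_def by measurable
  have "prob ?U \<le> (\<Sum>j\<le>n. 2 * prob (E j \<inter> C j))"
    unfolding sumE C_def using EF u st by (intro sum_mono increment_sym(1)) (auto intro: order_trans[OF st(1)])
  also have "\<dots> = 2 * prob (\<Union>j\<le>n. E j \<inter> C j)"
    unfolding sum_distrib_left[symmetric] using Eev Cev disj
    by (subst finite_measure_finite_Union) (auto intro: disj')
  also have "\<dots> \<le> 2 * prob (A \<inter> {\<omega> \<in> space M. X t \<omega> - X s \<omega> \<ge> v})"
    by (intro mult_left_mono finite_measure_mono) (auto simp: E_def C_def)
  also have "\<dots> = prob A * (1 - psi (v / sqrt (t - s)))"
    using st A v by (intro increment_tail) auto
  finally show "prob ?U \<le> prob A * (1 - psi (v / sqrt (t - s)))" .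

  show "prob A * (1 - psi ((v + \<delta>) / sqrt (t - s))) \<le> prob ?U +
      2 * prob {\<omega> \<in> space M. \<exists>j<n. X (u (Suc j)) \<omega> - X (u j) \<omega> > \<delta>}" (is "_ \<le> _ + 2 * prob ?O") if \<delta>: "\<delta> > 0"
  proof -
    have Oev: "?O \<in> events"
    proof -
      have "{\<omega> \<in> space M. \<exists>j\<in>{..<n}. X (u (Suc j)) \<omega> - X (u j) \<omega> > \<delta>} \<in> events"
      proof (intro sets.sets_Collect_finite_Ex)
        fix j assume "j \<in> {..<n}"
        hence [measurable]: "X (u j) \<in> borel_measurable M" "X (u (Suc j)) \<in> borel_measurable M" using Xu by auto
        show "{\<omega> \<in> space M. X (u (Suc j)) \<omega> - X (u j) \<omega> > \<delta>} \<in> events" by measurable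
      qed auto
      thus ?thesis by (simp add: Bex_def)
    qed
    have "prob A * (1 - psi ((v + \<delta>) / sqrt (t - s))) = 2 * prob (A \<inter> {\<omega> \<in> space M. X t \<omega> - X s \<omega> \<ge> v + \<delta>})"
      using st A v \<delta> by (intro increment_tail[symmetric]) auto
    also have "\<dots> \<le> 2 * prob ((\<Union>j\<le>n. E j \<inter> C' j) \<union> ?O)"
    proof (intro mult_left_mono finite_measure_mono)
      show "(\<Union>j\<le>n. E j \<inter> C' j) \<union> ?O \<in> events" using Eev Cev Oev by auto
      show "A \<inter> {\<omega> \<in> space M. X t \<omega> - X s \<omega> \<ge> v + \<delta>} \<subseteq> (\<Union>j\<le>n. E j \<inter> C' j) \<union> ?O"
      proof
        fix \<omega> assume \<omega>: "\<omega> \<in> A \<inter> {\<omega> \<in> space M. X t \<omega> - X s \<omega> \<ge> v + \<delta>}"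
        have "u n = t" using n by (simp add: u_def)
        with \<omega> \<delta> have "\<omega> \<in> ?U" by (auto intro!: exI[of _ n])
        then obtain j where j: "j \<le> n" "\<omega> \<in> E j" unfolding UE[symmetric] by auto
        show "\<omega> \<in> (\<Union>j\<le>n. E j \<inter> C' j) \<union> ?O"
        proof (cases "\<omega> \<in> ?O")
          case False
          have "j \<noteq> 0" using j(2) v u0 unfolding E_def by (auto intro!: Nat.gr0I)
          then obtain i where i: "j = Suc i" by (cases j) auto
          \<comment> \<open>One step before the first passage the rise was still below
            \<open>v\<close>, and no step exceeds \<open>\<delta>\<close>. So the rise at
            \<open>u j\<close> is less than \<open>v + \<delta>\<close>, and a strictly positive
            increment is left until \<open>t\<close>.\<close>
          have "X (u i) \<omega> - X s \<omega> < v" using j i unfolding E_def by auto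
          moreover have "X (u j) \<omega> - X (u i) \<omega> \<le> \<delta>" using False \<omega> j(1) unfolding i by (auto simp: not_less Suc_le_eq dest: spec[of _ i])
          ultimately have "\<omega> \<in> C' j" using \<omega> unfolding C'_def by auto
          thus ?thesis using j by auto
        qed auto
      qed
    qed auto
    also have "\<dots> \<le> 2 * (prob (\<Union>j\<le>n. E j \<inter> C' j) + prob ?O)"
      using Eev Cev Oev by (intro mult_left_mono measure_Un_le) auto
    also have "prob (\<Union>j\<le>n. E j \<inter> C' j) = (\<Sum>j\<le>n. prob (E j \<inter> C' j))"
      using Eev Cev disj by (intro finite_measure_finite_Union) (auto intro: disj')
    also have "2 * ((\<Sum>j\<le>n. prob (E j \<inter> C' j)) + prob ?O) = (\<Sum>j\<le>n. 2 * prob (E j \<inter> C' j)) + 2 * prob ?O"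
      by (simp add: sum_distrib_left)
    also have "(\<Sum>j\<le>n. 2 * prob (E j \<inter> C' j)) \<le> (\<Sum>j\<le>n. prob (E j))"
      unfolding C'_def using EF u st by (intro sum_mono increment_sym(2)) (auto intro: order_trans[OF st(1)])
    finally show ?thesis unfolding sumE by simp
  qed
qed


text \<open>Grid passage underestimates true passage, so each of the two grid bounds passes to the
  limit in its own way: the upper one with a slightly lowered barrier, the lower one because large
  single steps disappear by uniform continuity.\<close>

lemma reflection:
  assumes st: "0 \<le> s" "s < t" "t \<le> T" and A: "A \<in> sets (F s)"
  shows "prob (A \<inter> {\<omega> \<in> space M. \<forall>u\<in>{s..t}. X u \<omega> - X s \<omega> < v}) = prob A * psi (v / sqrt (t - s))"
proof (cases "v \<le> 0")
  case True
  hence "{\<omega> \<in> space M. \<forall>u\<in>{s..t}. X u \<omega> - X s \<omega> < v} = {}" using st by force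
  moreover have "v / sqrt (t - s) \<le> 0" using True st by (simp add: divide_nonpos_pos)
  ultimately show ?thesis by (simp only: psi_nonpos) simp
next
  case False
  hence v: "v > 0" by simp
  define w where "w = sqrt (t - s)"
  have w: "w > 0" using st by (simp add: w_def)
  have Aev: "A \<in> events" using A st sets_F[of s A] by auto
  have Xm: "X u \<in> borel_measurable M" if "s \<le> u" "u \<le> t" for u using that st by (auto intro: X_measurable)
  define L where "L = {\<omega> \<in> space M. \<forall>u\<in>{s..t}. X u \<omega> - X s \<omega> < v}"
  have "L = {\<omega> \<in> space M. \<forall>u\<in>{s..t}. X u \<omega> < X s \<omega> + v}" unfolding L_def by (auto simp: algebra_simps)
  also have "\<dots> \<in> events" using st Xm by (intro sets_all_less) auto
  finally have L: "L \<in> events" .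
  define u where "u n j = s + real j * (t - s) / real (Suc n)" for n j
  have u: "s \<le> u n j" "u n j \<le> t" if "j \<le> Suc n" for n j
  proof -
    have "real j * (t - s) \<le> real (Suc n) * (t - s)" using that st by (intro mult_right_mono) auto
    hence "real j * (t - s) / real (Suc n) \<le> t - s" by (subst divide_le_eq) (auto simp: mult.commute)
    moreover have "0 \<le> real j * (t - s) / real (Suc n)" using st by (intro divide_nonneg_nonneg mult_nonneg_nonneg) auto
    ultimately show "s \<le> u n j" "u n j \<le> t" unfolding u_def by linarith+
  qed
  define U where "U n v' = A \<inter> {\<omega> \<in> space M. \<exists>j\<le>Suc n. X (u n j) \<omega> - X s \<omega> \<ge> v'}" for n v'
  have U: "U n v' \<in> events" for n v'
  proof -
    have "{\<omega> \<in> space M. \<exists>j\<in>{..Suc n}. X (u n j) \<omega> - X s \<omega> \<ge> v'} \<in> events"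
    proof (intro sets.sets_Collect_finite_Ex)
      fix j assume "j \<in> {..Suc n}"
      hence [measurable]: "X (u n j) \<in> borel_measurable M" "X s \<in> borel_measurable M" using Xm u st by auto
      show "{\<omega> \<in> space M. X (u n j) \<omega> - X s \<omega> \<ge> v'} \<in> events" by measurable
    qed auto
    thus ?thesis unfolding U_def using Aev by (simp only: Bex_def atMost_iff sets.Int)
  qed
  have up: "prob (A - L) \<le> prob A * (1 - psi (v / w)) + e" if e: "e > 0" for e
  proof -
    \<comment> \<open>A path that attains \<open>v\<close> exceeds a lower \<open>v'\<close> on a
      whole neighbourhood, which a fine grid must hit. The first term in the maximum limits the loss
      in \<open>psi\<close> to \<open>e\<close>; the second keeps the barrier positive.\<close>
    define v' where "v' = max (v - e * w) (v / 2)"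
    have v': "v' > 0" "v' < v" "v - e * w \<le> v'" using v e w unfolding v'_def by auto
    have "prob (A - L) \<le> prob A * (1 - psi (v' / w))"
    proof (rule prob_le_limit)
      show "prob (U n v') \<le> prob A * (1 - psi (v' / w))" for n
        unfolding U_def u_def w_def using grid_reflection(1)[OF st A v'(1), of "Suc n"] by simp
      fix \<omega> assume \<omega>: "\<omega> \<in> A - L"
      have \<omega>M: "\<omega> \<in> space M" using \<omega> Aev sets.sets_into_space by blast
      then obtain y where y: "y \<in> {s..t}" "X y \<omega> - X s \<omega> \<ge> v" using \<omega> unfolding L_def by force
      have "continuous (at y within {0..T}) (\<lambda>u. X u \<omega>)"
        using cont[OF \<omega>M] y st by (auto simp: continuous_on_eq_continuous_within)
      moreover have "X y \<omega> > X s \<omega> + v'" using y v' by simp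
      ultimately have "\<forall>\<^sub>F z in at y within {0..T}. X z \<omega> > X s \<omega> + v'"
        unfolding continuous_within by (rule order_tendstoD(1))
      then obtain e where e: "e > 0" "\<And>z. z \<in> {0..T} \<Longrightarrow> z \<noteq> y \<Longrightarrow> dist z y < e \<Longrightarrow> X z \<omega> > X s \<omega> + v'"
        unfolding eventually_at by blast
      have "(\<lambda>n. (t - s) / real (Suc n)) \<longlonglongrightarrow> 0" by real_asymp
      hence "\<forall>\<^sub>F n in sequentially. (t - s) / real (Suc n) < e" using e(1) by (rule order_tendstoD(2))
      thus "\<forall>\<^sub>F n in sequentially. \<omega> \<in> U n v'"
      proof eventually_elim
        case (elim n)
        \<comment> \<open>\<open>r\<close> is the position of \<open>y\<close> in units of the mesh;
          its floor is the last grid index not after \<open>y\<close>, less than one mesh width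
          away.\<close>
        define r where "r = (y - s) / (t - s) * real (Suc n)"
        have r: "0 \<le> r" "r \<le> real (Suc n)"
          using y st mult_right_mono[of "(y - s) / (t - s)" 1 "real (Suc n)"]
          unfolding r_def by (auto simp del: of_nat_Suc)
        define j where "j = nat \<lfloor>r\<rfloor>"
        have j: "j \<le> Suc n" using r unfolding j_def by (simp add: nat_le_iff floor_le_iff del: of_nat_Suc)
        have jr: "real j \<le> r" "r < real j + 1" using r unfolding j_def by (simp_all add: of_nat_floor)
        have ry: "y = s + r * (t - s) / real (Suc n)" using st unfolding r_def by (simp del: of_nat_Suc)
        have "y - u n j = (r - real j) * (t - s) / real (Suc n)"
          unfolding ry u_def by (simp add: left_diff_distrib diff_divide_distrib del: of_nat_Suc)
        also have "\<dots> \<le> 1 * (t - s) / real (Suc n)" using jr st by (intro divide_right_mono mult_right_mono) auto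
        finally have "y - u n j < e" using elim by simp
        moreover have "y - u n j \<ge> 0"
          unfolding ry u_def using jr st by (simp add: divide_right_mono mult_right_mono del: of_nat_Suc)
        ultimately have "X (u n j) \<omega> > X s \<omega> + v'"
          using e(2)[of "u n j"] u[OF j] st y v' by (cases "u n j = y") (auto simp: dist_real_def)
        thus ?case unfolding U_def using j \<omega> \<omega>M by (auto intro!: exI[of _ j])
      qed
    qed (use Aev L U in auto)
    also have "psi (v / w) \<le> psi (v' / w + e)"
      using v'(3) w by (intro psi_mono) (simp add: field_simps)
    hence "1 - psi (v' / w) \<le> (1 - psi (v / w)) + e" using psi_add_le[of e "v' / w"] e by simp
    hence "prob A * (1 - psi (v' / w)) \<le> prob A * ((1 - psi (v / w)) + e)" by (intro mult_left_mono) auto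
    also have "\<dots> \<le> prob A * (1 - psi (v / w)) + e"
      using e by (simp add: distrib_left mult_left_le_one_le)
    finally show ?thesis .
  qed
  have low: "prob A * (1 - psi (v / w)) \<le> prob (A - L) + e" if e: "e > 0" for e
  proof -
    \<comment> \<open>After division by \<open>w\<close> the overshoot \<open>\<delta>\<close>
      becomes \<open>e\<close>, which is then the loss in \<open>psi\<close>.\<close>
    define \<delta> where "\<delta> = e * w"
    have \<delta>: "\<delta> > 0" using e w by (simp add: \<delta>_def)
    define Os where "Os n = {\<omega> \<in> space M. \<exists>j<Suc n. X (u n (Suc j)) \<omega> - X (u n j) \<omega> > \<delta>}" for n
    have Os: "Os n \<in> events" for n
    proof -
      have "{\<omega> \<in> space M. \<exists>j\<in>{..<Suc n}. X (u n (Suc j)) \<omega> - X (u n j) \<omega> > \<delta>} \<in> events"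
      proof (intro sets.sets_Collect_finite_Ex)
        fix j assume "j \<in> {..<Suc n}"
        hence [measurable]: "X (u n j) \<in> borel_measurable M" "X (u n (Suc j)) \<in> borel_measurable M" using Xm u by auto
        show "{\<omega> \<in> space M. X (u n (Suc j)) \<omega> - X (u n j) \<omega> > \<delta>} \<in> events" by measurable
      qed auto
      thus ?thesis unfolding Os_def by (simp only: Bex_def lessThan_iff)
    qed
    define c where "c = prob A * (1 - psi ((v + \<delta>) / w))"
    \<comment> \<open>A disguise of \<open>c \<le> prob (A - L)\<close>: the limit lemma is applied
      to the whole space, since every path eventually avoids the oversized steps in
      \<open>Os n\<close>.\<close>
    have "1 \<le> 1 - (c - prob (A - L)) / 2"
    proof (rule order_trans[OF eq_refl prob_le_limit[where E="space M" and D="\<lambda>n. space M - Os n"]])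
      fix n
      have "c \<le> prob (U n v) + 2 * prob (Os n)"
        unfolding c_def w_def U_def Os_def u_def using grid_reflection(2)[OF st A v _ \<delta>, of "Suc n"] by simp
      also have "prob (U n v) \<le> prob (A - L)"
      proof (rule finite_measure_mono)
        show "U n v \<subseteq> A - L"
        proof
          fix \<omega> assume "\<omega> \<in> U n v"
          then obtain j where j: "\<omega> \<in> A" "j \<le> Suc n" "X (u n j) \<omega> - X s \<omega> \<ge> v" unfolding U_def by auto
          have "\<omega> \<notin> L"
          proof
            assume "\<omega> \<in> L"
            hence "X (u n j) \<omega> - X s \<omega> < v" unfolding L_def using u[OF j(2)] by auto
            with j(3) show False by simp
          qed
          thus "\<omega> \<in> A - L" using j(1) by simp
        qed
      qed (use Aev L in auto)
      finally show "prob (space M - Os n) \<le> 1 - (c - prob (A - L)) / 2"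
        using prob_compl[OF Os, of n] by (simp add: field_simps)
    next
      fix \<omega> assume \<omega>: "\<omega> \<in> space M"
      have "uniformly_continuous_on {0..T} (\<lambda>u. X u \<omega>)"
        using cont[OF \<omega>] by (intro compact_uniformly_continuous) auto
      then obtain e where e: "e > 0" "\<And>y z. y \<in> {0..T} \<Longrightarrow> z \<in> {0..T} \<Longrightarrow> dist z y < e \<Longrightarrow> dist (X z \<omega>) (X y \<omega>) < \<delta>"
        using \<delta> unfolding uniformly_continuous_on_def by metis
      have "(\<lambda>n. (t - s) / real (Suc n)) \<longlonglongrightarrow> 0" by real_asymp
      hence "\<forall>\<^sub>F n in sequentially. (t - s) / real (Suc n) < e" using e(1) by (rule order_tendstoD(2))
      thus "\<forall>\<^sub>F n in sequentially. \<omega> \<in> space M - Os n"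
      proof eventually_elim
        case (elim n)
        have "X (u n (Suc j)) \<omega> - X (u n j) \<omega> \<le> \<delta>" if "j < Suc n" for j
        proof -
          have "u n (Suc j) - u n j = (t - s) / real (Suc n)"
            unfolding u_def by (simp add: algebra_simps add_divide_distrib diff_divide_distrib)
          hence "dist (u n (Suc j)) (u n j) < e" using elim st by (simp add: dist_real_def)
          hence "dist (X (u n (Suc j)) \<omega>) (X (u n j) \<omega>) < \<delta>"
            using that u[of j n] u[of "Suc j" n] st by (intro e(2)) auto
          thus ?thesis by (simp add: dist_real_def)
        qed
        hence "\<not> (\<exists>j<Suc n. X (u n (Suc j)) \<omega> - X (u n j) \<omega> > \<delta>)" by (meson leD)
        thus ?case using \<omega> unfolding Os_def by blast
      qed
    qed (use Os prob_space in auto)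
    hence "c \<le> prob (A - L)" by simp
    have "psi ((v + \<delta>) / w) \<le> psi (v / w) + e"
      using psi_add_le[of e "v / w"] e w by (simp add: \<delta>_def add_divide_distrib)
    hence "prob A * (1 - psi (v / w)) \<le> prob A * ((1 - psi ((v + \<delta>) / w)) + e)" by (intro mult_left_mono) auto
    also have "\<dots> \<le> c + e"
      using e by (simp add: distrib_left mult_left_le_one_le c_def)
    also note \<open>c \<le> prob (A - L)\<close>
    finally show ?thesis by simp
  qed
  have "prob (A - L) = prob A * (1 - psi (v / w))"
    by (rule antisym) (rule field_le_epsilon, erule up low)+
  moreover have "prob A = prob (A \<inter> L) + prob (A - L)"
    using finite_measure_Diff'[OF Aev L] by simp
  ultimately show ?thesis unfolding L_def w_def by (simp add: algebra_simps)
qed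

text \<open>Lets the barrier be random. The maximal rise \<open>S\<close> after time
  \<open>s\<close> is independent of \<open>F s\<close>, so by Fubini the barrier can be frozen and
  \<open>reflection\<close> applied to each of its values.\<close>

lemma reflection_integral:
  assumes st: "0 \<le> s" "s < t" "t \<le> T"
    and \<phi>: "\<phi> \<in> borel_measurable (F s)" "\<And>\<omega>. \<bar>\<phi> \<omega>\<bar> \<le> 1" and V: "V \<in> borel_measurable (F s)"
  shows "(\<integral>\<omega>. \<phi> \<omega> * indicator {\<omega> \<in> space M. \<forall>u\<in>{s..t}. X u \<omega> - X s \<omega> < V \<omega>} \<omega> \<partial>M) =
    (\<integral>\<omega>. \<phi> \<omega> * psi (V \<omega> / sqrt (t - s)) \<partial>M)"
proof -
  define S where "S \<omega> = Sup ((\<lambda>u. X u \<omega> - X s \<omega>) ` {s..t})" for \<omega>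
  have S_less: "S \<omega> < v \<longleftrightarrow> (\<forall>u\<in>{s..t}. X u \<omega> - X s \<omega> < v)" if \<omega>: "\<omega> \<in> space M" for \<omega> v
  proof -
    have "continuous_on {s..t} (\<lambda>u. X u \<omega> - X s \<omega>)"
      using cont[OF \<omega>] st by (intro continuous_intros) (auto intro: continuous_on_subset)
    then obtain y where y: "y \<in> {s..t}" "\<And>u. u \<in> {s..t} \<Longrightarrow> X u \<omega> - X s \<omega> \<le> X y \<omega> - X s \<omega>"
      using continuous_attains_sup[of "{s..t}" "\<lambda>u. X u \<omega> - X s \<omega>"] st by force
    hence "S \<omega> = X y \<omega> - X s \<omega>" unfolding S_def by (intro cSup_eq_maximum) auto
    thus ?thesis using y by fastforce
  qed
  have Xm: "X u \<in> borel_measurable M" if "s \<le> u" "u \<le> t" for u using that st by (auto intro: X_measurable)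
  have S_set: "{\<omega> \<in> space M. S \<omega> < v} \<in> events" for v
  proof -
    have "{\<omega> \<in> space M. S \<omega> < v} = {\<omega> \<in> space M. \<forall>u\<in>{s..t}. X u \<omega> < X s \<omega> + v}"
      using S_less by (auto simp: algebra_simps)
    also have "\<dots> \<in> events" using st Xm by (intro sets_all_less) auto
    finally show ?thesis .
  qed
  have S[measurable]: "S \<in> borel_measurable M" using S_set by (simp add: borel_measurable_iff_less)
  have S_prob: "prob (A \<inter> {\<omega> \<in> space M. S \<omega> < v}) = prob A * psi (v / sqrt (t - s))" if "A \<in> sets (F s)" for A v
  proof -
    have "{\<omega> \<in> space M. S \<omega> < v} = {\<omega> \<in> space M. \<forall>u\<in>{s..t}. X u \<omega> - X s \<omega> < v}" using S_less by auto
    thus ?thesis using reflection[OF st that] by simp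
  qed
  have spF: "space (F s) = space M" using st by (intro space_F) auto
  have S_dist: "prob {\<omega> \<in> space M. S \<omega> < v} = psi (v / sqrt (t - s))" for v
  proof -
    have "space M \<in> sets (F s)" using spF sets.top[of "F s"] by simp
    from S_prob[OF this, of v] show ?thesis by (simp add: prob_space Int_def)
  qed
  have [measurable]: "\<phi> \<in> borel_measurable M" "V \<in> borel_measurable M"
    using \<phi> V st measurable_F[of s] by auto
  define Z where "Z \<omega> = (\<phi> \<omega>, V \<omega>)" for \<omega>
  have Zm[measurable]: "Z \<in> measurable M (borel \<Otimes>\<^sub>M borel)" unfolding Z_def by measurable
  have ZF: "Z \<in> measurable (F s) (borel \<Otimes>\<^sub>M borel)" unfolding Z_def using \<phi> V by measurable
  \<comment> \<open>The product formula is known for half-lines only; they are closed under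
    intersection and generate the Borel sets.\<close>
  define \<C> where "\<C> = {S -` B \<inter> space M | B. B \<in> range (lessThan :: real \<Rightarrow> _)}"
  have "indep_set (sets (F s)) \<C>"
  proof (rule indep_setI)
    show "sets (F s) \<subseteq> events" using st sets_F[of s] by auto
    show "\<C> \<subseteq> events" unfolding \<C>_def using measurable_sets[OF S] by auto
    show "prob (a \<inter> b) = prob a * prob b" if ab: "a \<in> sets (F s)" "b \<in> \<C>" for a b
    proof -
      obtain v where "b = {\<omega> \<in> space M. S \<omega> < v}" using ab(2) unfolding \<C>_def by (auto simp: vimage_def Int_def conj_commute)
      thus ?thesis using S_prob[OF ab(1)] S_dist by simp
    qed
  qed
  hence "indep_set (sigma_sets (space M) (sets (F s))) (sigma_sets (space M) \<C>)"
  proof (rule indep_set_sigma_sets)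
    show "Int_stable (sets (F s))" by (auto simp: Int_stable_def)
    show "Int_stable \<C>"
      unfolding \<C>_def Int_stable_def
    proof safe
      fix a b :: real
      show "\<exists>B. S -` {..<a} \<inter> space M \<inter> (S -` {..<b} \<inter> space M) = S -` B \<inter> space M \<and> B \<in> range lessThan"
        by (intro exI[of _ "{..<min a b}"]) auto
    qed
  qed
  hence ind: "indep_set (sets (F s)) (sigma_sets (space M) \<C>)"
    using sets.sigma_sets_eq[of "F s"] spF by simp
  have "sigma_sets (space M) \<C> = {S -` B \<inter> space M | B. B \<in> sigma_sets UNIV (range lessThan)}"
    unfolding \<C>_def by (rule sigma_sets_vimage_commute[symmetric]) auto
  hence SC: "sigma_sets (space M) \<C> = {S -` B \<inter> space M | B. B \<in> sets borel}"
    by (simp add: borel_Iio)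
  \<comment> \<open>The zero coordinate gives \<open>S'\<close> the same value type as
    \<open>Z\<close>, as \<open>indep_var\<close> requires.\<close>
  define S' where "S' \<omega> = (S \<omega>, 0 :: real)" for \<omega>
  have S'm[measurable]: "S' \<in> measurable M (borel \<Otimes>\<^sub>M borel)" unfolding S'_def by measurable
  have "indep_var (borel \<Otimes>\<^sub>M borel) Z (borel \<Otimes>\<^sub>M borel) S'"
    unfolding indep_var_eq
  proof (intro conjI)
    have 1: "sigma_sets (space M) {Z -` A \<inter> space M |A. A \<in> sets (borel \<Otimes>\<^sub>M borel)} \<subseteq> sets (F s)"
      using measurable_sets[OF ZF] unfolding spF[symmetric] by (intro sets.sigma_sets_subset) auto
    have 2: "sigma_sets (space M) {S' -` A \<inter> space M |A. A \<in> sets (borel \<Otimes>\<^sub>M borel)} \<subseteq> sigma_sets (space M) \<C>"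
    proof (rule sigma_sets_mono, safe)
      fix A :: "(real \<times> real) set" assume [measurable]: "A \<in> sets (borel \<Otimes>\<^sub>M borel)"
      have "(\<lambda>x. (x, 0 :: real)) -` A \<inter> space borel \<in> sets (borel :: real measure)"
        by (rule measurable_sets[of _ _ "borel \<Otimes>\<^sub>M borel"]) auto
      moreover have "S' -` A \<inter> space M = S -` ((\<lambda>x. (x, 0)) -` A \<inter> space borel) \<inter> space M"
        by (auto simp: S'_def)
      ultimately show "S' -` A \<inter> space M \<in> sigma_sets (space M) \<C>" unfolding SC by blast
    qed
    show "indep_set (sigma_sets (space M) {Z -` A \<inter> space M |A. A \<in> sets (borel \<Otimes>\<^sub>M borel)})
      (sigma_sets (space M) {S' -` A \<inter> space M |A. A \<in> sets (borel \<Otimes>\<^sub>M borel)})"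
      using ind 1 2 unfolding indep_sets2_eq by blast
  qed auto
  hence prod: "distr M (borel \<Otimes>\<^sub>M borel) Z \<Otimes>\<^sub>M distr M (borel \<Otimes>\<^sub>M borel) S' = distr M ((borel \<Otimes>\<^sub>M borel) \<Otimes>\<^sub>M (borel \<Otimes>\<^sub>M borel)) (\<lambda>\<omega>. (Z \<omega>, S' \<omega>))"
    unfolding indep_var_distribution_eq by blast
  interpret PZ: prob_space "distr M (borel \<Otimes>\<^sub>M borel) Z" by (rule prob_space_distr) simp
  interpret PS: prob_space "distr M (borel \<Otimes>\<^sub>M borel) S'" by (rule prob_space_distr) simp
  interpret PP: pair_prob_space "distr M (borel \<Otimes>\<^sub>M borel) Z" "distr M (borel \<Otimes>\<^sub>M borel) S'" ..
  define f where "f p = fst (fst p) * (if fst (snd p) < snd (fst p) then 1 else 0 :: real)" for p :: "(real \<times> real) \<times> (real \<times> real)"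
  have [measurable]: "f \<in> borel_measurable ((borel \<Otimes>\<^sub>M borel) \<Otimes>\<^sub>M (borel \<Otimes>\<^sub>M borel))" unfolding f_def by measurable
  have "(\<integral>\<omega>. \<phi> \<omega> * indicator {\<omega> \<in> space M. \<forall>u\<in>{s..t}. X u \<omega> - X s \<omega> < V \<omega>} \<omega> \<partial>M) = (\<integral>\<omega>. f (Z \<omega>, S' \<omega>) \<partial>M)"
    by (intro Bochner_Integration.integral_cong) (auto simp: f_def Z_def S'_def S_less)
  also have "\<dots> = (\<integral>p. f p \<partial>(distr M (borel \<Otimes>\<^sub>M borel) Z \<Otimes>\<^sub>M distr M (borel \<Otimes>\<^sub>M borel) S'))"
    unfolding prod by (subst integral_distr) auto
  also have "\<dots> = (\<integral>z. (\<integral>y. f (z, y) \<partial>distr M (borel \<Otimes>\<^sub>M borel) S') \<partial>distr M (borel \<Otimes>\<^sub>M borel) Z)"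
  proof (rule PP.integral_fst'[symmetric])
    have "integrable M (\<lambda>\<omega>. f (Z \<omega>, S' \<omega>))"
      by (rule integrable_const_bound[where B=1]) (auto simp: f_def Z_def \<phi>)
    thus "integrable (distr M (borel \<Otimes>\<^sub>M borel) Z \<Otimes>\<^sub>M distr M (borel \<Otimes>\<^sub>M borel) S') f"
      unfolding prod by (subst integrable_distr_eq) auto
  qed
  also have "\<dots> = (\<integral>z. fst z * psi (snd z / sqrt (t - s)) \<partial>distr M (borel \<Otimes>\<^sub>M borel) Z)"
  proof (intro Bochner_Integration.integral_cong refl)
    fix z :: "real \<times> real"
    have "(\<integral>y. f (z, y) \<partial>distr M (borel \<Otimes>\<^sub>M borel) S') = (\<integral>\<omega>. f (z, S' \<omega>) \<partial>M)"
      by (subst integral_distr) (auto simp: f_def)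
    also have "\<dots> = (\<integral>\<omega>. fst z * indicator {\<omega> \<in> space M. S \<omega> < snd z} \<omega> \<partial>M)"
      by (intro Bochner_Integration.integral_cong) (auto simp: f_def S'_def)
    also have "\<dots> = fst z * prob {\<omega> \<in> space M. S \<omega> < snd z}" by simp
    finally show "(\<integral>y. f (z, y) \<partial>distr M (borel \<Otimes>\<^sub>M borel) S') = fst z * psi (snd z / sqrt (t - s))" using S_dist by simp
  qed
  also have "\<dots> = (\<integral>\<omega>. \<phi> \<omega> * psi (V \<omega> / sqrt (t - s)) \<partial>M)"
    by (subst integral_distr) (auto simp: Z_def)
  finally show ?thesis .
qed

end

section \<open>Detecting the first long excursion on a grid\<close>

definition grid :: "real \<Rightarrow> nat \<Rightarrow> nat \<Rightarrow> real" where
  "grid T n k = real k * T / real (Suc n)"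

text \<open>Only the first conjunct looks beyond the grid time \<open>grid T n (Suc k)\<close>; the
  other two are decided by then. It demands negativity for time \<open>d\<close> from the grid time,
  slightly longer than the run itself guarantees, so that the window has the deterministic length
  needed by the reflection principle.\<close>

definition grid_event :: "real \<Rightarrow> real \<Rightarrow> (real \<Rightarrow> real) \<Rightarrow> nat \<Rightarrow> nat \<Rightarrow> bool" where
  "grid_event T d x n k \<longleftrightarrow> (\<forall>u\<in>{grid T n (Suc k)..grid T n (Suc k) + d}. x u < 0) \<and>
    (\<exists>s\<in>{grid T n k..grid T n (Suc k)}. x s \<ge> 0) \<and> \<not> (\<exists>a\<in>neg_runs T d x. a + d < grid T n (Suc k))"

text \<open>The value of \<open>f\<close> at the detection time, or 0. At most one summand differs
  from 0 when \<open>q\<close> is at most \<open>T\<close>; the form of a sum permits integrating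
  term by term, and the deadline \<open>q\<close> makes the detection decidable at time
  \<open>q\<close>.\<close>

definition grid_sum :: "real \<Rightarrow> real \<Rightarrow> (real \<Rightarrow> real) \<Rightarrow> real \<Rightarrow> nat \<Rightarrow> (real \<Rightarrow> real) \<Rightarrow> real" where
  "grid_sum T d x q n f =
    (\<Sum>k\<le>n. if grid T n (Suc k) + d < q \<and> grid_event T d x n k then f (grid T n (Suc k)) else 0)"

lemma grid_mono: "0 < T \<Longrightarrow> k \<le> l \<Longrightarrow> grid T n k \<le> grid T n l"
  unfolding grid_def by (intro divide_right_mono mult_right_mono) auto

lemma grid_nonneg: "0 < T \<Longrightarrow> 0 \<le> grid T n k"
  unfolding grid_def by auto

lemma grid_pos: "0 < T \<Longrightarrow> 0 < grid T n (Suc k)"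
  unfolding grid_def by auto

lemma grid_Suc: "grid T n (Suc k) = grid T n k + T / real (Suc n)"
  unfolding grid_def by (simp add: distrib_right add_divide_distrib)

text \<open>The negative stretch through the grid time starts at a zero \<open>a\<close>. An earlier
  run would have to end before this zero, hence before the grid time, which the last conjunct of
  \<open>grid_event\<close> forbids. The nonnegative value in the previous cell puts
  \<open>a\<close> into that cell.\<close>

lemma grid_event_imp_first_run:
  assumes cont: "continuous_on {0..T} x" and x0: "x 0 = 0" and T: "0 < T" and d: "0 < d"
    and ev: "grid_event T d x n k" and le: "grid T n (Suc k) + d \<le> T"
  obtains a where "first_run T d x a" "grid T n k \<le> a" "a < grid T n (Suc k)"
proof -
  let ?t = "grid T n (Suc k)"
  have neg: "\<And>u. u \<in> {?t..?t + d} \<Longrightarrow> x u < 0" and no: "\<And>b. b \<in> neg_runs T d x \<Longrightarrow> ?t \<le> b + d"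
    using ev unfolding grid_event_def by (auto simp: not_less)
  obtain s where s: "s \<in> {grid T n k..?t}" "x s \<ge> 0" using ev unfolding grid_event_def by blast
  obtain a where a: "0 \<le> a" "a < ?t" "x a = 0" "\<And>s. s \<in> {a<..?t} \<Longrightarrow> x s < 0"
    using neg_run_start[OF cont x0, of ?t] grid_pos[OF T] neg[of ?t] le d by (metis add_increasing2 add_le_cancel_left atLeastAtMost_iff dual_order.trans le_add_same_cancel1 less_eq_real_def order_refl)
  have "s \<le> a" using a(4)[of s] s by force
  have neg': "x u < 0" if "u \<in> {a<..?t + d}" for u
    using a(4)[of u] neg[of u] that by (cases "u \<le> ?t") auto
  have aR: "a \<in> neg_runs T d x" using a neg' le unfolding neg_runs_def by auto
  moreover have "a \<le> b" if b: "b \<in> neg_runs T d x" for b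
  proof (rule ccontr)
    assume "\<not> a \<le> b"
    hence "\<not> a \<le> b + d" using b a(3) unfolding neg_runs_def by force
    with no[OF b] a(2) show False by simp
  qed
  ultimately have "first_run T d x a" unfolding first_run_def by blast
  thus ?thesis using that s \<open>s \<le> a\<close> a by auto
qed

lemma grid_eventually:
  assumes cont: "continuous_on {0..T} x" and T: "0 < T" and d: "0 < d"
    and a: "first_run T d x a" and q: "a + d < q" "q \<le> T"
  obtains \<kappa> where "\<forall>\<^sub>F n in sequentially. \<kappa> n \<le> n \<and> grid T n (Suc (\<kappa> n)) + d < q \<and> grid_event T d x n (\<kappa> n)"
    and "filterlim (\<lambda>n. grid T n (Suc (\<kappa> n))) (at_right a) sequentially"
proof -
  have R: "0 \<le> a" "a + d \<le> T" "x a = 0" "\<And>s. s \<in> {a<..a + d} \<Longrightarrow> x s < 0"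
    using a unfolding first_run_def neg_runs_def by auto
  \<comment> \<open>The cell is half open: if \<open>a\<close> is itself a grid point, it is the
    left end, and the zero at \<open>a\<close> is the nonnegative value required.\<close>
  define \<kappa> where "\<kappa> n = nat \<lfloor>a * real (Suc n) / T\<rfloor>" for n
  define \<theta> where "\<theta> n = grid T n (Suc (\<kappa> n))" for n
  have \<kappa>: "real (\<kappa> n) \<le> a * real (Suc n) / T" "a * real (Suc n) / T < real (\<kappa> n) + 1" for n
    using R T unfolding \<kappa>_def by (simp_all add: of_nat_floor del: of_nat_Suc)
  have lower: "grid T n (\<kappa> n) \<le> a" for n
    using \<kappa>(1)[of n] T unfolding grid_def by (simp add: field_simps del: of_nat_Suc)
  have upper: "a < \<theta> n" for n
    using \<kappa>(2)[of n] T unfolding grid_def \<theta>_def by (simp add: field_simps)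
  have upper': "\<theta> n \<le> a + T / real (Suc n)" for n
    using lower[of n] unfolding \<theta>_def grid_Suc by simp
  have lim: "\<theta> \<longlonglongrightarrow> a"
  proof (rule tendsto_sandwich[of "\<lambda>_. a" _ _ "\<lambda>n. a + T / real (Suc n)"])
    have "(\<lambda>n. a + T / real (Suc n)) \<longlonglongrightarrow> a + 0"
      by (intro tendsto_intros LIMSEQ_Suc[OF lim_const_over_n])
    thus "(\<lambda>n. a + T / real (Suc n)) \<longlonglongrightarrow> a" by simp
    show "(\<lambda>n. a) \<longlonglongrightarrow> a" by simp
  qed (use upper upper' in \<open>auto intro!: always_eventually simp: less_imp_le\<close>)
  have fl: "filterlim \<theta> (at_right a) sequentially"
    unfolding filterlim_at using lim upper by (auto intro!: always_eventually simp: less_imp_neq[symmetric])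
  have "continuous (at (a + d) within {0..T}) x"
    using cont R d by (auto simp: continuous_on_eq_continuous_within)
  moreover have "x (a + d) < 0" using R d by auto
  ultimately have "\<forall>\<^sub>F s in at (a + d) within {0..T}. x s < 0"
    unfolding continuous_within by (rule order_tendstoD(2))
  then obtain e where e: "e > 0" "\<And>s. s \<in> {0..T} \<Longrightarrow> s \<noteq> a + d \<Longrightarrow> dist s (a + d) < e \<Longrightarrow> x s < 0"
    unfolding eventually_at by blast
  \<comment> \<open>The three bounds on the delay after \<open>a\<close>: continuity keeps the path
    negative until the delayed window ends; the window ends before the deadline \<open>q\<close>;
    and the detection comes before \<open>a + d\<close>, so no run has been completed yet.\<close>
  define m where "m = Min {e, q - (a + d), d}"
  have m: "m > 0" "m \<le> e" "m \<le> q - (a + d)" "m \<le> d" using e q d unfolding m_def by auto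
  have "\<forall>\<^sub>F n in sequentially. \<theta> n < a + m" using lim m(1) by (intro order_tendstoD) auto
  hence "\<forall>\<^sub>F n in sequentially. \<kappa> n \<le> n \<and> \<theta> n + d < q \<and> grid_event T d x n (\<kappa> n)"
  proof eventually_elim
    case (elim n)
    have neg: "x u < 0" if "u \<in> {\<theta> n..\<theta> n + d}" for u
    proof (cases "u \<le> a + d")
      case True thus ?thesis using that upper[of n] by (intro R) auto
    next
      case False thus ?thesis using that elim m R q d upper[of n] by (intro e(2)) (auto simp: dist_real_def)
    qed
    have "a * real (Suc n) / T < real (Suc n)" using R T d by (simp add: field_simps del: of_nat_Suc)
    hence "real (\<kappa> n) < real (Suc n)" using \<kappa>(1)[of n] by linarith
    hence "\<kappa> n \<le> n" by simp
    moreover have "\<theta> n \<le> b + d" if "b \<in> neg_runs T d x" for b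
      using a that elim m unfolding first_run_def by force
    hence "\<not> (\<exists>b\<in>neg_runs T d x. b + d < \<theta> n)" by (meson leD)
    moreover have "a \<in> {grid T n (\<kappa> n)..\<theta> n}" using lower[of n] upper[of n] by auto
    moreover have "\<theta> n + d < q" using elim m by auto
    ultimately show ?case unfolding grid_event_def \<theta>_def[symmetric] using neg R(3) by (metis order_refl)
  qed
  thus ?thesis using that fl unfolding \<theta>_def by blast
qed

lemma grid_event_unique:
  assumes cont: "continuous_on {0..T} x" and x0: "x 0 = 0" and T: "0 < T" and d: "0 < d"
    and k: "grid_event T d x n k" "grid T n (Suc k) + d \<le> T"
    and l: "grid_event T d x n l" "grid T n (Suc l) + d \<le> T"
  shows "k = l"
proof -
  obtain a where a: "first_run T d x a" "grid T n k \<le> a" "a < grid T n (Suc k)"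
    using grid_event_imp_first_run[OF cont x0 T d k] by blast
  obtain b where b: "first_run T d x b" "grid T n l \<le> b" "b < grid T n (Suc l)"
    using grid_event_imp_first_run[OF cont x0 T d l] by blast
  have "a = b" by (rule first_run_unique[OF a(1) b(1)])
  hence "\<not> Suc k \<le> l" "\<not> Suc l \<le> k" using a b grid_mono[OF T] by (meson leD order_trans)+
  thus ?thesis by simp
qed

lemma grid_sum_eq:
  assumes cont: "continuous_on {0..T} x" and x0: "x 0 = 0" and T: "0 < T" and d: "0 < d" and q: "q \<le> T"
    and k: "k \<le> n" "grid_event T d x n k" "grid T n (Suc k) + d < q"
  shows "grid_sum T d x q n f = f (grid T n (Suc k))"
proof -
  have "grid_sum T d x q n f = (\<Sum>l\<le>n. if l = k then f (grid T n (Suc k)) else 0)"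
    unfolding grid_sum_def
  proof (intro sum.cong refl)
    fix l
    have "l = k" if "grid T n (Suc l) + d < q \<and> grid_event T d x n l"
    proof (rule grid_event_unique[OF cont x0 T d])
      show "grid_event T d x n l" "grid T n (Suc l) + d \<le> T" using that q by auto
      show "grid_event T d x n k" "grid T n (Suc k) + d \<le> T" using k q by auto
    qed
    thus "(if grid T n (Suc l) + d < q \<and> grid_event T d x n l then f (grid T n (Suc l)) else 0) =
      (if l = k then f (grid T n (Suc k)) else 0)"
      using k(2,3) by (cases "l = k") auto
  qed
  thus ?thesis using k(1) by simp
qed

lemma grid_sum_bounded:
  assumes cont: "continuous_on {0..T} x" and x0: "x 0 = 0" and T: "0 < T" and d: "0 < d" and q: "q \<le> T"
    and f: "\<And>s. s + d < q \<Longrightarrow> x s < 0 \<Longrightarrow> \<bar>f s\<bar> \<le> 1"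
  shows "\<bar>grid_sum T d x q n f\<bar> \<le> 1"
proof (cases "\<exists>k\<le>n. grid T n (Suc k) + d < q \<and> grid_event T d x n k")
  case True
  then obtain k where k: "k \<le> n" "grid_event T d x n k" "grid T n (Suc k) + d < q" by blast
  moreover have "x (grid T n (Suc k)) < 0" using k(2) d unfolding grid_event_def by auto
  ultimately show ?thesis using grid_sum_eq[OF cont x0 T d q k, of f] f by simp
next
  case False
  hence "grid_sum T d x q n f = 0" unfolding grid_sum_def by (intro sum.neutral) auto
  thus ?thesis by simp
qed

text \<open>Detection times decrease to \<open>a\<close> without reaching it, so a right limit of
  \<open>f\<close> is enough. This is essential for the ratio of \<open>psi\<close> values, which at
  \<open>a\<close> itself is 0 / 0.\<close>

lemma grid_sum_tendsto:
  assumes cont: "continuous_on {0..T} x" and x0: "x 0 = 0" and T: "0 < T" and d: "0 < d" and q: "q \<le> T"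
    and f: "\<And>a. first_run T d x a \<Longrightarrow> a + d < q \<Longrightarrow> (f \<longlongrightarrow> l) (at_right a)"
  shows "(\<lambda>n. grid_sum T d x q n f) \<longlonglongrightarrow> (if \<exists>a. first_run T d x a \<and> a + d < q then l else 0)"
proof (cases "\<exists>a. first_run T d x a \<and> a + d < q")
  case True
  then obtain a where a: "first_run T d x a" "a + d < q" by blast
  obtain \<kappa> where \<kappa>: "\<forall>\<^sub>F n in sequentially. \<kappa> n \<le> n \<and> grid T n (Suc (\<kappa> n)) + d < q \<and> grid_event T d x n (\<kappa> n)"
    and lim: "filterlim (\<lambda>n. grid T n (Suc (\<kappa> n))) (at_right a) sequentially"
    using grid_eventually[OF cont T d a q] by blast
  from \<kappa> have "\<forall>\<^sub>F n in sequentially. f (grid T n (Suc (\<kappa> n))) = grid_sum T d x q n f"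
    by eventually_elim (rule grid_sum_eq[OF cont x0 T d q, symmetric], auto)
  moreover have "(\<lambda>n. f (grid T n (Suc (\<kappa> n)))) \<longlonglongrightarrow> l"
    using filterlim_compose[OF f[OF a] lim] .
  ultimately have "(\<lambda>n. grid_sum T d x q n f) \<longlonglongrightarrow> l" by (rule Lim_transform_eventually[rotated])
  thus ?thesis using True by simp
next
  case False
  have "grid_sum T d x q n f = 0" for n
    unfolding grid_sum_def
  proof (intro sum.neutral ballI)
    fix k
    have False if ev: "grid_event T d x n k" and le: "grid T n (Suc k) + d < q"
    proof -
      obtain a where "first_run T d x a" "a < grid T n (Suc k)"
        using grid_event_imp_first_run[OF cont x0 T d ev] le q by auto
      thus False using False le by force
    qed
    thus "(if grid T n (Suc k) + d < q \<and> grid_event T d x n k then f (grid T n (Suc k)) else 0) = 0" by auto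
  qed
  thus ?thesis using False by (simp only: if_False) simp
qed

lemma shifted_path_at_right:
  fixes x :: "real \<Rightarrow> real"
  assumes cont: "continuous_on {0..T} x" and a: "0 \<le> a" "0 \<le> d" "a + d < T"
  shows "((\<lambda>s. x (s + d)) \<longlongrightarrow> x (a + d)) (at_right a)"
proof -
  have "continuous_on {a..T - d} (\<lambda>s. x (s + d))"
    using a by (intro continuous_on_compose2[OF cont, of _ "\<lambda>s. s + d"]) (auto intro!: continuous_intros)
  hence "continuous (at a within {a..T - d}) (\<lambda>s. x (s + d))"
    using a by (auto simp: continuous_on_eq_continuous_within)
  thus ?thesis using a by (simp add: continuous_within at_within_Icc_at_right)
qed

section \<open>Survival until maturity as a path property\<close>

text \<open>Holds vacuously without a run. It also holds if the first run ends exactly at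
  \<open>T\<close>, since a negative value exceeds its double.\<close>

definition survives :: "real \<Rightarrow> real \<Rightarrow> (real \<Rightarrow> real) \<Rightarrow> bool" where
  "survives T d x \<longleftrightarrow> (\<forall>a. first_run T d x a \<longrightarrow> (\<forall>u\<in>{a + d..T}. x u > 2 * x (a + d)))"

lemma not_survives_iff:
  assumes d: "0 < d"
  shows "\<not> survives T d x \<longleftrightarrow> (\<exists>a. first_run T d x a \<and> a + d < T \<and> (\<exists>u\<in>{a + d..T}. x u \<le> 2 * x (a + d)))"
    (is "?L \<longleftrightarrow> ?R")
proof
  assume ?L
  then obtain a u where a: "first_run T d x a" and u: "u \<in> {a + d..T}" "x u \<le> 2 * x (a + d)"
    unfolding survives_def by force
  have "x (a + d) < 0" "a + d \<le> T" using a d unfolding first_run_def neg_runs_def by auto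
  with u have "u \<noteq> a + d" by auto
  with u have "a + d < T" by auto
  with a u show ?R by blast
next
  assume ?R thus ?L unfolding survives_def by force
qed

text \<open>A countable description that yields measurability: the level at the random time
  \<open>a + d\<close> is replaced by its values at detected grid times. A margin independent of
  \<open>n\<close> keeps the inequality strict in the limit.\<close>

lemma survives_iff_grid:
  assumes cont: "continuous_on {0..T} x" and x0: "x 0 = 0" and T: "0 < T" and d: "0 < d"
  shows "survives T d x \<longleftrightarrow> \<not> (\<exists>a\<in>neg_runs T d x. a + d < T) \<or>
    (\<exists>m n0. \<forall>n\<ge>n0. \<exists>k\<le>n. grid T n (Suc k) + d < T \<and> grid_event T d x n k \<and>
      (\<forall>u\<in>{grid T n (Suc k) + d..T}. x u > 2 * x (grid T n (Suc k) + d) + 1 / real (Suc m)))"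
    (is "_ \<longleftrightarrow> \<not> ?N \<or> ?G")
proof (cases ?N)
  case False
  hence "\<not> (\<exists>a. first_run T d x a \<and> a + d < T)" unfolding first_run_def by blast
  hence "survives T d x" using not_survives_iff[OF d] by blast
  thus ?thesis using False by simp
next
  case True
  then obtain b where b: "b \<in> neg_runs T d x" "b + d < T" by blast
  then obtain a where a: "first_run T d x a" using first_run_ex[OF d] by blast
  have aT: "a + d < T" using a b unfolding first_run_def by force
  have R: "0 \<le> a" "x a = 0" "x (a + d) < 0" using a d unfolding first_run_def neg_runs_def by auto
  have surv: "survives T d x \<longleftrightarrow> (\<forall>u\<in>{a + d..T}. x u > 2 * x (a + d))"
    unfolding survives_def using first_run_unique[OF a] a by blast
  have contd: "((\<lambda>s. x (s + d)) \<longlongrightarrow> x (a + d)) (at_right a)"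
    using shifted_path_at_right[OF cont R(1) _ aT] d by simp
  show ?thesis
  proof
    assume "survives T d x"
    hence s: "\<And>u. u \<in> {a + d..T} \<Longrightarrow> x u > 2 * x (a + d)" using surv by blast
    have "continuous_on {a + d..T} x" using cont R d by (auto intro: continuous_on_subset)
    then obtain w where w: "w \<in> {a + d..T}" "\<And>u. u \<in> {a + d..T} \<Longrightarrow> x w \<le> x u"
      using continuous_attains_inf[of "{a + d..T}" x] aT by force
    obtain m where m: "1 / real (Suc m) < x w - 2 * x (a + d)"
      using nat_approx_posE[of "x w - 2 * x (a + d)"] s[OF w(1)] by auto
    obtain \<kappa> where \<kappa>: "\<forall>\<^sub>F n in sequentially. \<kappa> n \<le> n \<and> grid T n (Suc (\<kappa> n)) + d < T \<and> grid_event T d x n (\<kappa> n)"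
      and lim: "filterlim (\<lambda>n. grid T n (Suc (\<kappa> n))) (at_right a) sequentially"
      using grid_eventually[OF cont T d a aT] by blast
    have "(\<lambda>n. x w - 2 * x (grid T n (Suc (\<kappa> n)) + d)) \<longlonglongrightarrow> x w - 2 * x (a + d)"
      using filterlim_compose[OF contd lim] by (intro tendsto_intros)
    hence "\<forall>\<^sub>F n in sequentially. 1 / real (Suc m) < x w - 2 * x (grid T n (Suc (\<kappa> n)) + d)"
      using m by (rule order_tendstoD(1))
    moreover have "\<forall>\<^sub>F n in sequentially. a < grid T n (Suc (\<kappa> n))"
      using lim[unfolded filterlim_at] by (auto elim: eventually_mono)
    ultimately have "\<forall>\<^sub>F n in sequentially. \<exists>k\<le>n. grid T n (Suc k) + d < T \<and> grid_event T d x n k \<and>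
      (\<forall>u\<in>{grid T n (Suc k) + d..T}. x u > 2 * x (grid T n (Suc k) + d) + 1 / real (Suc m))"
      using \<kappa>
    proof eventually_elim
      case (elim n)
      have "x u > 2 * x (grid T n (Suc (\<kappa> n)) + d) + 1 / real (Suc m)" if "u \<in> {grid T n (Suc (\<kappa> n)) + d..T}" for u
        using w(2)[of u] that elim by (auto simp del: of_nat_Suc)
      thus ?case using elim by blast
    qed
    thus "\<not> ?N \<or> ?G" unfolding eventually_sequentially by blast
  next
    assume "\<not> ?N \<or> ?G"
    with True obtain m n0 where G: "\<And>n. n \<ge> n0 \<Longrightarrow> \<exists>k\<le>n. grid T n (Suc k) + d < T \<and> grid_event T d x n k \<and>
      (\<forall>u\<in>{grid T n (Suc k) + d..T}. x u > 2 * x (grid T n (Suc k) + d) + 1 / real (Suc m))" by blast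
    obtain \<kappa> where \<kappa>: "\<forall>\<^sub>F n in sequentially. \<kappa> n \<le> n \<and> grid T n (Suc (\<kappa> n)) + d < T \<and> grid_event T d x n (\<kappa> n)"
      and lim: "filterlim (\<lambda>n. grid T n (Suc (\<kappa> n))) (at_right a) sequentially"
      using grid_eventually[OF cont T d a aT] by blast
    show "survives T d x" unfolding surv
    proof
      fix u assume u: "u \<in> {a + d..T}"
      show "x u > 2 * x (a + d)"
      proof (cases "u = a + d")
        case False
        have "(\<lambda>n. grid T n (Suc (\<kappa> n))) \<longlonglongrightarrow> a" using lim[unfolded filterlim_at] by auto
        moreover have "a < u - d" using u False by auto
        ultimately have "\<forall>\<^sub>F n in sequentially. grid T n (Suc (\<kappa> n)) < u - d"
          by (rule order_tendstoD(2))
        hence ev: "\<forall>\<^sub>F n in sequentially. 2 * x (grid T n (Suc (\<kappa> n)) + d) + 1 / real (Suc m) \<le> x u"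
          using \<kappa> eventually_ge_at_top[of n0]
        proof eventually_elim
          case (elim n)
          from G[OF elim(3)] obtain k where k: "grid T n (Suc k) + d < T" "grid_event T d x n k"
            "\<forall>u\<in>{grid T n (Suc k) + d..T}. x u > 2 * x (grid T n (Suc k) + d) + 1 / real (Suc m)" by blast
          \<comment> \<open>Both indices detect the same first run, so the margin is available along
            the detection times that tend to \<open>a\<close>.\<close>
          have "k = \<kappa> n" using grid_event_unique[OF cont x0 T d, of n k "\<kappa> n"] k elim by auto
          moreover have "u \<in> {grid T n (Suc k) + d..T}" using \<open>k = \<kappa> n\<close> elim u by auto
          ultimately show ?case using k(3) by (metis less_imp_le)
        qed
        have "(\<lambda>n. 2 * x (grid T n (Suc (\<kappa> n)) + d) + 1 / real (Suc m)) \<longlonglongrightarrow> 2 * x (a + d) + 1 / real (Suc m)"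
          using filterlim_compose[OF contd lim] by (intro tendsto_intros)
        hence "2 * x (a + d) + 1 / real (Suc m) \<le> x u" by (rule tendsto_upperbound[OF _ ev]) simp
        moreover have "1 / real (Suc m) > 0" by simp
        ultimately show ?thesis by linarith
      qed (use R in simp)
    qed
  qed
qed

section \<open>Measurability of the excursion events and the reflection at a grid time\<close>

context cts_bm begin

text \<open>Here and below \<open>N\<close> is left open, so that the same proofs serve
  \<open>M\<close>, the filtration and the sigma-algebra generated by the path alone.\<close>

lemma sets_run_before:
  assumes d: "0 < d" and t: "0 \<le> t" "t \<le> T" and sp: "space N = space M"
    and X: "\<And>u. u \<in> {0..t} \<Longrightarrow> X u \<in> borel_measurable N"
  shows "{\<omega> \<in> space M. \<exists>a\<in>neg_runs T d (\<lambda>u. X u \<omega>). a + d < t} \<in> sets N"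
proof -
  define S where "S p q = (if 0 \<le> p \<and> q \<le> t \<and> d < q - p then {\<omega> \<in> space M. \<forall>s\<in>{p..q}. X s \<omega> < 0} else {})" for p q
  have "S p q \<in> sets N" for p q
  proof (cases "0 \<le> p \<and> q \<le> t \<and> d < q - p")
    case True
    hence "{\<omega> \<in> space M. \<forall>s\<in>{p..q}. X s \<omega> < (\<lambda>_. 0) \<omega>} \<in> sets N"
      using d t sp X by (intro sets_all_less) auto
    thus ?thesis using True by (simp add: S_def)
  qed (auto simp: S_def)
  hence "(\<Union>p\<in>\<rat>. \<Union>q\<in>\<rat>. S p q) \<in> sets N"
    by (intro sets.countable_UN'' countable_rat)
  also have "(\<Union>p\<in>\<rat>. \<Union>q\<in>\<rat>. S p q) = {\<omega> \<in> space M. \<exists>a\<in>neg_runs T d (\<lambda>u. X u \<omega>). a + d < t}"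
  proof -
    have "\<omega> \<in> (\<Union>p\<in>\<rat>. \<Union>q\<in>\<rat>. S p q) \<longleftrightarrow> (\<exists>a\<in>neg_runs T d (\<lambda>u. X u \<omega>). a + d < t)" if "\<omega> \<in> space M" for \<omega>
      unfolding run_before_iff[OF cont[OF that] start[OF that] d t(2)] S_def using that by (auto split: if_splits)
    moreover have "(\<Union>p\<in>\<rat>. \<Union>q\<in>\<rat>. S p q) \<subseteq> space M" by (auto simp: S_def split: if_splits)
    ultimately show ?thesis by blast
  qed
  finally show ?thesis .
qed

text \<open>The part of the grid event that is known at the grid time. Negativity at that time is
  included so that the value of \<open>psi\<close> to be divided by is positive on this set.\<close>

definition entry_set :: "real \<Rightarrow> nat \<Rightarrow> nat \<Rightarrow> 'a set" where
  "entry_set d n k = {\<omega> \<in> space M. X (grid T n (Suc k)) \<omega> < 0 \<and>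
    (\<exists>s\<in>{grid T n k..grid T n (Suc k)}. X s \<omega> \<ge> 0) \<and>
    \<not> (\<exists>a\<in>neg_runs T d (\<lambda>u. X u \<omega>). a + d < grid T n (Suc k))}"

lemma sets_entry_set:
  assumes T: "0 < T" and d: "0 < d" and t: "grid T n (Suc k) \<le> T" and sp: "space N = space M"
    and X: "\<And>u. u \<in> {0..grid T n (Suc k)} \<Longrightarrow> X u \<in> borel_measurable N"
  shows "entry_set d n k \<in> sets N"
proof -
  let ?t = "grid T n (Suc k)"
  have t0: "0 \<le> ?t" "0 \<le> grid T n k" "grid T n k \<le> ?t"
    using T by (auto intro: grid_nonneg grid_mono)
  have [measurable]: "X ?t \<in> borel_measurable N" using X t0 by auto
  have "{\<omega> \<in> space N. X ?t \<omega> < 0} \<in> sets N" by measurable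
  moreover have "{\<omega> \<in> space M. \<forall>s\<in>{grid T n k..?t}. X s \<omega> < (\<lambda>_. 0) \<omega>} \<in> sets N"
    using t0 t sp X by (intro sets_all_less) auto
  moreover have "{\<omega> \<in> space M. \<exists>a\<in>neg_runs T d (\<lambda>u. X u \<omega>). a + d < ?t} \<in> sets N"
    using t0 t sp X d by (intro sets_run_before) auto
  moreover have "entry_set d n k = {\<omega> \<in> space N. X ?t \<omega> < 0} - {\<omega> \<in> space M. \<forall>s\<in>{grid T n k..?t}. X s \<omega> < (\<lambda>_. 0) \<omega>}
      - {\<omega> \<in> space M. \<exists>a\<in>neg_runs T d (\<lambda>u. X u \<omega>). a + d < ?t}"
    unfolding entry_set_def sp by (auto simp: not_less)
  ultimately show ?thesis by auto
qed

definition event_set :: "real \<Rightarrow> nat \<Rightarrow> nat \<Rightarrow> 'a set" where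
  "event_set d n k = {\<omega> \<in> space M. grid_event T d (\<lambda>u. X u \<omega>) n k}"

lemma event_set_eq:
  assumes d: "0 < d"
  shows "event_set d n k = entry_set d n k \<inter> {\<omega> \<in> space M. \<forall>u\<in>{grid T n (Suc k)..grid T n (Suc k) + d}. X u \<omega> < 0}"
  unfolding event_set_def entry_set_def grid_event_def using d by auto

lemma sets_event_set:
  assumes T: "0 < T" and d: "0 < d" and t: "grid T n (Suc k) + d \<le> T" and sp: "space N = space M"
    and X: "\<And>u. u \<in> {0..grid T n (Suc k) + d} \<Longrightarrow> X u \<in> borel_measurable N"
  shows "event_set d n k \<in> sets N"
proof -
  have t0: "0 \<le> grid T n (Suc k)" using T by (auto intro: grid_nonneg)
  have "entry_set d n k \<in> sets N" using T d t sp X by (intro sets_entry_set) auto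
  moreover have "{\<omega> \<in> space M. \<forall>s\<in>{grid T n (Suc k)..grid T n (Suc k) + d}. X s \<omega> < (\<lambda>_. 0) \<omega>} \<in> sets N"
    using t0 t sp X d by (intro sets_all_less) auto
  ultimately show ?thesis unfolding event_set_eq[OF d] by auto
qed

lemma sets_event_set_F:
  assumes "0 < T" "0 < d" "grid T n (Suc k) + d \<le> t" "t \<le> T"
  shows "event_set d n k \<in> sets (F t)"
  using assms grid_nonneg[of T n "Suc k"] by (intro sets_event_set) (auto simp: space_F intro: X_measurable_F)

lemma sets_survives:
  assumes T: "0 < T" and d: "0 < d" and sp: "space N = space M"
    and X: "\<And>u. u \<in> {0..T} \<Longrightarrow> X u \<in> borel_measurable N"
  shows "{\<omega> \<in> space M. survives T d (\<lambda>u. X u \<omega>)} \<in> sets N"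
proof -
  define B where "B m n k = (if grid T n (Suc k) + d < T then
    event_set d n k \<inter> {\<omega> \<in> space M. \<forall>u\<in>{grid T n (Suc k) + d..T}. X u \<omega> > 2 * X (grid T n (Suc k) + d) \<omega> + 1 / real (Suc m)}
    else {})" for m n k
  have B: "B m n k \<in> sets N" for m n k
  proof (cases "grid T n (Suc k) + d < T")
    case True
    let ?c = "grid T n (Suc k) + d"
    have c: "0 \<le> ?c" using T d grid_nonneg[of T n "Suc k"] by auto
    interpret U: cts_bm M F T "\<lambda>t \<omega>. - X t \<omega>" by (rule uminus_cts_bm)
    have [measurable]: "X ?c \<in> borel_measurable N" using X c True by auto
    have "{\<omega> \<in> space M. \<forall>u\<in>{?c..T}. - X u \<omega> < - 2 * X ?c \<omega> - 1 / real (Suc m)} \<in> sets N"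
      using c True sp X by (intro U.sets_all_less) auto
    also have "{\<omega> \<in> space M. \<forall>u\<in>{?c..T}. - X u \<omega> < - 2 * X ?c \<omega> - 1 / real (Suc m)} =
        {\<omega> \<in> space M. \<forall>u\<in>{?c..T}. X u \<omega> > 2 * X ?c \<omega> + 1 / real (Suc m)}" by (intro Collect_cong conj_cong ball_cong) auto
    finally have "{\<omega> \<in> space M. \<forall>u\<in>{?c..T}. X u \<omega> > 2 * X ?c \<omega> + 1 / real (Suc m)} \<in> sets N" .
    moreover have "event_set d n k \<in> sets N" using T d True sp X by (intro sets_event_set) auto
    ultimately show ?thesis using True by (simp add: B_def)
  qed (simp add: B_def)
  have "(\<Union>m. \<Union>n0. \<Inter>n\<in>{n0..}. \<Union>k\<le>n. B m n k) \<in> sets N"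
  proof (intro sets.countable_UN image_subsetI)
    fix m n0
    have "(\<Inter>n\<in>{n0..}. \<Union>k\<le>n. B m n k) \<in> sets N"
    proof (rule sets.countable_INT)
      show "(\<lambda>n. \<Union>k\<le>n. B m n k) ` {n0..} \<subseteq> sets N" using B by (auto intro!: sets.finite_UN)
    qed auto
    thus "(\<Inter>n\<in>{n0..}. \<Union>k\<le>n. B m n k) \<in> sets N" .
  qed
  moreover have "{\<omega> \<in> space M. \<exists>a\<in>neg_runs T d (\<lambda>u. X u \<omega>). a + d < T} \<in> sets N"
    using T d sp X by (intro sets_run_before) auto
  moreover have "{\<omega> \<in> space M. survives T d (\<lambda>u. X u \<omega>)} =
    (space N - {\<omega> \<in> space M. \<exists>a\<in>neg_runs T d (\<lambda>u. X u \<omega>). a + d < T}) \<union>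
    (\<Union>m. \<Union>n0. \<Inter>n\<in>{n0..}. \<Union>k\<le>n. B m n k)" (is "?L = ?R1 \<union> ?R2")
  proof -
    have mem: "\<omega> \<in> B m n k \<longleftrightarrow> grid T n (Suc k) + d < T \<and> grid_event T d (\<lambda>u. X u \<omega>) n k \<and>
      (\<forall>u\<in>{grid T n (Suc k) + d..T}. X u \<omega> > 2 * X (grid T n (Suc k) + d) \<omega> + 1 / real (Suc m))"
      if "\<omega> \<in> space M" for \<omega> m n k using that unfolding B_def event_set_def by auto
    have "\<omega> \<in> ?L \<longleftrightarrow> \<omega> \<in> ?R1 \<union> ?R2" if \<omega>: "\<omega> \<in> space M" for \<omega>
    proof -
      have "\<omega> \<in> ?R2 \<longleftrightarrow> (\<exists>m n0. \<forall>n\<ge>n0. \<exists>k\<le>n. \<omega> \<in> B m n k)"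
        unfolding UN_iff INT_iff by (simp add: Bex_def Ball_def)
      thus ?thesis using \<omega> survives_iff_grid[OF cont[OF \<omega>] start[OF \<omega>] T d] unfolding mem[OF \<omega>] sp by blast
    qed
    moreover have "?R1 \<subseteq> space M" using sp by auto
    moreover have "B m n k \<subseteq> space M" for m n k unfolding B_def event_set_def by auto
    hence "(\<Union>k\<le>n. B m n k) \<subseteq> space M" for m n by blast
    hence "(\<Inter>n\<in>{n0..}. \<Union>k\<le>n. B m n k) \<subseteq> space M" for m n0 by blast
    hence "?R2 \<subseteq> space M" by (intro UN_least)
    ultimately show ?thesis by blast
  qed
  ultimately show ?thesis by auto
qed

text \<open>A run that ends exactly at \<open>T\<close> escapes the strict criterion of
  \<open>sets_run_before\<close>, but its start \<open>T - d\<close> is deterministic, so it can be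
  described directly.\<close>

lemma sets_run_until:
  assumes T: "0 < T" and d: "0 < d"
  shows "{\<omega> \<in> space M. neg_runs T d (\<lambda>u. X u \<omega>) \<noteq> {}} \<in> events"
proof -
  \<comment> \<open>The half-open stretch after \<open>T - d\<close> is exhausted by closed
    intervals, the form that \<open>sets_all_less\<close> handles.\<close>
  define S where "S = (if d \<le> T then {\<omega> \<in> space M. X (T - d) \<omega> = 0} \<inter>
    (\<Inter>m. {\<omega> \<in> space M. \<forall>s\<in>{T - d + d / real (Suc m)..T}. X s \<omega> < 0}) else {})"
  have "S \<in> events"
  proof (cases "d \<le> T")
    case True
    hence [measurable]: "X (T - d) \<in> borel_measurable M" using d by (intro X_measurable) auto
    have "{\<omega> \<in> space M. \<forall>s\<in>{T - d + d / real (Suc m)..T}. X s \<omega> < (\<lambda>_. 0) \<omega>} \<in> events" for m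
    proof (rule sets_all_less)
      have "d / real (Suc m) > 0" using d by simp
      thus pos: "0 \<le> T - d + d / real (Suc m)" using True by linarith
      show "T - d + d / real (Suc m) \<le> T" using d by (simp add: divide_le_eq)
      show "X u \<in> borel_measurable M" if "u \<in> {T - d + d / real (Suc m)..T}" for u
        using that pos by (intro X_measurable) auto
    qed auto
    moreover have "{\<omega> \<in> space M. X (T - d) \<omega> = 0} \<in> events" by measurable
    ultimately show ?thesis using True unfolding S_def by auto
  qed (simp add: S_def)
  moreover have "{\<omega> \<in> space M. \<exists>a\<in>neg_runs T d (\<lambda>u. X u \<omega>). a + d < T} \<in> events"
    using T d by (intro sets_run_before) (auto intro: X_measurable)
  moreover have "\<omega> \<in> S \<longleftrightarrow> T - d \<in> neg_runs T d (\<lambda>u. X u \<omega>)" if "\<omega> \<in> space M" for \<omega>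
  proof (cases "d \<le> T")
    case True
    have "(\<forall>m. \<forall>s\<in>{T - d + d / real (Suc m)..T}. X s \<omega> < 0) \<longleftrightarrow> (\<forall>s\<in>{T - d<..T}. X s \<omega> < 0)"
    proof safe
      fix s assume a: "\<forall>m. \<forall>s\<in>{T - d + d / real (Suc m)..T}. X s \<omega> < 0" and s: "s \<in> {T - d<..T}"
      obtain m where "1 / real (Suc m) < (s - (T - d)) / d" using nat_approx_posE[of "(s - (T - d)) / d"] s d by auto
      hence "d / real (Suc m) < s - (T - d)" using d by (simp add: field_simps del: of_nat_Suc)
      thus "X s \<omega> < 0" using a s by (auto simp del: of_nat_Suc dest!: spec[of _ m])
    next
      fix m s assume "\<forall>s\<in>{T - d<..T}. X s \<omega> < 0" "s \<in> {T - d + d / real (Suc m)..T}"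
      moreover have "d / real (Suc m) > 0" using d by simp
      ultimately show "X s \<omega> < 0" by (auto simp del: of_nat_Suc)
    qed
    thus ?thesis using that True unfolding S_def neg_runs_def by auto
  qed (auto simp: S_def neg_runs_def)
  hence "{\<omega> \<in> space M. neg_runs T d (\<lambda>u. X u \<omega>) \<noteq> {}} =
      {\<omega> \<in> space M. \<exists>a\<in>neg_runs T d (\<lambda>u. X u \<omega>). a + d < T} \<union> S"
  proof -
    assume *: "\<And>\<omega>. \<omega> \<in> space M \<Longrightarrow> \<omega> \<in> S \<longleftrightarrow> T - d \<in> neg_runs T d (\<lambda>u. X u \<omega>)"
    have "S \<subseteq> space M" unfolding S_def by auto
    moreover have "a + d < T \<or> a = T - d" if "a \<in> neg_runs T d (\<lambda>u. X u \<omega>)" for a \<omega>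
      using that unfolding neg_runs_def by auto
    ultimately show ?thesis using * by blast
  qed
  ultimately show ?thesis by auto
qed

text \<open>
  After the deterministic time \<open>t + d\<close> the increments of \<open>- X\<close> and \<open>X\<close> have the same law, which turns
  the absence of a default into \<open>X\<close> staying negative on \<open>{t..T}\<close>.
\<close>

lemma grid_event_identity:
  fixes n k :: nat
  assumes T: "0 < T" and d: "0 < d"
  defines "t \<equiv> grid T n (Suc k)"
  assumes tT: "t + d < T"
  shows "(\<integral>\<omega>. indicator (event_set d n k) \<omega> * indicator {\<omega> \<in> space M. \<exists>u\<in>{t + d..T}. X u \<omega> \<le> 2 * X (t + d) \<omega>} \<omega> \<partial>M) =
    (\<integral>\<omega>. indicator (event_set d n k) \<omega> * (1 - psi (- X t \<omega> / sqrt (T - t)) / psi (- X t \<omega> / sqrt d)) \<partial>M)"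
    and "integrable M (\<lambda>\<omega>. indicator (event_set d n k) \<omega> * indicator {\<omega> \<in> space M. \<exists>u\<in>{t + d..T}. X u \<omega> \<le> 2 * X (t + d) \<omega>} \<omega> :: real)"
    and "integrable M (\<lambda>\<omega>. indicator (event_set d n k) \<omega> * (1 - psi (- X t \<omega> / sqrt (T - t)) / psi (- X t \<omega> / sqrt d)))"
proof -
  let ?c = "t + d"
  let ?A = "entry_set d n k" and ?E = "event_set d n k"
  let ?L = "{\<omega> \<in> space M. \<exists>u\<in>{?c..T}. X u \<omega> \<le> 2 * X ?c \<omega>}"
  let ?R = "\<lambda>\<omega>. psi (- X t \<omega> / sqrt (T - t)) / psi (- X t \<omega> / sqrt d)"
  have t0: "0 \<le> t" using T unfolding t_def by (auto intro: grid_nonneg)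
  interpret U: cts_bm M F T "\<lambda>t \<omega>. - X t \<omega>" by (rule uminus_cts_bm)
  have AF: "?A \<in> sets (F t)" using T d tT t0 unfolding t_def
    by (intro sets_entry_set) (auto simp: space_F intro: X_measurable_F)
  have EF: "?E \<in> sets (F ?c)" using T d tT unfolding t_def by (intro sets_event_set_F) auto
  have XF: "X t \<in> borel_measurable (F t)" "X ?c \<in> borel_measurable (F ?c)" using t0 tT d by (auto intro: adapted)
  have Ev[measurable]: "?E \<in> events" "?A \<in> events" using EF AF sets_F[of ?c] sets_F[of t] t0 tT d by auto
  have [measurable]: "X t \<in> borel_measurable M" "X ?c \<in> borel_measurable M" using t0 tT d by (auto intro: X_measurable)
  have Xu: "X u \<in> borel_measurable M" if "u \<in> {0..T}" for u using that by (rule X_measurable)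
  have negA: "X t \<omega> < 0" if "\<omega> \<in> ?A" for \<omega> using that unfolding entry_set_def t_def by auto
  have L1: "{\<omega> \<in> space M. \<forall>u\<in>{?c..T}. - X u \<omega> < - 2 * X ?c \<omega>} \<in> events"
    using t0 d tT Xu by (intro U.sets_all_less) auto
  have Lev[measurable]: "?L \<in> events"
  proof -
    have "?L = space M - {\<omega> \<in> space M. \<forall>u\<in>{?c..T}. - X u \<omega> < - 2 * X ?c \<omega>}" by (auto simp: not_less)
    thus ?thesis using L1 by auto
  qed
  have R01: "0 \<le> ?R \<omega>" "?R \<omega> \<le> 1" for \<omega>
    using psi_ratio_bounds[of d "T - t" "- X t \<omega>"] d tT by auto
  have Rm: "?R \<in> borel_measurable (F t)" using XF(1) by measurable
  have "t \<in> {0..T}" using t0 tT d by auto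
  from measurable_F[OF this Rm] have [measurable]: "?R \<in> borel_measurable M" .

  have "(\<integral>\<omega>. indicator ?E \<omega> * indicator (space M - ?L) \<omega> \<partial>M) =
      (\<integral>\<omega>. indicator ?E \<omega> * indicator {\<omega> \<in> space M. \<forall>u\<in>{?c..T}. - X u \<omega> - - X ?c \<omega> < - X ?c \<omega>} \<omega> \<partial>M :: real)"
    by (intro Bochner_Integration.integral_cong refl arg_cong2[where f="(*)"]) (auto simp: indicator_def not_le)
  \<comment> \<open>The barrier - X_{t+d} is known at \<open>?c\<close>, so the formula for - X
    turns survival into a \<open>psi\<close> term, and the same formula for X turns that term into X
    staying negative after \<open>?c\<close>.\<close>
  also have "\<dots> = (\<integral>\<omega>. indicator ?E \<omega> * psi (- X ?c \<omega> / sqrt (T - ?c)) \<partial>M)"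
    using t0 d tT EF XF by (intro U.reflection_integral) (auto simp: indicator_def)
  also have "\<dots> = (\<integral>\<omega>. indicator ?E \<omega> * indicator {\<omega> \<in> space M. \<forall>u\<in>{?c..T}. X u \<omega> - X ?c \<omega> < - X ?c \<omega>} \<omega> \<partial>M)"
    using t0 d tT EF XF by (intro reflection_integral[symmetric]) (auto simp: indicator_def)
  \<comment> \<open>The windows before and after \<open>?c\<close> join into one window from
    \<open>t\<close> to \<open>T\<close>, to which the reflection principle applies once more at
    time \<open>t\<close>.\<close>
  also have "\<dots> = (\<integral>\<omega>. indicator ?A \<omega> * indicator {\<omega> \<in> space M. \<forall>u\<in>{t..T}. X u \<omega> - X t \<omega> < - X t \<omega>} \<omega> \<partial>M)"
  proof (intro Bochner_Integration.integral_cong refl)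
    fix \<omega>
    have split: "(\<forall>u\<in>{t..T}. X u \<omega> < 0) \<longleftrightarrow> (\<forall>u\<in>{t..?c}. X u \<omega> < 0) \<and> (\<forall>u\<in>{?c..T}. X u \<omega> < 0)"
    proof -
      have "{t..T} = {t..?c} \<union> {?c..T}" using d tT by auto
      thus ?thesis by (simp only: ball_Un)
    qed
    show "(indicator ?E \<omega> * indicator {\<omega> \<in> space M. \<forall>u\<in>{?c..T}. X u \<omega> - X ?c \<omega> < - X ?c \<omega>} \<omega> :: real) =
        indicator ?A \<omega> * indicator {\<omega> \<in> space M. \<forall>u\<in>{t..T}. X u \<omega> - X t \<omega> < - X t \<omega>} \<omega>"
      using split unfolding event_set_eq[OF d] t_def[symmetric] by (auto simp: indicator_def)
  qed
  also have "\<dots> = (\<integral>\<omega>. indicator ?A \<omega> * psi (- X t \<omega> / sqrt (T - t)) \<partial>M)"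
    using t0 d tT AF XF by (intro reflection_integral) (auto simp: indicator_def)
  \<comment> \<open>Here \<open>?c - t\<close> is \<open>d\<close>. Splitting off this factor leaves
    a ratio known at \<open>t\<close>; the factor itself is then read backwards as negativity on the
    window of length \<open>d\<close>, which restores the event \<open>?E\<close>.\<close>
  also have "\<dots> = (\<integral>\<omega>. (indicator ?A \<omega> * ?R \<omega>) * psi (- X t \<omega> / sqrt (?c - t)) \<partial>M)"
  proof (intro Bochner_Integration.integral_cong refl)
    fix \<omega>
    have "psi (- X t \<omega> / sqrt d) \<noteq> 0" if "\<omega> \<in> ?A"
      using psi_pos[of "- X t \<omega> / sqrt d"] negA[OF that] d by (simp add: divide_neg_pos)
    thus "indicator ?A \<omega> * psi (- X t \<omega> / sqrt (T - t)) = (indicator ?A \<omega> * ?R \<omega>) * psi (- X t \<omega> / sqrt (?c - t))"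
      by (auto simp: indicator_def)
  qed
  also have "\<dots> = (\<integral>\<omega>. (indicator ?A \<omega> * ?R \<omega>) * indicator {\<omega> \<in> space M. \<forall>u\<in>{t..?c}. X u \<omega> - X t \<omega> < - X t \<omega>} \<omega> \<partial>M)"
  proof (rule reflection_integral[symmetric])
    show "(\<lambda>\<omega>. indicator ?A \<omega> * ?R \<omega>) \<in> borel_measurable (F t)" using AF Rm by measurable
    show "\<bar>indicator ?A \<omega> * ?R \<omega>\<bar> \<le> 1" for \<omega> using R01[of \<omega>] by (auto simp: indicator_def)
  qed (use t0 d tT XF in auto)
  also have "\<dots> = (\<integral>\<omega>. indicator ?E \<omega> * ?R \<omega> \<partial>M)"
    unfolding event_set_eq[OF d] t_def[symmetric] by (intro Bochner_Integration.integral_cong refl) (auto simp: indicator_def)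
  finally have eq: "(\<integral>\<omega>. indicator ?E \<omega> * indicator (space M - ?L) \<omega> \<partial>M) = (\<integral>\<omega>. indicator ?E \<omega> * ?R \<omega> \<partial>M)" .
  have L': "space M - ?L \<in> events" using Lev by (rule sets.compl_sets)
  have int: "integrable M (indicator ?E :: 'a \<Rightarrow> real)"
    using Ev(1) by (intro integrable_real_indicator) (simp_all add: less_top[symmetric])
  have "integrable M (\<lambda>\<omega>. ?R \<omega> * indicator ?E \<omega>)"
  proof (intro integrable_real_mult_indicator integrable_const_bound[where B=1] AE_I2)
    show "norm (?R \<omega>) \<le> 1" for \<omega> using R01[of \<omega>] by (simp only: real_norm_def abs_of_nonneg)
  qed (use Ev in auto)
  hence int2: "integrable M (\<lambda>\<omega>. indicator ?E \<omega> * ?R \<omega>)" by (simp add: mult.commute)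
  have "integrable M (indicator (?E \<inter> (space M - ?L)) :: 'a \<Rightarrow> real)"
    using Ev(1) L' by (intro integrable_real_indicator) (simp_all add: less_top[symmetric])
  moreover have "(indicator (?E \<inter> (space M - ?L)) :: 'a \<Rightarrow> real) = (\<lambda>\<omega>. indicator ?E \<omega> * indicator (space M - ?L) \<omega>)"
    by (rule ext) (rule indicator_inter_arith)
  ultimately have int3: "integrable M (\<lambda>\<omega>. indicator ?E \<omega> * indicator (space M - ?L) \<omega> :: real)"
    by simp
  have "integrable M (\<lambda>\<omega>. indicator ?E \<omega> - indicator ?E \<omega> * ?R \<omega>)"
    using int int2 by (rule Bochner_Integration.integrable_diff)
  thus "integrable M (\<lambda>\<omega>. indicator ?E \<omega> * (1 - ?R \<omega>))" by (simp add: right_diff_distrib)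
  have "integrable M (\<lambda>\<omega>. indicator ?E \<omega> - indicator ?E \<omega> * indicator (space M - ?L) \<omega> :: real)"
    using int int3 by (rule Bochner_Integration.integrable_diff)
  also have "?this \<longleftrightarrow> integrable M (\<lambda>\<omega>. indicator ?E \<omega> * indicator ?L \<omega> :: real)"
    by (intro Bochner_Integration.integrable_cong refl) (auto simp: indicator_def)
  finally show "integrable M (\<lambda>\<omega>. indicator ?E \<omega> * indicator ?L \<omega> :: real)" .
  have "(\<integral>\<omega>. indicator ?E \<omega> * indicator ?L \<omega> \<partial>M) = (\<integral>\<omega>. indicator ?E \<omega> - indicator ?E \<omega> * indicator (space M - ?L) \<omega> \<partial>M :: real)"
    by (intro Bochner_Integration.integral_cong) (auto simp: indicator_def)
  also have "\<dots> = (\<integral>\<omega>. indicator ?E \<omega> \<partial>M) - (\<integral>\<omega>. indicator ?E \<omega> * ?R \<omega> \<partial>M)"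
    using Bochner_Integration.integral_diff[OF int int3] eq by simp
  also have "\<dots> = (\<integral>\<omega>. indicator ?E \<omega> * (1 - ?R \<omega>) \<partial>M)"
    using Bochner_Integration.integral_diff[OF int int2] by (simp add: right_diff_distrib)
  finally show "(\<integral>\<omega>. indicator ?E \<omega> * indicator ?L \<omega> \<partial>M) = (\<integral>\<omega>. indicator ?E \<omega> * (1 - ?R \<omega>) \<partial>M)" .
qed

end

section \<open>Limits as the mesh shrinks\<close>

lemma psi_ratio_tendsto:
  assumes cont: "continuous_on {0..T} x" and d: "0 < d" and a: "first_run T d x a" "a + d < T"
  shows "((\<lambda>s. psi (- x s / sqrt (T - s)) / psi (- x s / sqrt d)) \<longlongrightarrow> sqrt d / sqrt (T - a)) (at_right a)"
proof -
  have R: "0 \<le> a" "x a = 0" "\<And>s. s \<in> {a<..a + d} \<Longrightarrow> x s < 0" "a < T"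
    using a d unfolding first_run_def neg_runs_def by auto
  have ev: "\<forall>\<^sub>F s in at_right a. s \<in> {a<..<a + d}" using d by (intro eventually_at_rightI) auto
  have xs: "(x \<longlongrightarrow> 0) (at_right a)" using shifted_path_at_right[OF cont R(1), of 0] R by simp
  have lim: "((\<lambda>s. psi (- x s / sqrt (w s)) / (- x s / sqrt (w s))) \<longlongrightarrow> 2 / sqrt (2 * pi)) (at_right a)"
    if w: "(w \<longlongrightarrow> w0) (at_right a)" "w0 > 0" for w w0
  proof (rule filterlim_compose[OF psi_div_tendsto])
    have "((\<lambda>s. - x s / sqrt (w s)) \<longlongrightarrow> - 0 / sqrt w0) (at_right a)"
      using w by (intro tendsto_intros xs) auto
    moreover have "\<forall>\<^sub>F s in at_right a. - x s / sqrt (w s) > 0"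
      using ev order_tendstoD(1)[OF w]
      by eventually_elim (use R(3) in \<open>auto simp: divide_neg_pos\<close>)
    ultimately show "filterlim (\<lambda>s. - x s / sqrt (w s)) (at_right 0) (at_right a)"
      unfolding filterlim_at by (auto elim: eventually_mono)
  qed
  have wT: "((\<lambda>s. T - s) \<longlongrightarrow> T - a) (at_right a)" by (intro tendsto_intros)
  \<comment> \<open>Each \<open>psi\<close> is divided by its own argument. Both quotients tend to
    the same constant, and of the two arguments only the ratio of the square roots survives.\<close>
  have "((\<lambda>s. (psi (- x s / sqrt (T - s)) / (- x s / sqrt (T - s))) / (psi (- x s / sqrt d) / (- x s / sqrt d))
      * (sqrt d / sqrt (T - s))) \<longlongrightarrow> (2 / sqrt (2 * pi)) / (2 / sqrt (2 * pi)) * (sqrt d / sqrt (T - a))) (at_right a)"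
    using R by (intro tendsto_mult tendsto_divide lim[OF wT] lim[of "\<lambda>_. d" d] tendsto_real_sqrt wT) (auto simp: d)
  moreover have "\<forall>\<^sub>F s in at_right a. (psi (- x s / sqrt (T - s)) / (- x s / sqrt (T - s))) / (psi (- x s / sqrt d) / (- x s / sqrt d))
      * (sqrt d / sqrt (T - s)) = psi (- x s / sqrt (T - s)) / psi (- x s / sqrt d)"
    using ev
  proof eventually_elim
    case (elim s)
    hence "x s < 0" "s < T" using R a by auto
    thus ?case using d by (simp add: field_simps)
  qed
  ultimately have "((\<lambda>s. psi (- x s / sqrt (T - s)) / psi (- x s / sqrt d)) \<longlongrightarrow>
      (2 / sqrt (2 * pi)) / (2 / sqrt (2 * pi)) * (sqrt d / sqrt (T - a))) (at_right a)"
    by (rule Lim_transform_eventually)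
  thus ?thesis by simp
qed

text \<open>Isolates the possible discontinuity of the crossing indicator: an arbitrarily small
  lowering of the level makes a mere contact disappear.\<close>

definition touches :: "real \<Rightarrow> real \<Rightarrow> (real \<Rightarrow> real) \<Rightarrow> real \<Rightarrow> bool" where
  "touches T d x a \<longleftrightarrow> (\<exists>u\<in>{a + d..T}. x u = 2 * x (a + d)) \<and> (\<forall>u\<in>{a + d..T}. x u \<ge> 2 * x (a + d))"

text \<open>Without a touch, either some value lies strictly below the level or the minimum lies
  strictly above it. Both situations persist when \<open>s\<close> is close to
  \<open>a\<close>.\<close>

lemma crossing_indicator_tendsto:
  assumes cont: "continuous_on {0..T} x" and d: "0 < d" and a: "first_run T d x a" "a + d < T"
    and nt: "\<not> touches T d x a"
  shows "((\<lambda>s. if \<exists>u\<in>{s + d..T}. x u \<le> 2 * x (s + d) then 1 else 0 :: real) \<longlongrightarrow>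
    (if \<exists>u\<in>{a + d..T}. x u \<le> 2 * x (a + d) then 1 else 0)) (at_right a)"
proof (rule tendsto_eventually)
  have R: "0 \<le> a" "x (a + d) < 0" using a d unfolding first_run_def neg_runs_def by auto
  have lim: "((\<lambda>s. 2 * x (s + d)) \<longlongrightarrow> 2 * x (a + d)) (at_right a)"
    using shifted_path_at_right[OF cont R(1) _ a(2)] d by (intro tendsto_intros) auto
  show "\<forall>\<^sub>F s in at_right a. (if \<exists>u\<in>{s + d..T}. x u \<le> 2 * x (s + d) then 1 else 0 :: real) =
    (if \<exists>u\<in>{a + d..T}. x u \<le> 2 * x (a + d) then 1 else 0)"
  proof (cases "\<exists>u\<in>{a + d..T}. x u \<le> 2 * x (a + d)")
    case True
    with nt obtain u where u: "u \<in> {a + d..T}" "x u < 2 * x (a + d)"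
      unfolding touches_def by (meson antisym not_le)
    with R have "u \<noteq> a + d" by auto
    with u have "\<forall>\<^sub>F s in at_right a. s \<in> {a<..<u - d}" by (intro eventually_at_rightI) auto
    moreover have "\<forall>\<^sub>F s in at_right a. x u < 2 * x (s + d)" using order_tendstoD(1)[OF lim u(2)] .
    ultimately show ?thesis
    proof eventually_elim
      case (elim s)
      hence "\<exists>u\<in>{s + d..T}. x u \<le> 2 * x (s + d)" using u by (intro bexI[of _ u]) auto
      thus ?case using True by simp
    qed
  next
    case False
    have "continuous_on {a + d..T} x" using cont R d by (auto intro: continuous_on_subset)
    then obtain w where w: "w \<in> {a + d..T}" "\<And>u. u \<in> {a + d..T} \<Longrightarrow> x w \<le> x u"
      using continuous_attains_inf[of "{a + d..T}" x] a by force
    have "2 * x (a + d) < x w" using False w(1) by (meson not_le)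
    from order_tendstoD(2)[OF lim this] have "\<forall>\<^sub>F s in at_right a. 2 * x (s + d) < x w" .
    moreover have "\<forall>\<^sub>F s in at_right a. s \<in> {a<..<a + 1}" by (intro eventually_at_rightI) auto
    ultimately show ?thesis
    proof eventually_elim
      case (elim s)
      have "\<not> x u \<le> 2 * x (s + d)" if "u \<in> {s + d..T}" for u
        using w(2)[of u] elim that by auto
      hence "\<not> (\<exists>u\<in>{s + d..T}. x u \<le> 2 * x (s + d))" by blast
      thus ?case using False by simp
    qed
  qed
qed

context cts_bm begin

lemma grid_sum_indicator:
  assumes "\<omega> \<in> space M"
  shows "grid_sum T d (\<lambda>u. X u \<omega>) q n f =
    (\<Sum>k | k \<le> n \<and> grid T n (Suc k) + d < q. indicator (event_set d n k) \<omega> * f (grid T n (Suc k)))"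
proof -
  have "grid_sum T d (\<lambda>u. X u \<omega>) q n f = (\<Sum>k\<in>{..n}. if grid T n (Suc k) + d < q
    then indicator (event_set d n k) \<omega> * f (grid T n (Suc k)) else 0)"
    unfolding grid_sum_def using assms by (intro sum.cong) (auto simp: event_set_def indicator_def)
  also have "\<dots> = (\<Sum>k\<in>{k\<in>{..n}. grid T n (Suc k) + d < q}. indicator (event_set d n k) \<omega> * f (grid T n (Suc k)))"
    by (rule sum.inter_filter[symmetric]) simp
  finally show ?thesis by simp
qed

text \<open>A touch makes the minimum over [q, T] equal to twice the value at \<open>a + d\<close>,
  for any rational \<open>q\<close> between \<open>a + d\<close> and the time of contact. That level
  is known at \<open>q\<close>, and the reflection formula shows that the minimum hits a level known
  at \<open>q\<close> with probability 0.\<close>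

lemma AE_no_touch:
  assumes T: "0 < T" and d: "0 < d"
  shows "AE \<omega> in M. \<forall>a. first_run T d (\<lambda>u. X u \<omega>) a \<and> a + d < T \<longrightarrow> \<not> touches T d (\<lambda>u. X u \<omega>) a"
proof -
  interpret U: cts_bm M F T "\<lambda>t \<omega>. - X t \<omega>" by (rule uminus_cts_bm)
  define V where "V q \<omega> = (if \<exists>a. first_run T d (\<lambda>u. X u \<omega>) a \<and> a + d < q
    then X ((THE a. first_run T d (\<lambda>u. X u \<omega>) a) + d) \<omega> else 0)" for q \<omega>
  have V_eq: "V q \<omega> = X (a + d) \<omega>" if "first_run T d (\<lambda>u. X u \<omega>) a" "a + d < q" for q \<omega> a
  proof -
    have "(THE a. first_run T d (\<lambda>u. X u \<omega>) a) = a"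
      using that(1) first_run_unique[OF _ that(1)] by (rule the_equality)
    thus ?thesis using that unfolding V_def by metis
  qed
  define W where "W q \<omega> = X q \<omega> - 2 * V q \<omega>" for q \<omega>
  \<comment> \<open>Rearranged: on [q, T] the path stays above the level 2 V - c. Belonging to this
    set for every positive margin but not for margin 0 means that the minimum equals the
    level.\<close>
  define B where "B q c = {\<omega> \<in> space M. \<forall>u\<in>{q..T}. - X u \<omega> - - X q \<omega> < W q \<omega> + c}" for q c
  have null: "AE \<omega> in M. \<not> (\<forall>m. \<omega> \<in> B q (1 / real (Suc m)) - B q 0)" if q: "0 < q" "q < T" for q
  proof -
    \<comment> \<open>The value at the end of the first run is a limit of grid sums with deadline
      \<open>q\<close>, each of which is known at time \<open>q\<close>.\<close>
    have VF: "V q \<in> borel_measurable (F q)"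
    proof (rule borel_measurable_LIMSEQ_real)
      fix \<omega> assume "\<omega> \<in> space (F q)"
      hence \<omega>: "\<omega> \<in> space M" using q by (simp add: space_F)
      show "(\<lambda>n. \<Sum>k | k \<le> n \<and> grid T n (Suc k) + d < q. indicator (event_set d n k) \<omega> * X (grid T n (Suc k) + d) \<omega>) \<longlonglongrightarrow> V q \<omega>"
        unfolding grid_sum_indicator[OF \<omega>, of d q _ "\<lambda>s. X (s + d) \<omega>", symmetric] V_def
      proof (rule grid_sum_tendsto[OF cont[OF \<omega>] start[OF \<omega>] T d])
        fix a assume a: "first_run T d (\<lambda>u. X u \<omega>) a" "a + d < q"
        have "(THE a. first_run T d (\<lambda>u. X u \<omega>) a) = a"
          using a(1) first_run_unique[OF _ a(1)] by (rule the_equality)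
        thus "((\<lambda>s. X (s + d) \<omega>) \<longlongrightarrow> X ((THE a. first_run T d (\<lambda>u. X u \<omega>) a) + d) \<omega>) (at_right a)"
          using shifted_path_at_right[OF cont[OF \<omega>], of a d] a q d unfolding first_run_def neg_runs_def by auto
      qed (use q in auto)
    next
      fix n
      show "(\<lambda>\<omega>. \<Sum>k | k \<le> n \<and> grid T n (Suc k) + d < q. indicator (event_set d n k) \<omega> * X (grid T n (Suc k) + d) \<omega>) \<in> borel_measurable (F q)"
      proof (intro borel_measurable_sum borel_measurable_times borel_measurable_indicator)
        fix k assume "k \<in> {k. k \<le> n \<and> grid T n (Suc k) + d < q}"
        thus "event_set d n k \<in> sets (F q)" "X (grid T n (Suc k) + d) \<in> borel_measurable (F q)"
          using T d q grid_nonneg[of T n "Suc k"] by (auto intro!: sets_event_set_F X_measurable_F)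
      qed
    qed
    have Xq: "X q \<in> borel_measurable (F q)" using q by (intro adapted) auto
    have W[measurable]: "W q \<in> borel_measurable (F q)" unfolding W_def using VF Xq by measurable
    have qT: "q \<in> {0..T}" using q by auto
    have WM[measurable]: "W q \<in> borel_measurable M" by (rule measurable_F[OF qT W])
    have XqM: "X q \<in> borel_measurable M" by (rule X_measurable[OF qT])
    have Bev: "B q c \<in> events" for c
    proof -
      have "B q c = {\<omega> \<in> space M. \<forall>u\<in>{q..T}. - X u \<omega> < W q \<omega> + c - X q \<omega>}" unfolding B_def by (auto simp: algebra_simps)
      also have "\<dots> \<in> events" using q XqM by (intro U.sets_all_less) (auto intro: X_measurable)
      finally show ?thesis .
    qed
    have Bp: "prob (B q c) = (\<integral>\<omega>. psi ((W q \<omega> + c) / sqrt (T - q)) \<partial>M)" for c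
    proof -
      have "(\<integral>\<omega>. 1 * indicator (B q c) \<omega> \<partial>M) = (\<integral>\<omega>. 1 * psi ((W q \<omega> + c) / sqrt (T - q)) \<partial>M)"
        unfolding B_def using q by (intro U.reflection_integral) auto
      thus ?thesis using Bev by simp
    qed
    have ipsi: "integrable M (\<lambda>\<omega>. psi ((W q \<omega> + c) / sqrt (T - q)))" for c
      by (rule integrable_const_bound[where B=1]) auto
    define D where "D = (\<Inter>m. B q (1 / real (Suc m)) - B q 0)"
    have Dev: "D \<in> events" unfolding D_def using Bev by auto
    have "prob D \<le> 1 / real (Suc m) / sqrt (T - q)" for m
    proof -
      have B0: "B q 0 \<subseteq> B q (1 / real (Suc m))"
      proof
        fix \<omega> assume "\<omega> \<in> B q 0"
        hence "\<omega> \<in> space M" and lt: "\<And>u. u \<in> {q..T} \<Longrightarrow> - X u \<omega> - - X q \<omega> < W q \<omega>" unfolding B_def by auto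
        moreover have "1 / real (Suc m) > 0" by simp
        ultimately show "\<omega> \<in> B q (1 / real (Suc m))" unfolding B_def by (auto dest!: lt intro: less_trans simp del: of_nat_Suc)
      qed
      have "prob D \<le> prob (B q (1 / real (Suc m)) - B q 0)"
        using Bev by (intro finite_measure_mono) (auto simp: D_def)
      also have "\<dots> = prob (B q (1 / real (Suc m))) - prob (B q 0)"
        using Bev B0 by (intro finite_measure_Diff) auto
      also have "\<dots> = (\<integral>\<omega>. psi ((W q \<omega> + 1 / real (Suc m)) / sqrt (T - q)) - psi ((W q \<omega> + 0) / sqrt (T - q)) \<partial>M)"
        unfolding Bp by (rule Bochner_Integration.integral_diff[OF ipsi ipsi, symmetric])
      also have "\<dots> \<le> (\<integral>\<omega>. 1 / real (Suc m) / sqrt (T - q) \<partial>M)"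
      proof (intro integral_mono)
        fix \<omega>
        show "psi ((W q \<omega> + 1 / real (Suc m)) / sqrt (T - q)) - psi ((W q \<omega> + 0) / sqrt (T - q)) \<le> 1 / real (Suc m) / sqrt (T - q)"
          using psi_add_le[of "1 / real (Suc m) / sqrt (T - q)" "W q \<omega> / sqrt (T - q)"] q
          by (simp add: add_divide_distrib del: of_nat_Suc)
      qed (rule Bochner_Integration.integrable_diff[OF ipsi ipsi], simp)
      also have "\<dots> = 1 / real (Suc m) / sqrt (T - q)" by (simp add: prob_space)
      finally show ?thesis .
    qed
    moreover have "(\<lambda>m. 1 / real (Suc m) / sqrt (T - q)) \<longlonglongrightarrow> 0 / sqrt (T - q)"
      using q by (intro tendsto_intros LIMSEQ_Suc[OF lim_1_over_n]) auto
    ultimately have "prob D \<le> 0" by (intro LIMSEQ_le_const[where X="\<lambda>m. 1 / real (Suc m) / sqrt (T - q)" and a="prob D"]) auto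
    hence "prob D = 0" using measure_nonneg[of M D] by linarith
    hence "AE \<omega> in M. \<omega> \<notin> D" using Dev prob_eq_0 by blast
    thus ?thesis unfolding D_def by simp
  qed
  have "AE \<omega> in M. \<forall>q\<in>{q\<in>\<rat>. 0 < q \<and> q < T}. \<not> (\<forall>m. \<omega> \<in> B q (1 / real (Suc m)) - B q 0)"
    using null by (subst AE_ball_countable) (auto intro: countable_subset[OF _ countable_rat])
  with AE_space show ?thesis
  proof eventually_elim
    case (elim \<omega>)
    show ?case
    proof (intro allI impI notI)
      fix a assume a: "first_run T d (\<lambda>u. X u \<omega>) a \<and> a + d < T" and t: "touches T d (\<lambda>u. X u \<omega>) a"
      from t obtain y where y: "y \<in> {a + d..T}" "X y \<omega> = 2 * X (a + d) \<omega>" and ge: "\<And>u. u \<in> {a + d..T} \<Longrightarrow> X u \<omega> \<ge> 2 * X (a + d) \<omega>"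
        unfolding touches_def by blast
      have R: "0 \<le> a" "X (a + d) \<omega> < 0" using a d unfolding first_run_def neg_runs_def by auto
      have "a + d < y" using y R by (cases "y = a + d") auto
      \<comment> \<open>Strictly between the two times: after \<open>a + d\<close>, so that the
        level is known, and before the contact, so that the contact lies in [q, T].\<close>
      then obtain q where q: "q \<in> \<rat>" "a + d < q" "q < y" using Rats_dense_in_real by blast
      have V: "V q \<omega> = X (a + d) \<omega>" using V_eq a q by blast
      have "\<omega> \<notin> B q 0"
      proof
        assume "\<omega> \<in> B q 0"
        moreover have "y \<in> {q..T}" using y q by auto
        ultimately have "- X y \<omega> - - X q \<omega> < W q \<omega> + 0" unfolding B_def by blast
        thus False unfolding W_def V using y by simp
      qed
      moreover have "\<omega> \<in> B q (1 / real (Suc m))" for m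
      proof -
        have pos: "1 / real (Suc m) > 0" by simp
        have "- X u \<omega> - - X q \<omega> < W q \<omega> + 1 / real (Suc m)" if "u \<in> {q..T}" for u
        proof -
          have "X u \<omega> \<ge> 2 * X (a + d) \<omega>" using that q by (intro ge) auto
          thus ?thesis unfolding W_def V using pos by linarith
        qed
        thus ?thesis unfolding B_def using elim by auto
      qed
      moreover have "q \<in> {q\<in>\<rat>. 0 < q \<and> q < T}" using q y R d by auto
      ultimately show False using elim(2) by blast
    qed
  qed
qed

lemma grid_sum_identity:
  fixes n :: nat
  assumes T: "0 < T" and d: "0 < d"
  defines "f \<equiv> \<lambda>\<omega>. grid_sum T d (\<lambda>u. X u \<omega>) T n (\<lambda>s. if \<exists>u\<in>{s + d..T}. X u \<omega> \<le> 2 * X (s + d) \<omega> then 1 else 0)"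
    and "g \<equiv> \<lambda>\<omega>. grid_sum T d (\<lambda>u. X u \<omega>) T n (\<lambda>s. 1 - psi (- X s \<omega> / sqrt (T - s)) / psi (- X s \<omega> / sqrt d))"
  shows "integrable M f" and "integrable M g" and "(\<integral>\<omega>. f \<omega> \<partial>M) = (\<integral>\<omega>. g \<omega> \<partial>M)"
proof -
  define K where "K = {k. k \<le> n \<and> grid T n (Suc k) + d < T}"
  have K: "grid T n (Suc k) + d < T" if "k \<in> K" for k using that by (simp add: K_def)
  define f' where "f' \<omega> = (\<Sum>k\<in>K. indicator (event_set d n k) \<omega> * indicator {\<omega> \<in> space M. \<exists>u\<in>{grid T n (Suc k) + d..T}. X u \<omega> \<le> 2 * X (grid T n (Suc k) + d) \<omega>} \<omega> :: real)" for \<omega>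
  define g' where "g' \<omega> = (\<Sum>k\<in>K. indicator (event_set d n k) \<omega> * (1 - psi (- X (grid T n (Suc k)) \<omega> / sqrt (T - grid T n (Suc k))) / psi (- X (grid T n (Suc k)) \<omega> / sqrt d)))" for \<omega>
  have ff: "f \<omega> = f' \<omega>" if "\<omega> \<in> space M" for \<omega>
    unfolding f_def f'_def grid_sum_indicator[OF that] K_def[symmetric] using that by (intro sum.cong) (auto simp: indicator_def)
  have gg: "g \<omega> = g' \<omega>" if "\<omega> \<in> space M" for \<omega>
    unfolding g_def g'_def grid_sum_indicator[OF that] K_def[symmetric] ..
  have "integrable M f'"
    unfolding f'_def using grid_event_identity(2)[OF T d K] by (intro Bochner_Integration.integrable_sum)
  thus "integrable M f" using ff by (subst Bochner_Integration.integrable_cong[OF refl]) auto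
  have "integrable M g'"
    unfolding g'_def using grid_event_identity(3)[OF T d K] by (intro Bochner_Integration.integrable_sum)
  thus "integrable M g" using gg by (subst Bochner_Integration.integrable_cong[OF refl]) auto
  have "(\<integral>\<omega>. f' \<omega> \<partial>M) = (\<integral>\<omega>. g' \<omega> \<partial>M)"
    unfolding f'_def g'_def
    using grid_event_identity(1)[OF T d K] grid_event_identity(2)[OF T d K] grid_event_identity(3)[OF T d K]
    by (subst (1 2) Bochner_Integration.integral_sum) (auto intro!: sum.cong)
  thus "(\<integral>\<omega>. f \<omega> \<partial>M) = (\<integral>\<omega>. g \<omega> \<partial>M)"
    using ff gg by (simp cong: Bochner_Integration.integral_cong)
qed

text \<open>The limit of \<open>grid_sum_identity\<close> by dominated convergence. \<open>K\<close>
  is given only pathwise; its measurability is obtained here because the run indicator minus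
  \<open>K\<close> is a limit of grid sums.\<close>

lemma prob_survives:
  assumes T: "0 < T" and d: "0 < d"
    and K: "\<And>\<omega> a. \<omega> \<in> space M \<Longrightarrow> first_run T d (\<lambda>u. X u \<omega>) a \<Longrightarrow> K \<omega> = sqrt d / sqrt (T - a)"
    and K0: "\<And>\<omega>. \<omega> \<in> space M \<Longrightarrow> neg_runs T d (\<lambda>u. X u \<omega>) = {} \<Longrightarrow> K \<omega> = 0"
  shows "prob {\<omega> \<in> space M. survives T d (\<lambda>u. X u \<omega>)} =
    1 - (prob {\<omega> \<in> space M. neg_runs T d (\<lambda>u. X u \<omega>) \<noteq> {}} - (\<integral>\<omega>. K \<omega> \<partial>M))"
    and "K \<in> borel_measurable M"
proof -
  let ?S = "{\<omega> \<in> space M. survives T d (\<lambda>u. X u \<omega>)}"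
  let ?N = "{\<omega> \<in> space M. neg_runs T d (\<lambda>u. X u \<omega>) \<noteq> {}}"
  have S[measurable]: "?S \<in> events" by (rule sets_survives[OF T d]) (auto intro: X_measurable)
  have N[measurable]: "?N \<in> events" by (rule sets_run_until[OF T d])
  define f where "f n \<omega> = grid_sum T d (\<lambda>u. X u \<omega>) T n (\<lambda>s. if \<exists>u\<in>{s + d..T}. X u \<omega> \<le> 2 * X (s + d) \<omega> then 1 else 0)" for n \<omega>
  define g where "g n \<omega> = grid_sum T d (\<lambda>u. X u \<omega>) T n (\<lambda>s. 1 - psi (- X s \<omega> / sqrt (T - s)) / psi (- X s \<omega> / sqrt d))" for n \<omega>
  have fg: "integrable M (f n)" "integrable M (g n)" "(\<integral>\<omega>. f n \<omega> \<partial>M) = (\<integral>\<omega>. g n \<omega> \<partial>M)" for n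
    using grid_sum_identity[OF T d, of n] unfolding f_def g_def by auto
  have f1: "\<bar>f n \<omega>\<bar> \<le> 1" if "\<omega> \<in> space M" for n \<omega>
    unfolding f_def by (rule grid_sum_bounded[OF cont[OF that] start[OF that] T d]) auto
  have g1: "\<bar>g n \<omega>\<bar> \<le> 1" if "\<omega> \<in> space M" for n \<omega>
    unfolding g_def
  proof (rule grid_sum_bounded[OF cont[OF that] start[OF that] T d order_refl])
    fix s assume "s + d < T"
    thus "\<bar>1 - psi (- X s \<omega> / sqrt (T - s)) / psi (- X s \<omega> / sqrt d)\<bar> \<le> 1"
      using psi_ratio_bounds[of d "T - s" "- X s \<omega>"] d by linarith
  qed
  have flim: "AE \<omega> in M. (\<lambda>n. f n \<omega>) \<longlonglongrightarrow> indicator (space M - ?S) \<omega>"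
    using AE_space AE_no_touch[OF T d]
  proof eventually_elim
    case (elim \<omega>)
    let ?x = "\<lambda>u. X u \<omega>"
    \<comment> \<open>Formulated without a fixed \<open>a\<close>, since the limit lemma asks for
      one limit value; by uniqueness of the first run it is the crossing indicator at that
      run.\<close>
    define l :: real where "l = (if \<exists>a. first_run T d ?x a \<and> (\<exists>u\<in>{a + d..T}. X u \<omega> \<le> 2 * X (a + d) \<omega>) then 1 else 0)"
    have "(\<lambda>n. f n \<omega>) \<longlonglongrightarrow> (if \<exists>a. first_run T d ?x a \<and> a + d < T then l else 0)"
      unfolding f_def
    proof (rule grid_sum_tendsto[OF cont[OF elim(1)] start[OF elim(1)] T d order_refl])
      fix a assume a: "first_run T d ?x a" "a + d < T"
      have "(\<exists>a. first_run T d ?x a \<and> (\<exists>u\<in>{a + d..T}. X u \<omega> \<le> 2 * X (a + d) \<omega>)) \<longleftrightarrow>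
        (\<exists>u\<in>{a + d..T}. X u \<omega> \<le> 2 * X (a + d) \<omega>)"
        using a(1) first_run_unique[OF a(1)] by metis
      hence "l = (if \<exists>u\<in>{a + d..T}. X u \<omega> \<le> 2 * X (a + d) \<omega> then 1 else 0)"
        unfolding l_def by (simp only:)
      thus "((\<lambda>s. if \<exists>u\<in>{s + d..T}. X u \<omega> \<le> 2 * X (s + d) \<omega> then 1 else 0) \<longlongrightarrow> l) (at_right a)"
        using crossing_indicator_tendsto[OF cont[OF elim(1)] d a] elim(2) a by simp
    qed
    moreover have "(if \<exists>a. first_run T d ?x a \<and> a + d < T then l else 0) = indicator (space M - ?S) \<omega>"
    proof -
      have "\<not> survives T d ?x \<longleftrightarrow> (\<exists>a. first_run T d ?x a \<and> a + d < T) \<and>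
          (\<exists>a. first_run T d ?x a \<and> (\<exists>u\<in>{a + d..T}. X u \<omega> \<le> 2 * X (a + d) \<omega>))"
        unfolding not_survives_iff[OF d] using first_run_unique[of T d ?x] by metis
      thus ?thesis using elim(1) unfolding l_def by (cases "survives T d ?x") auto
    qed
    ultimately show ?case by simp
  qed
  have glim: "(\<lambda>n. g n \<omega>) \<longlonglongrightarrow> indicator ?N \<omega> - K \<omega>" if \<omega>: "\<omega> \<in> space M" for \<omega>
  proof -
    let ?x = "\<lambda>u. X u \<omega>"
    have "(\<lambda>n. g n \<omega>) \<longlonglongrightarrow> (if \<exists>a. first_run T d ?x a \<and> a + d < T then 1 - K \<omega> else 0)"
      unfolding g_def
    proof (rule grid_sum_tendsto[OF cont[OF \<omega>] start[OF \<omega>] T d order_refl])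
      fix a assume a: "first_run T d ?x a" "a + d < T"
      show "((\<lambda>s. 1 - psi (- X s \<omega> / sqrt (T - s)) / psi (- X s \<omega> / sqrt d)) \<longlongrightarrow> 1 - K \<omega>) (at_right a)"
        using psi_ratio_tendsto[OF cont[OF \<omega>] d a] K[OF \<omega> a(1)] by (intro tendsto_intros) auto
    qed
    moreover have "(if \<exists>a. first_run T d ?x a \<and> a + d < T then 1 - K \<omega> else 0) = indicator ?N \<omega> - K \<omega>"
    proof (cases "neg_runs T d ?x = {}")
      case True
      thus ?thesis using K0[OF \<omega>] by (auto simp: first_run_def)
    next
      case False
      then obtain a where a: "first_run T d ?x a" using first_run_ex[OF d] by blast
      hence "a + d \<le> T" unfolding first_run_def neg_runs_def by auto
      show ?thesis
      proof (cases "a + d < T")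
        case True thus ?thesis using a False \<omega> by auto
      next
        case False
        \<comment> \<open>A run that ends at \<open>T\<close> is never detected, so the limit is 0.
          Correspondingly the weight is 1 and the indicator minus \<open>K\<close> vanishes.\<close>
        hence "T - a = d" using \<open>a + d \<le> T\<close> by simp
        hence "K \<omega> = 1" using K[OF \<omega> a] d by simp
        moreover have "\<not> (\<exists>a. first_run T d ?x a \<and> a + d < T)" using False first_run_unique[OF a] by blast
        ultimately show ?thesis using \<open>neg_runs T d ?x \<noteq> {}\<close> \<omega> by simp
      qed
    qed
    ultimately show ?thesis by simp
  qed
  define h where "h \<omega> = indicator ?N \<omega> - K \<omega>" for \<omega>
  have hm[measurable]: "h \<in> borel_measurable M"
    unfolding h_def by (rule borel_measurable_LIMSEQ_real[OF glim borel_measurable_integrable[OF fg(2)]])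
  have "(\<lambda>n. \<integral>\<omega>. f n \<omega> \<partial>M) \<longlonglongrightarrow> (\<integral>\<omega>. indicator (space M - ?S) \<omega> \<partial>M)"
  proof (rule integral_dominated_convergence[where w="\<lambda>_. 1"])
    show "AE \<omega> in M. norm (f n \<omega>) \<le> 1" for n using f1 by (intro AE_I2) simp
  qed (use fg(1) flim S in \<open>simp_all add: borel_measurable_integrable\<close>)
  moreover have "(\<lambda>n. \<integral>\<omega>. g n \<omega> \<partial>M) \<longlonglongrightarrow> (\<integral>\<omega>. h \<omega> \<partial>M)"
  proof (rule integral_dominated_convergence[where w="\<lambda>_. 1"])
    show "AE \<omega> in M. norm (g n \<omega>) \<le> 1" for n using g1 by (intro AE_I2) simp
    show "AE \<omega> in M. (\<lambda>n. g n \<omega>) \<longlonglongrightarrow> h \<omega>" using glim unfolding h_def by (intro AE_I2)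
  qed (use fg(2) hm in \<open>simp_all add: borel_measurable_integrable\<close>)
  ultimately have eq: "(\<integral>\<omega>. indicator (space M - ?S) \<omega> \<partial>M) = (\<integral>\<omega>. h \<omega> \<partial>M)"
    unfolding fg(3) by (rule LIMSEQ_unique)
  have "\<bar>h \<omega>\<bar> \<le> 1" if "\<omega> \<in> space M" for \<omega>
    using LIMSEQ_le_const2[OF tendsto_rabs[OF glim[OF that]], of 1] g1[OF that] unfolding h_def by auto
  hence hint: "integrable M h" by (intro integrable_const_bound[where B=1] AE_I2) auto
  have Nint: "integrable M (indicator ?N :: 'a \<Rightarrow> real)"
    using N by (intro integrable_real_indicator) (simp_all add: less_top[symmetric])
  have "(\<integral>\<omega>. K \<omega> \<partial>M) = (\<integral>\<omega>. indicator ?N \<omega> - h \<omega> \<partial>M)" by (simp add: h_def)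
  also have "\<dots> = prob ?N - (\<integral>\<omega>. h \<omega> \<partial>M)"
    using Bochner_Integration.integral_diff[OF Nint hint] N by simp
  also have "(\<integral>\<omega>. h \<omega> \<partial>M) = prob (space M - ?S)" using eq S by simp
  also have "\<dots> = 1 - prob ?S" by (rule prob_compl[OF S])
  finally show "prob ?S = 1 - (prob ?N - (\<integral>\<omega>. K \<omega> \<partial>M))" by simp
  have "(\<lambda>\<omega>. indicator ?N \<omega> - h \<omega>) \<in> borel_measurable M" by measurable
  thus "K \<in> borel_measurable M" by (simp add: h_def)
qed


section \<open>Independence of the initial information\<close>

definition path_gen :: "real set \<Rightarrow> 'a set set" where
  "path_gen J = (\<Union>t\<in>J. {X t -` B \<inter> space M | B. B \<in> sets borel})"

lemma path_gen_mono: "I \<subseteq> J \<Longrightarrow> path_gen I \<subseteq> path_gen J"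
  unfolding path_gen_def by blast

lemma path_gen_Pow: "path_gen J \<subseteq> Pow (space M)"
  unfolding path_gen_def by auto

lemma measurable_path_gen:
  assumes "u \<in> J" "path_gen J \<subseteq> sigma_sets (space M) P" "P \<subseteq> Pow (space M)"
  shows "X u \<in> borel_measurable (sigma (space M) P)"
proof (rule measurableI)
  fix B :: "real set" assume "B \<in> sets borel"
  hence "X u -` B \<inter> space M \<in> path_gen J" using assms(1) unfolding path_gen_def by blast
  thus "X u -` B \<inter> space (sigma (space M) P) \<in> sets (sigma (space M) P)" using assms(2,3) by auto
qed simp

lemma sigma_path_gen_subset_F:
  assumes "J \<subseteq> {0..s}" "0 \<le> s" "s \<le> T"
  shows "sigma_sets (space M) (path_gen J) \<subseteq> sets (F s)"
proof -
  have sp: "space (F s) = space M" using assms by (simp add: space_F)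
  have "path_gen J \<subseteq> sets (F s)"
    unfolding path_gen_def
  proof safe
    fix t and B :: "real set" assume "t \<in> J" "B \<in> sets borel"
    moreover from this have "X t \<in> borel_measurable (F s)" using assms by (intro X_measurable_F) auto
    ultimately show "X t -` B \<inter> space M \<in> sets (F s)" using measurable_sets[of "X t" "F s" borel B] sp by simp
  qed
  thus ?thesis using sets.sigma_sets_subset[of "path_gen J" "F s"] sp by simp
qed

text \<open>Here \<open>s\<close> is the latest time in \<open>J\<close>. The intersections of path
  events up to \<open>s\<close> with events of the next increment form a pi-system on which the
  product rule follows from \<open>increment\<close>; the sigma-algebra it generates makes X_b
  measurable as X_s plus the increment.\<close>

lemma indep_increment_step:
  assumes s: "0 \<le> s" "s < b" "b \<le> T" "s \<in> J" "J \<subseteq> {0..s}"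
    and ind: "indep_set (sets (F 0)) (sigma_sets (space M) (path_gen J))"
  shows "indep_set (sets (F 0)) (sigma_sets (space M) (path_gen (insert b J)))"
proof -
  have T0: "0 \<in> {0..T}" "s \<in> {0..T}" "b \<in> {0..T}" using s by auto
  let ?D = "sigma_sets (space M) (path_gen J)"
  define I where "I B = {\<omega> \<in> space M. X b \<omega> - X s \<omega> \<in> B}" for B
  define P where "P = {E \<inter> I B | E B. E \<in> ?D \<and> B \<in> sets borel}"
  have DF: "?D \<subseteq> sets (F s)" using s by (intro sigma_path_gen_subset_F) auto
  have [measurable]: "X b \<in> borel_measurable M" "X s \<in> borel_measurable M" using T0 by (auto intro: X_measurable)
  have Iev: "I B \<in> events" if [measurable]: "B \<in> sets borel" for B unfolding I_def by measurable
  have Dev: "?D \<subseteq> events" using DF sets_F[OF T0(2)] by blast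
  have topD: "space M \<in> ?D" by (rule sigma_sets_top)
  have topF: "space M \<in> sets (F s)" using sets.top[of "F s"] space_F[OF T0(2)] by simp
  let ?\<nu> = "\<lambda>B. measure std_normal_distribution {z. sqrt (b - s) * z \<in> B}"
  have inc: "prob (A \<inter> I B) = prob A * ?\<nu> B" if "A \<in> sets (F s)" "B \<in> sets borel" for A B
    unfolding I_def using increment[OF s(1-3) that] .
  have "indep_set (sets (F 0)) P"
  proof (rule indep_setI)
    show "sets (F 0) \<subseteq> events" using sets_F[OF T0(1)] by blast
    show "P \<subseteq> events" using Dev Iev unfolding P_def by auto
    fix A C assume A: "A \<in> sets (F 0)" and "C \<in> P"
    then obtain E B where E: "E \<in> ?D" and B: "B \<in> sets borel" and C: "C = E \<inter> I B" unfolding P_def by blast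
    have "A \<in> sets (F s)" using A mono[of 0 s] s by auto
    hence "A \<inter> E \<in> sets (F s)" using E DF by auto
    from inc[OF this B] have "prob (A \<inter> C) = prob (A \<inter> E) * ?\<nu> B" unfolding C by (simp add: Int_assoc)
    also have "prob (A \<inter> E) = prob A * prob E" by (rule indep_setD[OF ind A E])
    also have "prob A * prob E * ?\<nu> B = prob A * prob C" using inc[of E B] E DF B unfolding C by auto
    finally show "prob (A \<inter> C) = prob A * prob C" .
  qed
  hence "indep_set (sigma_sets (space M) (sets (F 0))) (sigma_sets (space M) P)"
  proof (rule indep_set_sigma_sets)
    show "Int_stable (sets (F 0))" by (auto simp: Int_stable_def)
    show "Int_stable P"
      unfolding Int_stable_def
    proof (intro ballI)
      fix C C' assume "C \<in> P" "C' \<in> P"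
      then obtain E B E' B' where *: "E \<in> ?D" "E' \<in> ?D" "B \<in> sets borel" "B' \<in> sets borel" "C = E \<inter> I B" "C' = E' \<inter> I B'"
        unfolding P_def by blast
      have "E \<inter> E' \<in> ?D" using * sets.Int[of E "sigma (space M) (path_gen J)" E'] path_gen_Pow[of J] by simp
      moreover have "C \<inter> C' = (E \<inter> E') \<inter> I (B \<inter> B')" unfolding * I_def by auto
      ultimately show "C \<inter> C' \<in> P" unfolding P_def using * by blast
    qed
  qed
  hence ind': "indep_set (sets (F 0)) (sigma_sets (space M) P)"
    using sets.sigma_sets_eq[of "F 0"] space_F[OF T0(1)] by simp
  have PPow: "P \<subseteq> Pow (space M)" using Dev Iev sets.sets_into_space unfolding P_def I_def by blast
  have D_P: "?D \<subseteq> P"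
  proof
    fix E assume E: "E \<in> ?D"
    have eq: "E \<inter> I UNIV = E" using E Dev sets.sets_into_space unfolding I_def by auto
    have "E \<inter> I UNIV \<in> P" unfolding P_def using E by (intro CollectI exI[of _ E] exI[of _ UNIV]) simp
    thus "E \<in> P" by (simp only: eq)
  qed
  hence gJ: "path_gen J \<subseteq> sigma_sets (space M) P" by blast
  let ?N = "sigma (space M) P"
  have [measurable]: "X s \<in> borel_measurable ?N" using s(4) gJ PPow by (rule measurable_path_gen)
  have [measurable]: "(\<lambda>\<omega>. X b \<omega> - X s \<omega>) \<in> borel_measurable ?N"
  proof (rule measurableI)
    fix B :: "real set" assume B: "B \<in> sets borel"
    have "space M \<inter> I B \<in> P" unfolding P_def using topD B by blast
    moreover have "(\<lambda>\<omega>. X b \<omega> - X s \<omega>) -` B \<inter> space M = space M \<inter> I B" unfolding I_def by auto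
    ultimately show "(\<lambda>\<omega>. X b \<omega> - X s \<omega>) -` B \<inter> space ?N \<in> sets ?N" using PPow by auto
  qed simp
  have "(\<lambda>\<omega>. X s \<omega> + (X b \<omega> - X s \<omega>)) \<in> borel_measurable ?N" by measurable
  hence Xb: "X b \<in> borel_measurable ?N" by simp
  have "path_gen (insert b J) \<subseteq> sigma_sets (space M) P"
  proof -
    have "X b -` B \<inter> space M \<in> sigma_sets (space M) P" if "B \<in> sets borel" for B
      using measurable_sets[OF Xb that] PPow by simp
    hence "path_gen {b} \<subseteq> sigma_sets (space M) P" unfolding path_gen_def by auto
    moreover have "path_gen (insert b J) = path_gen {b} \<union> path_gen J" unfolding path_gen_def by auto
    ultimately show ?thesis using gJ by blast
  qed
  hence "sigma_sets (space M) (path_gen (insert b J)) \<subseteq> sigma_sets (space M) P" by (rule sigma_sets_mono)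
  thus ?thesis using ind' unfolding indep_sets2_eq by blast
qed

text \<open>Times are added in increasing order. Time 0 is always included, so a preceding time
  exists at every step; since paths start at 0, it contributes only trivial events.\<close>

lemma indep_finite_times:
  assumes T: "0 < T" and J: "finite J" "J \<subseteq> {0<..T}"
  shows "indep_set (sets (F 0)) (sigma_sets (space M) (path_gen (insert 0 J)))"
  using J
proof (induction J rule: finite_linorder_max_induct)
  case empty
  have T0: "0 \<in> {0..T}" using T by auto
  have "path_gen {0} \<subseteq> {{}, space M}"
  proof
    fix C assume "C \<in> path_gen {0}"
    then obtain B where "C = X 0 -` B \<inter> space M" unfolding path_gen_def by auto
    thus "C \<in> {{}, space M}" using start by (cases "0 \<in> B") auto
  qed
  hence "sigma_sets (space M) (path_gen {0}) \<subseteq> sigma_sets (space M) {}"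
    by (intro sigma_sets_mono) (simp add: sigma_sets_empty_eq)
  hence sub: "sigma_sets (space M) (path_gen {0}) \<subseteq> {{}, space M}" by (simp add: sigma_sets_empty_eq)
  show ?case
  proof (rule indep_setI)
    show "sets (F 0) \<subseteq> events" using sets_F[OF T0] by blast
    show "sigma_sets (space M) (path_gen {0}) \<subseteq> events" using sub by auto
    fix A E assume A: "A \<in> sets (F 0)" and "E \<in> sigma_sets (space M) (path_gen {0})"
    hence "E = {} \<or> E = space M" using sub by auto
    moreover have "A \<subseteq> space M" using sets_F[OF T0 A] sets.sets_into_space by auto
    ultimately show "prob (A \<inter> E) = prob A * prob E" by (auto simp: prob_space Int_absorb2)
  qed
next
  case (insert b J)
  define s where "s = Max (insert 0 J)"
  have sJ: "s \<in> insert 0 J" unfolding s_def using insert(1) by (intro Max_in) auto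
  have sup: "t \<le> s" if "t \<in> insert 0 J" for t unfolding s_def using insert(1) that by (intro Max_ge) auto
  have "indep_set (sets (F 0)) (sigma_sets (space M) (path_gen (insert b (insert 0 J))))"
  proof (rule indep_increment_step)
    show "indep_set (sets (F 0)) (sigma_sets (space M) (path_gen (insert 0 J)))" using insert by auto
    show "s < b" using sJ insert by auto
    show "insert 0 J \<subseteq> {0..s}" using sup insert by force
    show "0 \<le> s" using sup by auto
  qed (use sJ insert in auto)
  thus ?case by (simp add: insert_commute)
qed

text \<open>Events that depend on finitely many times form a pi-system, as two finite sets of times
  have a finite union, and they generate all path events.\<close>

lemma indep_paths:
  assumes T: "0 < T" and A: "A \<in> sets (F 0)" and E: "E \<in> sigma_sets (space M) (path_gen {0..T})"
  shows "prob (A \<inter> E) = prob A * prob E"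
proof -
  define \<J> where "\<J> = {J. finite J \<and> J \<subseteq> {0<..T}}"
  define U where "U = (\<Union>J\<in>\<J>. sigma_sets (space M) (path_gen (insert 0 J)))"
  have T0: "0 \<in> {0..T}" using T by auto
  have ind: "indep_set (sets (F 0)) (sigma_sets (space M) (path_gen (insert 0 J)))" if "J \<in> \<J>" for J
    using indep_finite_times[OF T] that unfolding \<J>_def by auto
  have "indep_set (sets (F 0)) U"
    using ind sets_F[OF T0] unfolding U_def indep_sets2_eq by blast
  hence "indep_set (sigma_sets (space M) (sets (F 0))) (sigma_sets (space M) U)"
  proof (rule indep_set_sigma_sets)
    show "Int_stable (sets (F 0))" by (auto simp: Int_stable_def)
    show "Int_stable U"
      unfolding Int_stable_def
    proof (intro ballI)
      fix C C' assume "C \<in> U" "C' \<in> U"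
      then obtain J J' where J: "J \<in> \<J>" "J' \<in> \<J>"
        and C: "C \<in> sigma_sets (space M) (path_gen (insert 0 J))" "C' \<in> sigma_sets (space M) (path_gen (insert 0 J'))"
        unfolding U_def by blast
      let ?J = "insert 0 (J \<union> J')"
      have "C \<in> sigma_sets (space M) (path_gen ?J)" "C' \<in> sigma_sets (space M) (path_gen ?J)"
        using C sigma_sets_subseteq[OF path_gen_mono[of "insert 0 J" ?J]] sigma_sets_subseteq[OF path_gen_mono[of "insert 0 J'" ?J]]
        by blast+
      hence "C \<inter> C' \<in> sigma_sets (space M) (path_gen ?J)"
        using sets.Int[of C "sigma (space M) (path_gen ?J)" C'] path_gen_Pow[of ?J] by simp
      moreover have "J \<union> J' \<in> \<J>" using J unfolding \<J>_def by auto
      ultimately show "C \<inter> C' \<in> U" unfolding U_def by blast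
    qed
  qed
  hence ind: "indep_set (sets (F 0)) (sigma_sets (space M) U)"
    using sets.sigma_sets_eq[of "F 0"] space_F[OF T0] by simp
  have "path_gen {0..T} \<subseteq> U"
  proof
    fix C assume "C \<in> path_gen {0..T}"
    then obtain t where t: "t \<in> {0..T}" "C \<in> path_gen {t}" unfolding path_gen_def by blast
    have "C \<in> path_gen (insert 0 (if t = 0 then {} else {t}))"
      using t(2) path_gen_mono[of "{t}" "insert 0 (if t = 0 then {} else {t})"] by auto
    moreover have "(if t = 0 then {} else {t}) \<in> \<J>" using t unfolding \<J>_def by auto
    ultimately show "C \<in> U" unfolding U_def by blast
  qed
  hence "sigma_sets (space M) (path_gen {0..T}) \<subseteq> sigma_sets (space M) U" by (rule sigma_sets_subseteq)
  thus ?thesis using indep_setD[OF ind A] E by blast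
qed

lemma indep_survives:
  assumes T: "0 < T" and d: "0 < d" and A: "A \<in> sets (F 0)"
  shows "prob (A \<inter> {\<omega> \<in> space M. survives T d (\<lambda>u. X u \<omega>)}) = prob A * prob {\<omega> \<in> space M. survives T d (\<lambda>u. X u \<omega>)}"
proof (rule indep_paths[OF T A])
  let ?N = "sigma (space M) (path_gen {0..T})"
  have "{\<omega> \<in> space M. survives T d (\<lambda>u. X u \<omega>)} \<in> sets ?N"
  proof (rule sets_survives[OF T d])
    show "X u \<in> borel_measurable ?N" if "u \<in> {0..T}" for u
      using that path_gen_Pow by (intro measurable_path_gen[of u "{0..T}"]) auto
  qed (use path_gen_Pow in auto)
  thus "{\<omega> \<in> space M. survives T d (\<lambda>u. X u \<omega>)} \<in> sigma_sets (space M) (path_gen {0..T})"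
    using path_gen_Pow by simp
qed

end

section \<open>The price of the bond\<close>

text \<open>The random times are arbitrary on the null set of bad paths; completeness makes events
  and functions defined through them measurable nevertheless.\<close>

lemma (in complete_measure) sets_eq_off_null:
  assumes N: "N \<in> null_sets M" and B: "B \<in> sets M" and A: "A \<subseteq> space M"
    and eq: "\<And>\<omega>. \<omega> \<in> space M \<Longrightarrow> \<omega> \<notin> N \<Longrightarrow> \<omega> \<in> A \<longleftrightarrow> \<omega> \<in> B"
  shows "A \<in> sets M"
proof -
  have "A \<inter> N \<in> sets M" using complete[OF _ N, of "A \<inter> N"] by auto
  moreover have "A = (B - N) \<union> (A \<inter> N)" using eq A B sets.sets_into_space by blast
  ultimately show ?thesis using B N by (metis null_setsD2 sets.Diff sets.Un)
qed

lemma (in complete_measure) measurable_eq_off_null: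
  assumes N: "N \<in> null_sets M" and g: "g \<in> measurable M R" and f: "\<And>\<omega>. \<omega> \<in> space M \<Longrightarrow> f \<omega> \<in> space R"
    and eq: "\<And>\<omega>. \<omega> \<in> space M \<Longrightarrow> \<omega> \<notin> N \<Longrightarrow> f \<omega> = g \<omega>"
  shows "f \<in> measurable M R"
proof (rule measurableI)
  fix B assume B: "B \<in> sets R"
  show "f -` B \<inter> space M \<in> sets M"
    by (rule sets_eq_off_null[OF N measurable_sets[OF g B]]) (use eq in auto)
qed (use f in auto)

text \<open>The path is set to 0 on one null set. This keeps it adapted because \<open>F 0\<close>
  contains all null sets.\<close>

lemma std_brownian_motion_version:
  assumes "std_brownian_motion M F T X" and T: "0 < T"
  obtains N X' where "N \<in> null_sets M" "cts_bm M F T X'" "\<And>\<omega> t. \<omega> \<notin> N \<Longrightarrow> X' t \<omega> = X t \<omega>"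
proof -
  interpret std_brownian_motion M F T X by fact
  have "AE \<omega> in M. X 0 \<omega> = 0 \<and> continuous_on {0..T} (\<lambda>t. X t \<omega>)"
    using initial continuous_paths by eventually_elim auto
  then obtain N where good: "{\<omega> \<in> space M. \<not> (X 0 \<omega> = 0 \<and> continuous_on {0..T} (\<lambda>t. X t \<omega>))} \<subseteq> N"
    and "emeasure M N = 0" "N \<in> sets M"
    by (rule AE_E)
  hence N: "N \<in> null_sets M" by blast
  define X' where "X' t \<omega> = (if \<omega> \<in> N then 0 else X t \<omega>)" for t \<omega>
  have X': "X' t \<omega> = X t \<omega>" if "\<omega> \<notin> N" for t \<omega> using that by (simp add: X'_def)
  have NF: "N \<in> sets (F t)" if "t \<in> {0..T}" for t
    using N null_sets_initial mono[of 0 t] that by auto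
  have spF: "space (F t) = space M" if "t \<in> {0..T}" for t using subalg[OF that] by (simp add: subalgebra_def)
  have ev: "A \<in> sets M" if "t \<in> {0..T}" "A \<in> sets (F t)" for t A using subalg[OF that(1)] that(2) by (auto simp: subalgebra_def)
  have Xm: "X t \<in> borel_measurable M" if "t \<in> {0..T}" for t
    by (rule measurable_from_subalg[OF subalg[OF that] adapted[OF that]])
  have "cts_bm M F T X'"
  proof (unfold_locales, goal_cases)
    case (1 t) thus ?case by (rule subalg)
  next
    case (2 s t) thus ?case by (rule mono)
  next
    case (3 t)
    note [measurable] = adapted[OF 3] NF[OF 3]
    show ?case unfolding X'_def by measurable
  next
    case (4 \<omega>) thus ?case using good by (auto simp: X'_def)
  next
    case (5 \<omega>)
    show ?case
    proof (cases "\<omega> \<in> N")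
      case False thus ?thesis using good 5 by (auto simp: X'_def)
    qed (simp add: X'_def)
  next
    case (6 s t A B)
    have st: "s \<in> {0..T}" "t \<in> {0..T}" using 6 by auto
    have w: "sqrt (t - s) > 0" using 6 by simp
    note [measurable] = Xm[OF st(1)] Xm[OF st(2)] 6(5) null_setsD2[OF N] ev[OF st(1) 6(4)]
    let ?Z = "\<lambda>\<omega>. (X t \<omega> - X s \<omega> - 0) / sqrt (t - s)"
    have Zd: "distributed M lborel ?Z std_normal_density"
      using increments_normal[OF 6(1-3)] unfolding normal_standard_normal_convert[OF w] by simp
    have C: "{z. sqrt (t - s) * z \<in> B} \<in> sets borel"
      using measurable_sets[of "\<lambda>z. sqrt (t - s) * z" borel borel B] 6(5) by (simp add: vimage_def)
    have "prob (A \<inter> {\<omega> \<in> space M. X' t \<omega> - X' s \<omega> \<in> B}) = prob (A \<inter> {\<omega> \<in> space M. X t \<omega> - X s \<omega> \<in> B})"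
    proof (rule measure_eq_AE)
      show "AE \<omega> in M. \<omega> \<in> A \<inter> {\<omega> \<in> space M. X' t \<omega> - X' s \<omega> \<in> B} \<longleftrightarrow> \<omega> \<in> A \<inter> {\<omega> \<in> space M. X t \<omega> - X s \<omega> \<in> B}"
        using AE_not_in[OF N] by eventually_elim (simp add: X')
    qed (unfold X'_def, measurable)
    also have "\<dots> = prob A * prob ((\<lambda>\<omega>. X t \<omega> - X s \<omega>) -` B \<inter> space M)"
    proof -
      have "{\<omega> \<in> space M. X t \<omega> - X s \<omega> \<in> B} = (\<lambda>\<omega>. X t \<omega> - X s \<omega>) -` B \<inter> space M" by auto
      moreover have "(\<lambda>\<omega>. X t \<omega> - X s \<omega>) -` B \<inter> space M \<in> {(\<lambda>\<omega>. X t \<omega> - X s \<omega>) -` B \<inter> space M | B. B \<in> sets borel}"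
        using 6(5) by blast
      ultimately show ?thesis using indep_setD[OF increments_indep[OF 6(1-3)] 6(4)] by presburger
    qed
    also have "(\<lambda>\<omega>. X t \<omega> - X s \<omega>) -` B \<inter> space M = ?Z -` {z. sqrt (t - s) * z \<in> B} \<inter> space M"
      using w by auto
    also have "prob \<dots> = measure (distr M lborel ?Z) {z. sqrt (t - s) * z \<in> B}"
      using C by (subst measure_distr) auto
    also have "distr M lborel ?Z = std_normal_distribution"
      using Zd by (rule distributed_distr_eq_density)
    finally show ?case .
  qed
  thus ?thesis using that N X' by blast
qed

lemma path_cong:
  assumes "\<And>t. X t \<omega> = Z t \<omega>"
  shows "last_zero X t \<omega> = last_zero Z t \<omega>"
    and "tau_alpha T \<alpha> X \<omega> = tau_alpha T \<alpha> Z \<omega>"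
    and "default_time T \<alpha> X \<omega> = default_time T \<alpha> Z \<omega>"
    and "reflected T \<alpha> X t \<omega> = reflected T \<alpha> Z t \<omega>"
proof -
  have lz: "last_zero X s \<omega> = last_zero Z s \<omega>" for s unfolding last_zero_def using assms by simp
  show "last_zero X t \<omega> = last_zero Z t \<omega>" by (rule lz)
  have lzl: "last_zero_left X s \<omega> = last_zero_left Z s \<omega>" for s unfolding last_zero_left_def lz ..
  show tau: "tau_alpha T \<alpha> X \<omega> = tau_alpha T \<alpha> Z \<omega>" unfolding tau_alpha_def lz lzl assms ..
  show "default_time T \<alpha> X \<omega> = default_time T \<alpha> Z \<omega>" unfolding default_time_def tau assms ..
  show "reflected T \<alpha> X t \<omega> = reflected T \<alpha> Z t \<omega>" unfolding reflected_def tau assms ..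
qed

text \<open>The market observes nothing but signs of X just after time 0: off a null set, Y differs
  from X no earlier than \<open>d\<close>. Right-continuity of \<open>F\<close> then brings this
  information down to \<open>F 0\<close>.\<close>

lemma sets_market_filtration_0:
  assumes bm: "std_brownian_motion M F T X" and T: "0 < T" and d: "0 < d"
    and N: "N \<in> null_sets M" and Y: "\<And>\<omega> u. \<omega> \<in> space M \<Longrightarrow> \<omega> \<notin> N \<Longrightarrow> u < d \<Longrightarrow> Y u \<omega> = X u \<omega>"
  shows "space (market_filtration M T Y 0) = space M"
    and "sets (market_filtration M T Y 0) \<subseteq> sets (F 0)"
proof -
  interpret std_brownian_motion M F T X by fact
  have G: "market_filtration M T Y 0 = sigma (space M) (\<Inter>s\<in>{0<..T}. sets (sign_sigma_complete M Y s))"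
    using T unfolding market_filtration_def by simp
  show "space (market_filtration M T Y 0) = space M" unfolding G by (rule space_measure_of_conv)
  have spF: "space (F t) = space M" if "t \<in> {0..T}" for t using subalg[OF that] by (simp add: subalgebra_def)
  have null: "A \<in> sets (F t)" if "A \<in> null_sets M" "t \<in> {0..T}" for A t
    using that null_sets_initial mono[of 0 t] by auto
  have sl[measurable]: "sign_left \<in> borel_measurable borel" unfolding sign_left_def[abs_def] by measurable
  have complete_F: "sets (sign_sigma_complete M Y s) \<subseteq> sets (F s)" if s: "0 < s" "s < d" "s \<le> T" for s
  proof -
    have sT: "s \<in> {0..T}" using s by auto
    have gen: "(\<lambda>\<omega>. sign_left (Y u \<omega>)) -` B \<inter> space M \<in> sets (F s)" if u: "u \<in> {0..s}" and B: "B \<in> sets borel" for u B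
    proof -
      have "X u \<in> borel_measurable (F s)"
      proof (rule measurable_from_subalg[OF _ adapted])
        show "subalgebra (F s) (F u)" using u s mono[of u s] spF by (auto simp: subalgebra_def)
      qed (use u s in auto)
      hence "(\<lambda>\<omega>. sign_left (X u \<omega>)) \<in> borel_measurable (F s)" by (rule measurable_compose[OF _ sl])
      from measurable_sets[OF this B] have "(\<lambda>\<omega>. sign_left (X u \<omega>)) -` B \<inter> space M \<in> sets (F s)" by (simp add: spF[OF sT])
      \<comment> \<open>On \<open>N\<close> the sign of \<open>Y\<close> is uncontrolled, but by
        completeness any part of \<open>N\<close> is again a null set and belongs to
        \<open>F s\<close>.\<close>
      moreover have NB: "N \<inter> ((\<lambda>\<omega>. sign_left (Y u \<omega>)) -` B \<inter> space M) \<in> sets (F s)"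
      proof (rule null[OF _ sT])
        have "N \<inter> ((\<lambda>\<omega>. sign_left (Y u \<omega>)) -` B \<inter> space M) \<in> sets M" by (rule complete[OF Int_lower1 N])
        thus "N \<inter> ((\<lambda>\<omega>. sign_left (Y u \<omega>)) -` B \<inter> space M) \<in> null_sets M"
          using null_sets_subset[OF N _ Int_lower1] by blast
      qed
      moreover have "(\<lambda>\<omega>. sign_left (Y u \<omega>)) -` B \<inter> space M =
          ((\<lambda>\<omega>. sign_left (X u \<omega>)) -` B \<inter> space M - N) \<union> (N \<inter> ((\<lambda>\<omega>. sign_left (Y u \<omega>)) -` B \<inter> space M))"
        using Y u s by auto
      ultimately show ?thesis using null[OF N sT] by (metis sets.Diff sets.Un)
    qed
    have "sets (sign_sigma M Y s) \<subseteq> sets (F s)"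
    proof -
      have "sigma_sets (space M) (\<Union>u\<in>{0..s}. {(\<lambda>\<omega>. sign_left (Y u \<omega>)) -` B \<inter> space M | B. B \<in> sets borel}) \<subseteq> sets (F s)"
        using gen unfolding spF[OF sT, symmetric] by (intro sets.sigma_sets_subset) auto
      thus ?thesis unfolding sign_sigma_def by (subst sets_measure_of) auto
    qed
    hence "sets (sign_sigma M Y s) \<union> null_sets M \<subseteq> sets (F s)" using null sT by blast
    moreover from this have "sets (sign_sigma M Y s) \<union> null_sets M \<subseteq> Pow (space M)"
      using sets.sets_into_space[of _ "F s"] spF[OF sT] by auto
    ultimately show ?thesis
      unfolding sign_sigma_complete_def using sets.sigma_sets_subset[of _ "F s"] spF[OF sT] by simp
  qed
  have "A \<in> sets (F 0)" if A: "A \<in> (\<Inter>s\<in>{0<..T}. sets (sign_sigma_complete M Y s))" for A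
  proof -
    have "A \<in> sets (F s)" if s: "s \<in> {0<..T}" for s
    proof -
      \<comment> \<open>Observation up to a time below \<open>d\<close> suffices, where the signs
        are still those of \<open>X\<close>.\<close>
      define s' where "s' = min s (d / 2)"
      have s': "0 < s'" "s' < d" "s' \<le> s" "s' \<in> {0<..T}" using s d by (auto simp: s'_def)
      have "A \<in> sets (F s')" using A complete_F[of s'] s' by auto
      thus ?thesis using mono[of s' s] s' s by auto
    qed
    thus ?thesis using right_continuous[of 0] T by auto
  qed
  hence sub: "(\<Inter>s\<in>{0<..T}. sets (sign_sigma_complete M Y s)) \<subseteq> sets (F 0)" by blast
  moreover have "\<dots> \<subseteq> Pow (space M)" using sets.sets_into_space[of _ "F 0"] spF[of 0] T by auto
  ultimately have "sets (market_filtration M T Y 0) = sigma_sets (space M) (\<Inter>s\<in>{0<..T}. sets (sign_sigma_complete M Y s))"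
    unfolding G by (intro sets_measure_of) (rule order_trans)
  thus "sets (market_filtration M T Y 0) \<subseteq> sets (F 0)"
    using sets.sigma_sets_subset[OF sub] spF[of 0] T by simp
qed

theorem mainTheorem2:
  fixes M :: "'a measure" and F :: "real \<Rightarrow> 'a measure" and T \<alpha> :: real
    and X Y :: "real \<Rightarrow> 'a \<Rightarrow> real" and \<tau>\<^sub>\<alpha> \<tau> :: "'a \<Rightarrow> ereal"
    and G :: "real \<Rightarrow> 'a measure" and r :: "real \<Rightarrow> real" and S\<^sub>0 :: "'a \<Rightarrow> real"
  assumes "T > 0" and "\<alpha> > 0"
    and "std_brownian_motion M F T X"
    and "set_integrable lebesgue {0..T} r"
    and "\<tau>\<^sub>\<alpha> = tau_alpha T \<alpha> X"
    and "\<tau> = default_time T \<alpha> X"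
    and "Y = reflected T \<alpha> X"
    and "G = market_filtration M T Y"
    and "S\<^sub>0 = (\<lambda>\<omega>. real_cond_exp M (G 0)
           (\<lambda>\<omega>'. exp (- (LINT u:{0..T}|lebesgue. r u)) * indicator {\<omega> \<in> space M. \<tau> \<omega> > ereal T} \<omega>') \<omega>
           * indicator {\<omega> \<in> space M. \<tau> \<omega> > 0} \<omega>)"
  shows "AE \<omega> in M. S\<^sub>0 \<omega> =
    exp (- (LINT u:{0..T}|lebesgue. r u)) *
    (1 - (measure M {\<omega> \<in> space M. \<tau>\<^sub>\<alpha> \<omega> \<le> ereal T}
          - (LINT \<omega>|M. (\<alpha> / sqrt 2) / sqrt (T - last_zero Y (real_of_ereal (\<tau>\<^sub>\<alpha> \<omega>)) \<omega>)
               * indicator {\<omega> \<in> space M. \<tau>\<^sub>\<alpha> \<omega> \<le> ereal T} \<omega>)))"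
proof -
  interpret B: std_brownian_motion M F T X by fact
  note T = assms(1)
  define d where "d = \<alpha>\<^sup>2 / 2"
  have d: "d = \<alpha>\<^sup>2 / 2" "0 < d" using assms(2) by (auto simp: d_def)
  \<comment> \<open>The numerator in the price formula is the factor \<open>sqrt d\<close> in the
    limit of the ratio.\<close>
  have sqrt_d: "\<alpha> / sqrt 2 = sqrt d" using assms(2) by (simp add: d_def real_sqrt_divide)
  define c where "c = exp (- (LINT u:{0..T}|lebesgue. r u))"
  obtain N X' where N: "N \<in> null_sets M" and C: "cts_bm M F T X'" and X': "\<And>\<omega> t. \<omega> \<notin> N \<Longrightarrow> X' t \<omega> = X t \<omega>"
    by (rule std_brownian_motion_version[OF assms(3) T]) (rule that)
  interpret C: cts_bm M F T X' by fact
  have notN: "AE \<omega> in M. \<omega> \<notin> N" by (rule AE_not_in[OF N])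

  let ?x = "\<lambda>\<omega> u. X' u \<omega>"
  define Q where "Q = {\<omega> \<in> space M. survives T d (?x \<omega>)}"
  define R where "R = {\<omega> \<in> space M. neg_runs T d (?x \<omega>) \<noteq> {}}"
  \<comment> \<open>The integrand of the claim for the continuous version. Its indicator removes the
    outcomes with infinite time, where \<open>real_of_ereal\<close> returns 0.\<close>
  define K where "K \<omega> = (\<alpha> / sqrt 2) / sqrt (T - last_zero (reflected T \<alpha> X') (real_of_ereal (tau_alpha T \<alpha> X' \<omega>)) \<omega>)
    * indicator {\<omega> \<in> space M. tau_alpha T \<alpha> X' \<omega> \<le> ereal T} \<omega>" for \<omega>

  have tau_le: "tau_alpha T \<alpha> X' \<omega> \<le> ereal T \<longleftrightarrow> \<omega> \<in> R" and tau_ge: "ereal d \<le> tau_alpha T \<alpha> X' \<omega>"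
    and default: "default_time T \<alpha> X' \<omega> > ereal T \<longleftrightarrow> \<omega> \<in> Q" if \<omega>: "\<omega> \<in> space M" for \<omega>
  proof -
    note cx = C.cont[OF \<omega>] C.start[OF \<omega>]
    have "(tau_alpha T \<alpha> X' \<omega> \<le> ereal T \<longleftrightarrow> \<omega> \<in> R) \<and> ereal d \<le> tau_alpha T \<alpha> X' \<omega> \<and> (default_time T \<alpha> X' \<omega> > ereal T \<longleftrightarrow> \<omega> \<in> Q)"
    proof (cases "neg_runs T d (?x \<omega>) = {}")
      case True
      hence "survives T d (?x \<omega>)" unfolding survives_def first_run_def by simp
      thus ?thesis using tau_alpha_cases(2)[where X=X' and \<omega>=\<omega>, OF cx d True] default_time_cases(3)[where X=X' and \<omega>=\<omega>, OF cx d True] True \<omega>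
        by (simp add: R_def Q_def)
    next
      case False
      then obtain a where a: "first_run T d (?x \<omega>) a" using first_run_ex[OF d(2)] by blast
      have aT: "0 \<le> a" "a + d \<le> T" using a unfolding first_run_def neg_runs_def by auto
      have "survives T d (?x \<omega>) \<longleftrightarrow> (\<forall>u\<in>{a + d..T}. X' u \<omega> > 2 * X' (a + d) \<omega>)"
        unfolding survives_def using a first_run_unique[OF a] by metis
      thus ?thesis using tau_alpha_cases(1)[where X=X' and \<omega>=\<omega>, OF cx d a] default_time_cases(2)[where X=X' and \<omega>=\<omega>, OF cx d a] False \<omega> aT
        by (simp add: R_def Q_def)
    qed
    thus "tau_alpha T \<alpha> X' \<omega> \<le> ereal T \<longleftrightarrow> \<omega> \<in> R" "ereal d \<le> tau_alpha T \<alpha> X' \<omega>"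
      "default_time T \<alpha> X' \<omega> > ereal T \<longleftrightarrow> \<omega> \<in> Q" by auto
  qed
  have Q: "Q \<in> sets M" unfolding Q_def by (rule C.sets_survives[OF T d(2)]) (auto intro: C.X_measurable)
  have R: "R \<in> sets M" unfolding R_def by (rule C.sets_run_until[OF T d(2)])
  have K1: "K \<omega> = sqrt d / sqrt (T - a)" if "\<omega> \<in> space M" "first_run T d (?x \<omega>) a" for \<omega> a
  proof -
    have "last_zero (reflected T \<alpha> X') (real_of_ereal (tau_alpha T \<alpha> X' \<omega>)) \<omega> = a"
      using C.cont[OF that(1)] C.start[OF that(1)] d that(2) by (rule last_zero_reflected)
    moreover have "\<omega> \<in> R" using that unfolding R_def first_run_def by auto
    ultimately show ?thesis using tau_le[OF that(1)] that(1) sqrt_d unfolding K_def by simp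
  qed
  have K0: "K \<omega> = 0" if "\<omega> \<in> space M" "neg_runs T d (?x \<omega>) = {}" for \<omega>
    using tau_le[OF that(1)] that unfolding K_def R_def by simp
  have formula: "measure M Q = 1 - (measure M R - (LINT \<omega>|M. K \<omega>))" "K \<in> borel_measurable M"
    using C.prob_survives[OF T d(2), of K] K1 K0 unfolding Q_def R_def by simp_all

  have ev_eq: "A \<in> sets M" "measure M (A' \<inter> A) = measure M (A' \<inter> B)"
    if "A \<subseteq> space M" "B \<in> sets M" "A' \<in> sets M" "\<And>\<omega>. \<omega> \<in> space M \<Longrightarrow> \<omega> \<notin> N \<Longrightarrow> \<omega> \<in> A \<longleftrightarrow> \<omega> \<in> B" for A A' B
  proof -
    show A: "A \<in> sets M" by (rule B.sets_eq_off_null[OF N that(2,1,4)])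
    show "measure M (A' \<inter> A) = measure M (A' \<inter> B)"
    proof (rule measure_eq_AE)
      show "AE \<omega> in M. \<omega> \<in> A' \<inter> A \<longleftrightarrow> \<omega> \<in> A' \<inter> B"
        using notN AE_space by eventually_elim (use that(4) in blast)
    qed (use that A in auto)
  qed
  define D where "D = {\<omega> \<in> space M. \<tau> \<omega> > ereal T}"
  have D_Q: "\<omega> \<in> D \<longleftrightarrow> \<omega> \<in> Q" if "\<omega> \<in> space M" "\<omega> \<notin> N" for \<omega>
    using default[OF that(1)] path_cong(3)[of X' \<omega> X, OF X'[OF that(2)]] that(1) unfolding D_def assms(6) by simp
  have L_R: "\<omega> \<in> {\<omega> \<in> space M. \<tau>\<^sub>\<alpha> \<omega> \<le> ereal T} \<longleftrightarrow> \<omega> \<in> R" if "\<omega> \<in> space M" "\<omega> \<notin> N" for \<omega>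
    using tau_le[OF that(1)] path_cong(2)[of X' \<omega> X, OF X'[OF that(2)]] that(1) unfolding assms(5) by simp
  have Dev: "D \<in> sets M" by (rule ev_eq(1)[OF _ Q _ D_Q]) (auto simp: D_def)
  have prob_L: "measure M {\<omega> \<in> space M. \<tau>\<^sub>\<alpha> \<omega> \<le> ereal T} = measure M R"
    using ev_eq(2)[OF _ R sets.top L_R] sets.sets_into_space[OF R] by (simp add: Int_absorb1)
  have int_K: "(LINT \<omega>|M. (\<alpha> / sqrt 2) / sqrt (T - last_zero Y (real_of_ereal (\<tau>\<^sub>\<alpha> \<omega>)) \<omega>)
               * indicator {\<omega> \<in> space M. \<tau>\<^sub>\<alpha> \<omega> \<le> ereal T} \<omega>) = (LINT \<omega>|M. K \<omega>)" (is "integral\<^sup>L M ?k = _")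
  proof -
    have k: "?k \<omega> = K \<omega>" if "\<omega> \<in> space M" "\<omega> \<notin> N" for \<omega>
    proof -
      have tau: "\<tau>\<^sub>\<alpha> \<omega> = tau_alpha T \<alpha> X' \<omega>" unfolding assms(5) by (rule path_cong(2)[where X=X' and Z=X and \<omega>=\<omega>, OF X'[OF that(2)], symmetric])
      have "reflected T \<alpha> X' t \<omega> = Y t \<omega>" for t unfolding assms(7) by (rule path_cong(4)[where X=X' and Z=X and \<omega>=\<omega>, OF X'[OF that(2)]])
      from path_cong(1)[where X="reflected T \<alpha> X'" and Z=Y and \<omega>=\<omega>, OF this] show ?thesis
        unfolding K_def tau using that(1) tau by (simp add: indicator_def)
    qed
    \<comment> \<open>Equality almost everywhere transfers the integral only between measurable
      functions; this measurability is inherited from \<open>K\<close> by completeness.\<close>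
    have "?k \<in> borel_measurable M"
      by (rule B.measurable_eq_off_null[OF N formula(2) _ k]) auto
    moreover have "AE \<omega> in M. ?k \<omega> = K \<omega>" using notN AE_space by eventually_elim (rule k)
    ultimately show ?thesis using formula(2) by (intro integral_cong_AE)
  qed

  have Y_X: "Y u \<omega> = X u \<omega>" if "\<omega> \<in> space M" "\<omega> \<notin> N" "u < d" for \<omega> u
  proof -
    have "ereal u < tau_alpha T \<alpha> X' \<omega>" using tau_ge[OF that(1)] that(3) by (metis ereal_less_eq(3) less_le_trans less_ereal.simps(1))
    thus ?thesis unfolding assms(7) reflected_def path_cong(2)[of X' \<omega> X, OF X'[OF that(2)]] by simp
  qed
  note G = sets_market_filtration_0[OF assms(3) T d(2) N Y_X, folded assms(8)]
  have F0: "0 \<in> {0..T}" using T by simp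
  have sub: "subalgebra M (G 0)" using G C.sets_F[OF F0] unfolding subalgebra_def by auto
  interpret G: sigma_finite_subalgebra M "G 0"
    by (rule finite_measure_subalgebra_is_sigma_finite) (use sub in \<open>unfold_locales, auto\<close>)
  \<comment> \<open>Over every event in \<open>G 0\<close>, hence in \<open>F 0\<close>,
    independence factorises the integral, so a constant meets the defining property of the
    conditional expectation.\<close>
  have cond: "AE \<omega> in M. real_cond_exp M (G 0) (\<lambda>\<omega>'. c * indicator D \<omega>') \<omega> = c * measure M Q"
  proof (rule G.real_cond_exp_charact)
    fix A assume "A \<in> sets (G 0)"
    hence A: "A \<in> sets (F 0)" using G by auto
    have AM: "A \<in> sets M" by (rule C.sets_F[OF F0 A])
    have "(LINT \<omega>:A|M. c * indicator D \<omega>) = (LINT \<omega>|M. c * indicator (A \<inter> D) \<omega>)"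
      unfolding set_lebesgue_integral_def by (intro Bochner_Integration.integral_cong) (auto simp: indicator_def)
    also have "\<dots> = c * measure M (A \<inter> D)" using AM Dev by simp
    also have "measure M (A \<inter> D) = measure M (A \<inter> Q)" by (rule ev_eq(2)[OF _ Q AM D_Q]) (auto simp: D_def)
    also have "\<dots> = measure M A * measure M Q" unfolding Q_def by (rule C.indep_survives[OF T d(2) A])
    also have "c * (measure M A * measure M Q) = (LINT \<omega>:A|M. c * measure M Q)"
      unfolding set_lebesgue_integral_def using AM by simp
    finally show "(LINT \<omega>:A|M. c * indicator D \<omega>) = (LINT \<omega>:A|M. c * measure M Q)" .
  next
    show "integrable M (\<lambda>\<omega>. c * indicator D \<omega> :: real)"
      using Dev by (intro integrable_mult_right integrable_real_indicator) (simp_all add: less_top[symmetric])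
  qed auto
  have "AE \<omega> in M. S\<^sub>0 \<omega> = c * measure M Q"
    using cond notN AE_space
  proof eventually_elim
    case (elim \<omega>)
    \<comment> \<open>Default cannot precede the completion of a run of positive length, so the last
      indicator in the price equals 1 almost surely.\<close>
    have "\<tau> \<omega> > 0"
      using default_time_cases(1)[where X=X' and \<omega>=\<omega>, OF C.cont[OF elim(3)] C.start[OF elim(3)] d]
      unfolding assms(6) path_cong(3)[of X' \<omega> X, OF X'[OF elim(2)]] .
    hence "indicator {\<omega> \<in> space M. \<tau> \<omega> > 0} \<omega> = (1 :: real)" using elim(3) by simp
    moreover have "S\<^sub>0 \<omega> = real_cond_exp M (G 0) (\<lambda>\<omega>'. c * indicator D \<omega>') \<omega> * indicator {\<omega> \<in> space M. \<tau> \<omega> > 0} \<omega>"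
      unfolding assms(9) c_def D_def ..
    ultimately show ?case using elim(1) by (simp only: mult_1_right)
  qed
  thus ?thesis unfolding formula(1) prob_L int_K c_def .
qed

end
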